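(* Let $\Phi:\Omega_\zeta\to\mathbb{H}(\mathbb{C})$ (respectively $\widehat{\Phi}:\Omega_\zeta\to\mathbb{H}(\mathbb{C})$) be a mapping. (A) $\Phi$ is right-$G$-monogenic (respectively $\widehat\Phi$ is left-$G$-monogenic) in the domain $\Omega_\zeta\subset E_3$ if and only if condition (I) holds, and likewise if and only if condition (II) holds: (I) the components $U_k:\Omega\to\mathbb{C}$ of the mapping with respect to the basis $\{e_1,e_2,e_3,e_4\}$ are $\mathbb{R}$-differentiable in $\Omega$ and at every point of $\Omega_\zeta$ $$\frac{\partial\Phi}{\partial y}=i_2\frac{\partial\Phi}{\partial x},\quad \frac{\partial\Phi}{\partial z}=i_3\frac{\partial\Phi}{\partial x}\qquad\Big(\text{respectively } \frac{\partial\widehat\Phi}{\partial y}=\frac{\partial\widehat\Phi}{\partial x}i_2,\quad \frac{\partial\widehat\Phi}{\partial z}=\frac{\partial\widehat\Phi}{\partial x}i_3\Big);$$ (II) the components $U_k:\Omega\to\mathbb{C}$ are $\mathbb{R}$-differentiable in $\Omega$ and $\Phi$ is right-$H$-monogenic (respectively $\widehat\Phi$ is left-$H$-monogenic) in $\Omega_\zeta$. (B) If $f_1(E_3)=f_2(E_3)=\mathbb{C}$, then $\Phi$ is right-$G$-monogenic (respectively $\widehat\Phi$ is left-$G$-monogenic) in $\Omega_\zeta$ if and only if condition (III) holds, and likewise if and only if condition (IV) holds: (III) every point $\zeta_0\in\Omega_\zeta$ has a neighbourhood in which the mapping is the sum of a convergent power series $\Phi(\zeta)=\sum_{n=0}^\infty(\zeta-\zeta_0)^n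 p_n$, $p_n\in\mathbb{H}(\mathbb{C})$ (respectively $\widehat\Phi(\zeta)=\sum_{n=0}^\infty\widehat p_n(\zeta-\zeta_0)^n$, $\widehat p_n\in\mathbb{H}(\mathbb{C})$); (IV) the mapping is continuous in $\Omega_\zeta$ and $\int_{\partial\Delta_\zeta}d\zeta\,\Phi(\zeta)=0$ (respectively $\int_{\partial\Delta_\zeta}\widehat\Phi(\zeta)\,d\zeta=0$) for every triangle $\Delta_\zeta$ such that $\overline{\Delta_\zeta}\subset\Omega_\zeta$. (C) If $f_1(E_3)=f_2(E_3)=\mathbb{C}$ and, in addition, $\Omega\subset\mathbb{R}^3$ is convex in the direction of the lines $L^1,L^2$, then $\Phi$ is right-$G$-monogenic (respectively $\widehat\Phi$ is left-$G$-monogenic) in $\Omega_\zeta$ if and only if (V) there exist unique functions $F_1,F_3$ (respectively $\widehat F_1,\widehat F_4$) analytic in the domain $D_1:=\{\xi_1=x+a_1y+b_1z:(x,y,z)\in\Omega\}$ and unique functions $F_2,F_4$ (respectively $\widehat F_2,\widehat F_3$) analytic in the domain $D_2:=\{\xi_2=x+a_2y+b_2z:(x,y,z)\in\Omega\}$ such that for all $\zeta=xi_1+yi_2+zi_3\in\Omega_\zeta$ $$\Phi(\zeta)=F_1(\xi_1)e_1+F_2(\xi_2)e_2+F_3(\xi_1)e_3+F_4(\xi_2)e_4$$ $$\Big(\text{respectively } \widehat\Phi(\zeta)=\widehat F_1(\xi_1)e_1+\widehat F_2(\xi_2)e_2+\widehat F_3(\xi_2)e_3+\widehat F_4(\xi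_1)e_4\Big).$$
   Context: $\mathbb{H}(\mathbb{C})$ is the algebra of quaternions over $\mathbb{C}$ with basis $1,I,J,K$ ($I^2=J^2=K^2=-1$, $IJ=-JI=K$, $JK=-KJ=I$, $KI=-IK=J$). With $i$ the imaginary complex unit, another basis is $e_1=\frac12(1+iI)$, $e_2=\frac12(1-iI)$, $e_3=\frac12(iJ-K)$, $e_4=\frac12(iJ+K)$, with nonzero products $e_1e_1=e_1$, $e_1e_3=e_3$, $e_2e_2=e_2$, $e_2e_4=e_4$, $e_3e_2=e_3$, $e_3e_4=e_1$, $e_4e_1=e_4$, $e_4e_3=e_2$ (all other products of basis elements are $0$) and $1=e_1+e_2$. As a topological vector space $\mathbb{H}(\mathbb{C})\cong\mathbb{C}^4$. Fix $a_1,a_2,b_1,b_2\in\mathbb{C}$ such that $i_1=1$, $i_2=a_1e_1+a_2e_2$, $i_3=b_1e_1+b_2e_2$ are linearly independent over $\mathbb{R}$. Let $E_3=\{\zeta=xi_1+yi_2+zi_3: x,y,z\in\mathbb{R}\}$. For $S\subset\mathbb{R}^3$ put $S_\zeta=\{xi_1+yi_2+zi_3:(x,y,z)\in S\}\subset E_3$; $\Omega$ is a domain in $\mathbb{R}^3$. A mapping on $\Omega_\zeta$ is decomposed as $\Phi(\zeta)=\sum_{k=1}^4U_k(x,y,z)e_k$, $U_k:\Omega\to\mathbb{C}$ (similarly for $\widehat\Phi$). $\mathbb{R}$-differentiable means (totally, Fréchet) differentiable as a function of the real variables $(x,y,z)$ at every point. $f_1,f_2:\mathbb{H}(\mathbb{C})\to\mathbb{C}$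 are the linear functionals with $f_1(e_1)=f_1(e_3)=1$, $f_1(e_2)=f_1(e_4)=0$, $f_2(e_2)=f_2(e_4)=1$, $f_2(e_1)=f_2(e_3)=0$. For $\zeta=xi_1+yi_2+zi_3$ write $\xi_k=f_k(\zeta)=x+ya_k+zb_k$, $k=1,2$, so $\zeta=\xi_1e_1+\xi_2e_2$. $L^k\subset\mathbb{R}^3$ is the line $\{x+y\,\mathrm{Re}\,a_k+z\,\mathrm{Re}\,b_k=0,\ y\,\mathrm{Im}\,a_k+z\,\mathrm{Im}\,b_k=0\}$. $\Omega$ is convex in the direction of a line if it contains every segment parallel to that line whose endpoints lie in $\Omega$. $G$-monogenic: a continuous mapping $\Phi:\Omega_\zeta\to\mathbb{H}(\mathbb{C})$ is right-$G$-monogenic in $\Omega_\zeta$ if for every $\zeta\in\Omega_\zeta$ there is $\Phi'(\zeta)\in\mathbb{H}(\mathbb{C})$ with $\lim_{\varepsilon\to0+0}(\Phi(\zeta+\varepsilon h)-\Phi(\zeta))\varepsilon^{-1}=h\,\Phi'(\zeta)$ for all $h\in E_3$. A continuous mapping $\widehat\Phi$ is left-$G$-monogenic in $\Omega_\zeta$ if for every $\zeta\in\Omega_\zeta$ there is $\widehat\Phi'(\zeta)\in\mathbb{H}(\mathbb{C})$ with $\lim_{\varepsilon\to0+0}(\widehat\Phi(\zeta+\varepsilon h)-\widehat\Phi(\zeta))\varepsilon^{-1}=\widehat\Phi'(\zeta)\,h$ for all $h\in E_3$. $H$-monogenic: a continuous mapping $\Phi=\sum_kU_ke_k$ is $H$-monogenic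 in $\Omega_\zeta$ if the $U_k$ have first-order partial derivatives in $x,y,z$ and $d\Phi:=\sum_{k=1}^4\left(\frac{\partial U_k}{\partial x}dx+\frac{\partial U_k}{\partial y}dy+\frac{\partial U_k}{\partial z}dz\right)e_k$ can be written as $d\Phi=\sum_{s=1}^{16}A_s\,d\zeta\,B_s$ with some $\mathbb{H}(\mathbb{C})$-valued functions $A_s,B_s$ on $\Omega_\zeta$, where $d\zeta=dx+i_2dy+i_3dz$ (equality as linear forms in $dx,dy,dz$). Its Hausdorff derivative is $\Phi'_H(\zeta):=\sum_{s=1}^{16}A_sB_s$ (well defined, equal to $\frac{\partial\Phi}{\partial x}$). An $H$-monogenic mapping $\Phi$ is right-$H$-monogenic if $d\Phi=d\zeta\,\Phi'_H(\zeta)$; an $H$-monogenic mapping $\widehat\Phi$ is left-$H$-monogenic if $d\widehat\Phi=\widehat\Phi'_H(\zeta)\,d\zeta$. Integrals: for a Jordan rectifiable curve $\gamma\subset\mathbb{R}^3$ and continuous $\Psi:\gamma_\zeta\to\mathbb{H}(\mathbb{C})$, $\Psi(\zeta)=\sum_{k=1}^4W_k(x,y,z)e_k$ with $W_k:\gamma\to\mathbb{C}$, put $\int_{\gamma_\zeta}d\zeta\,\Psi(\zeta):=\sum_{k=1}^4\left(e_k\int_\gamma W_k\,dx+i_2e_k\int_\gamma W_k\,dy+i_3e_k\int_\gamma W_k\,dz\right)$ and $\int_{\gamma_\zeta}\Psi(\zeta)\,d\zeta:=\sum_{k=1}^4\left(e_k\int_\gamma W_k\,dx+e_ki_2\int_\gamma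 W_k\,dy+e_ki_3\int_\gamma W_k\,dz\right)$. A triangle $\Delta$ is a plane figure in $\mathbb{R}^3$ bounded by three segments joining its three vertices, and $\partial\Delta$ is its boundary in the relative topology of its plane; $\Delta_\zeta$, $\partial\Delta_\zeta$ are the corresponding sets in $E_3$. *)

theory Defs
  imports "HOL-Analysis.Analysis"
begin

section \<open>The algebra of quaternions over the complex numbers\<close>

text \<open>\<open>CQuat w x y z\<close> is \<open>w + x I + y J + z K\<close> with complex coefficients.\<close>

datatype cquat = CQuat (cq1: complex) (cqI: complex) (cqJ: complex) (cqK: complex)

lemma cquat_eq_iff:
  "p = q \<longleftrightarrow> cq1 p = cq1 q \<and> cqI p = cqI q \<and> cqJ p = cqJ q \<and> cqK p = cqK q"
  by (cases p; cases q) auto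

instantiation cquat :: ring_1
begin

definition zero_cquat where "0 = CQuat 0 0 0 0"
definition one_cquat where "1 = CQuat 1 0 0 0"
definition plus_cquat where
  "p + q = CQuat (cq1 p + cq1 q) (cqI p + cqI q) (cqJ p + cqJ q) (cqK p + cqK q)"
definition uminus_cquat where
  "- p = CQuat (- cq1 p) (- cqI p) (- cqJ p) (- cqK p)"
definition minus_cquat where
  "p - q = CQuat (cq1 p - cq1 q) (cqI p - cqI q) (cqJ p - cqJ q) (cqK p - cqK q)"
definition times_cquat where
  "p * q = CQuat
     (cq1 p * cq1 q - cqI p * cqI q - cqJ p * cqJ q - cqK p * cqK q)
     (cq1 p * cqI q + cqI p * cq1 q + cqJ p * cqK q - cqK p * cqJ q)
     (cq1 p * cqJ q - cqI p * cqK q + cqJ p * cq1 q + cqK p * cqI q)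
     (cq1 p * cqK q + cqI p * cqJ q - cqJ p * cqI q + cqK p * cq1 q)"

instance
  by standard
    (simp_all add: cquat_eq_iff zero_cquat_def one_cquat_def plus_cquat_def uminus_cquat_def
      minus_cquat_def times_cquat_def algebra_simps)

end

instantiation cquat :: real_algebra_1
begin

definition scaleR_cquat where
  "r *\<^sub>R q = CQuat (r *\<^sub>R cq1 q) (r *\<^sub>R cqI q) (r *\<^sub>R cqJ q) (r *\<^sub>R cqK q)"

instance
  by standard
    (simp_all add: cquat_eq_iff scaleR_cquat_def plus_cquat_def times_cquat_def algebra_simps)

end

text \<open>The norm (hence the topology) is that of the product space of four copies of \<open>complex\<close>.\<close>

instantiation cquat :: real_normed_vector
begin

definition norm_cquat_def: "norm (q::cquat) = norm (cq1 q, cqI q, cqJ q, cqK q)"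
definition sgn_cquat_def: "sgn (q::cquat) = q /\<^sub>R norm q"
definition dist_cquat_def: "dist p (q::cquat) = norm (p - q)"
definition uniformity_cquat_def: "(uniformity :: (cquat \<times> cquat) filter) =
  (INF e\<in>{0 <..}. principal {(p, q). dist p q < e})"
definition open_cquat_def: "open (U :: cquat set) \<longleftrightarrow>
  (\<forall>p\<in>U. eventually (\<lambda>(p', q). p' = p \<longrightarrow> q \<in> U) uniformity)"

instance
proof
  fix r :: real and p q :: cquat and U :: "cquat set"
  show "dist p q = norm (p - q)" by (rule dist_cquat_def)
  show "sgn p = p /\<^sub>R norm p" by (rule sgn_cquat_def)
  show "uniformity = (INF e\<in>{0 <..}. principal {(p::cquat, q). dist p q < e})"
    by (rule uniformity_cquat_def)
  show "open U \<longleftrightarrow> (\<forall>p\<in>U. eventually (\<lambda>(p', q). p' = p \<longrightarrow> q \<in> U) uniformity)"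
    by (rule open_cquat_def)
  show "norm p = 0 \<longleftrightarrow> p = 0"
    by (simp add: norm_cquat_def cquat_eq_iff zero_cquat_def prod_eq_iff)
  have "norm (p + q) =
      norm ((cq1 p, cqI p, cqJ p, cqK p) + (cq1 q, cqI q, cqJ q, cqK q))"
    by (simp add: norm_cquat_def plus_cquat_def)
  also have "\<dots> \<le> norm p + norm q"
    unfolding norm_cquat_def by (rule norm_triangle_ineq)
  finally show "norm (p + q) \<le> norm p + norm q" .
  have "norm (r *\<^sub>R p) = norm (r *\<^sub>R (cq1 p, cqI p, cqJ p, cqK p))"
    by (simp add: norm_cquat_def scaleR_cquat_def)
  then show "norm (r *\<^sub>R p) = \<bar>r\<bar> * norm p"
    by (simp only: norm_scaleR norm_cquat_def)
qed

end

definition scaleC :: "complex \<Rightarrow> cquat \<Rightarrow> cquat" (infixr \<open>*\<^sub>C\<close> 75) where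
  "c *\<^sub>C q = CQuat (c * cq1 q) (c * cqI q) (c * cqJ q) (c * cqK q)"

lemma scaleC_mult: "c *\<^sub>C (p * q) = (c *\<^sub>C p) * q" "c *\<^sub>C (p * q) = p * (c *\<^sub>C q)"
  by (simp_all add: cquat_eq_iff scaleC_def times_cquat_def algebra_simps)

lemma scaleC_of_real: "complex_of_real r *\<^sub>C q = r *\<^sub>R q"
  by (simp add: cquat_eq_iff scaleC_def scaleR_cquat_def scaleR_conv_of_real)

definition qI :: cquat where "qI = CQuat 0 1 0 0"
definition qJ :: cquat where "qJ = CQuat 0 0 1 0"
definition qK :: cquat where "qK = CQuat 0 0 0 1"

lemma cquat_decomp: "q = cq1 q *\<^sub>C 1 + cqI q *\<^sub>C qI + cqJ q *\<^sub>C qJ + cqK q *\<^sub>C qK"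
  by (simp add: cquat_eq_iff scaleC_def plus_cquat_def one_cquat_def qI_def qJ_def qK_def)

lemma quaternion_units:
  "qI * qI = - 1" "qJ * qJ = - 1" "qK * qK = - 1"
  "qI * qJ = qK" "qJ * qI = - qK" "qJ * qK = qI" "qK * qJ = - qI" "qK * qI = qJ" "qI * qK = - qJ"
  by (simp_all add: cquat_eq_iff times_cquat_def uminus_cquat_def one_cquat_def
      qI_def qJ_def qK_def)


section \<open>The basis \<open>e\<^sub>1, e\<^sub>2, e\<^sub>3, e\<^sub>4\<close>\<close>

text \<open>The index type is \<open>4\<close>, in which \<open>4 = 0\<close>; its elements are \<open>1, 2, 3, 4\<close>.\<close>

definition ebas :: "4 \<Rightarrow> cquat" where
  "ebas k =
     (if k = 1 then (1/2) *\<^sub>C (1 + \<i> *\<^sub>C qI)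
      else if k = 2 then (1/2) *\<^sub>C (1 - \<i> *\<^sub>C qI)
      else if k = 3 then (1/2) *\<^sub>C (\<i> *\<^sub>C qJ - qK)
      else (1/2) *\<^sub>C (\<i> *\<^sub>C qJ + qK))"

lemma ebas_explicit:
  "ebas 1 = CQuat (1/2) (\<i>/2) 0 0" "ebas 2 = CQuat (1/2) (- \<i>/2) 0 0"
  "ebas 3 = CQuat 0 0 (\<i>/2) (- 1/2)" "ebas 4 = CQuat 0 0 (\<i>/2) (1/2)"
  by (simp_all add: ebas_def cquat_eq_iff scaleC_def plus_cquat_def minus_cquat_def
      one_cquat_def qI_def qJ_def qK_def)

lemma ebas_products:
  "ebas 1 * ebas 1 = ebas 1" "ebas 1 * ebas 2 = 0" "ebas 1 * ebas 3 = ebas 3" "ebas 1 * ebas 4 = 0"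
  "ebas 2 * ebas 1 = 0" "ebas 2 * ebas 2 = ebas 2" "ebas 2 * ebas 3 = 0" "ebas 2 * ebas 4 = ebas 4"
  "ebas 3 * ebas 1 = 0" "ebas 3 * ebas 2 = ebas 3" "ebas 3 * ebas 3 = 0" "ebas 3 * ebas 4 = ebas 1"
  "ebas 4 * ebas 1 = ebas 4" "ebas 4 * ebas 2 = 0" "ebas 4 * ebas 3 = ebas 2" "ebas 4 * ebas 4 = 0"
  "1 = ebas 1 + ebas 2"
  by (simp_all only: ebas_explicit)
    (simp_all add: cquat_eq_iff times_cquat_def plus_cquat_def zero_cquat_def one_cquat_def)

text \<open>\<open>ecoord q k\<close> is the coefficient of \<open>e\<^sub>k\<close> in \<open>q\<close>.\<close>

definition ecoord :: "cquat \<Rightarrow> 4 \<Rightarrow> complex" where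
  "ecoord q = (THE u. q = (\<Sum>k\<in>UNIV. u k *\<^sub>C ebas k))"

lemma ebas_sum_eq:
  "(\<Sum>k\<in>UNIV. u k *\<^sub>C ebas k) =
     CQuat ((u 1 + u 2) / 2) (\<i> * (u 1 - u 2) / 2) (\<i> * (u 3 + u 4) / 2) ((u 4 - u 3) / 2)"
  by (simp only: sum_4 ebas_explicit)
    (simp add: cquat_eq_iff scaleC_def plus_cquat_def field_simps)

lemma ebas_sum_iff:
  "q = (\<Sum>k\<in>UNIV. u k *\<^sub>C ebas k) \<longleftrightarrow>
     u 1 = cq1 q - \<i> * cqI q \<and> u 2 = cq1 q + \<i> * cqI q \<and>
     u 3 = - cqK q - \<i> * cqJ q \<and> u 4 = cqK q - \<i> * cqJ q"
  (is "_ \<longleftrightarrow> ?R")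
proof
  show "q = (\<Sum>k\<in>UNIV. u k *\<^sub>C ebas k) \<Longrightarrow> ?R"
    unfolding ebas_sum_eq by (simp add: field_simps flip: mult.assoc)
next
  assume R: ?R
  show "q = (\<Sum>k\<in>UNIV. u k *\<^sub>C ebas k)"
    unfolding ebas_sum_eq R[THEN conjunct1] R[THEN conjunct2, THEN conjunct1]
      R[THEN conjunct2, THEN conjunct2, THEN conjunct1]
      R[THEN conjunct2, THEN conjunct2, THEN conjunct2] cquat_eq_iff
    by (simp add: right_diff_distrib distrib_left flip: mult.assoc)
qed

lemma ecoord_iff: "q = (\<Sum>k\<in>UNIV. u k *\<^sub>C ebas k) \<longleftrightarrow> ecoord q = u"
proof -
  have uniq: "u = v" if "q = (\<Sum>k\<in>UNIV. u k *\<^sub>C ebas k)" "q = (\<Sum>k\<in>UNIV. v k *\<^sub>C ebas k)"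
    for u v :: "4 \<Rightarrow> complex"
  proof
    fix k show "u k = v k"
      using that exhaust_4[of k] unfolding ebas_sum_iff by auto
  qed
  define v :: "4 \<Rightarrow> complex" where "v k =
    (if k = 1 then cq1 q - \<i> * cqI q else if k = 2 then cq1 q + \<i> * cqI q
     else if k = 3 then - cqK q - \<i> * cqJ q else cqK q - \<i> * cqJ q)" for k
  have v: "q = (\<Sum>k\<in>UNIV. v k *\<^sub>C ebas k)"
    unfolding ebas_sum_iff by (simp add: v_def)
  have "ecoord q = v"
    unfolding ecoord_def by (rule the_equality) (use v uniq in blast)+
  then show ?thesis using v uniq by blast
qed

lemma ecoord_explicit:
  "ecoord q 1 = cq1 q - \<i> * cqI q" "ecoord q 2 = cq1 q + \<i> * cqI q"
  "ecoord q 3 = - cqK q - \<i> * cqJ q" "ecoord q 4 = cqK q - \<i> * cqJ q"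
  using ecoord_iff[of q "ecoord q"] unfolding ebas_sum_iff by simp_all

definition f1 :: "cquat \<Rightarrow> complex" where "f1 q = ecoord q 1 + ecoord q 3"
definition f2 :: "cquat \<Rightarrow> complex" where "f2 q = ecoord q 2 + ecoord q 4"

lemma f1_f2_linear:
  "f1 (p + q) = f1 p + f1 q" "f1 (c *\<^sub>C q) = c * f1 q"
  "f2 (p + q) = f2 p + f2 q" "f2 (c *\<^sub>C q) = c * f2 q"
  unfolding f1_def f2_def ecoord_explicit
  by (simp_all add: plus_cquat_def scaleC_def algebra_simps)

lemma f1_f2_ebas:
  "f1 (ebas 1) = 1" "f1 (ebas 3) = 1" "f1 (ebas 2) = 0" "f1 (ebas 4) = 0"
  "f2 (ebas 2) = 1" "f2 (ebas 4) = 1" "f2 (ebas 1) = 0" "f2 (ebas 3) = 0"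
  unfolding f1_def f2_def ecoord_explicit ebas_explicit by simp_all


section \<open>The space \<open>E\<^sub>3\<close> and mappings on it\<close>

text \<open>The parameters \<open>i2\<close>, \<open>i3\<close> below are the basis vectors \<open>i\<^sub>2\<close>, \<open>i\<^sub>3\<close> of \<open>E\<^sub>3\<close>; \<open>i\<^sub>1 = 1\<close>.\<close>

definition zeta :: "cquat \<Rightarrow> cquat \<Rightarrow> real^3 \<Rightarrow> cquat" where
  "zeta i2 i3 p = p$1 *\<^sub>R 1 + p$2 *\<^sub>R i2 + p$3 *\<^sub>R i3"

definition E3 :: "cquat \<Rightarrow> cquat \<Rightarrow> cquat set" where
  "E3 i2 i3 = range (zeta i2 i3)"

text \<open>\<open>Ucomp i2 i3 \<Phi> k\<close> is the component \<open>U\<^sub>k\<close> of \<open>\<Phi>\<close>, as a function of \<open>(x, y, z)\<close>.\<close>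

definition Ucomp :: "cquat \<Rightarrow> cquat \<Rightarrow> (cquat \<Rightarrow> cquat) \<Rightarrow> 4 \<Rightarrow> real^3 \<Rightarrow> complex" where
  "Ucomp i2 i3 \<Phi> k p = ecoord (\<Phi> (zeta i2 i3 p)) k"

definition has_partial_deriv :: "3 \<Rightarrow> (real^3 \<Rightarrow> complex) \<Rightarrow> real^3 \<Rightarrow> bool" where
  "has_partial_deriv j g p \<longleftrightarrow> (\<lambda>t. g (p + t *\<^sub>R axis j 1)) differentiable (at 0)"

definition partial_deriv :: "3 \<Rightarrow> (real^3 \<Rightarrow> complex) \<Rightarrow> real^3 \<Rightarrow> complex" where
  "partial_deriv j g p = vector_derivative (\<lambda>t. g (p + t *\<^sub>R axis j 1)) (at 0)"

definition partial_map :: "cquat \<Rightarrow> cquat \<Rightarrow> 3 \<Rightarrow> (cquat \<Rightarrow> cquat) \<Rightarrow> real^3 \<Rightarrow> cquat" where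
  "partial_map i2 i3 j \<Phi> p = (\<Sum>k\<in>UNIV. partial_deriv j (Ucomp i2 i3 \<Phi> k) p *\<^sub>C ebas k)"

definition R_differentiable :: "cquat \<Rightarrow> cquat \<Rightarrow> (real^3) set \<Rightarrow> (cquat \<Rightarrow> cquat) \<Rightarrow> bool" where
  "R_differentiable i2 i3 \<Omega> \<Phi> \<longleftrightarrow> (\<forall>k. \<forall>p\<in>\<Omega>. Ucomp i2 i3 \<Phi> k differentiable (at p))"

text \<open>Mappings on \<open>\<Omega>\<^sub>\<zeta> = zeta i2 i3 ` \<Omega>\<close> are total functions on \<open>cquat\<close>. As \<open>\<Omega>\<close> is open, continuity,
  derivatives and limits below only involve their values on \<open>\<Omega>\<^sub>\<zeta>\<close>.\<close>

definition right_G_monogenic :: "cquat \<Rightarrow> cquat \<Rightarrow> (real^3) set \<Rightarrow> (cquat \<Rightarrow> cquat) \<Rightarrow> bool" where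
  "right_G_monogenic i2 i3 \<Omega> \<Phi> \<longleftrightarrow> continuous_on (zeta i2 i3 ` \<Omega>) \<Phi> \<and>
     (\<forall>\<zeta>\<in>zeta i2 i3 ` \<Omega>. \<exists>D. \<forall>h\<in>E3 i2 i3.
        ((\<lambda>\<epsilon>. (\<Phi> (\<zeta> + \<epsilon> *\<^sub>R h) - \<Phi> \<zeta>) /\<^sub>R \<epsilon>) \<longlongrightarrow> h * D) (at_right 0))"

definition left_G_monogenic :: "cquat \<Rightarrow> cquat \<Rightarrow> (real^3) set \<Rightarrow> (cquat \<Rightarrow> cquat) \<Rightarrow> bool" where
  "left_G_monogenic i2 i3 \<Omega> \<Phi> \<longleftrightarrow> continuous_on (zeta i2 i3 ` \<Omega>) \<Phi> \<and>
     (\<forall>\<zeta>\<in>zeta i2 i3 ` \<Omega>. \<exists>D. \<forall>h\<in>E3 i2 i3.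
        ((\<lambda>\<epsilon>. (\<Phi> (\<zeta> + \<epsilon> *\<^sub>R h) - \<Phi> \<zeta>) /\<^sub>R \<epsilon>) \<longlongrightarrow> D * h) (at_right 0))"

text \<open>Linear forms in \<open>dx, dy, dz\<close> are functions of the vector \<open>v = (dx, dy, dz)\<close>; in particular
  the form \<open>d\<zeta> = dx + i\<^sub>2 dy + i\<^sub>3 dz\<close> is \<open>zeta i2 i3\<close>.\<close>

definition differential ::
  "cquat \<Rightarrow> cquat \<Rightarrow> (cquat \<Rightarrow> cquat) \<Rightarrow> real^3 \<Rightarrow> real^3 \<Rightarrow> cquat" where
  "differential i2 i3 \<Phi> p v =
     (\<Sum>k\<in>UNIV. (\<Sum>j\<in>UNIV. partial_deriv j (Ucomp i2 i3 \<Phi> k) p * of_real (v$j)) *\<^sub>C ebas k)"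

definition hausdorff_rep ::
  "cquat \<Rightarrow> cquat \<Rightarrow> (cquat \<Rightarrow> cquat) \<Rightarrow> real^3 \<Rightarrow> (nat \<Rightarrow> cquat) \<Rightarrow> (nat \<Rightarrow> cquat) \<Rightarrow> bool" where
  "hausdorff_rep i2 i3 \<Phi> p A B \<longleftrightarrow>
     (\<forall>v. differential i2 i3 \<Phi> p v = (\<Sum>s=1..16. A s * zeta i2 i3 v * B s))"

definition H_monogenic :: "cquat \<Rightarrow> cquat \<Rightarrow> (real^3) set \<Rightarrow> (cquat \<Rightarrow> cquat) \<Rightarrow> bool" where
  "H_monogenic i2 i3 \<Omega> \<Phi> \<longleftrightarrow> continuous_on (zeta i2 i3 ` \<Omega>) \<Phi> \<and>
     (\<forall>p\<in>\<Omega>. \<forall>k j. has_partial_deriv j (Ucomp i2 i3 \<Phi> k) p) \<and>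
     (\<exists>A B :: nat \<Rightarrow> cquat \<Rightarrow> cquat. \<forall>p\<in>\<Omega>.
        hausdorff_rep i2 i3 \<Phi> p (\<lambda>s. A s (zeta i2 i3 p)) (\<lambda>s. B s (zeta i2 i3 p)))"

text \<open>The value \<open>\<Phi>'\<^sub>H(\<zeta>)\<close> at \<open>\<zeta> = zeta i2 i3 p\<close>. It does not depend on the representation:
  putting \<open>(dx, dy, dz) = (1, 0, 0)\<close> in it gives \<open>\<Sum>\<^sub>s A\<^sub>s B\<^sub>s\<close>.\<close>

definition hausdorff_derivative ::
  "cquat \<Rightarrow> cquat \<Rightarrow> (cquat \<Rightarrow> cquat) \<Rightarrow> real^3 \<Rightarrow> cquat" where
  "hausdorff_derivative i2 i3 \<Phi> p =
     (THE D. \<exists>A B. hausdorff_rep i2 i3 \<Phi> p A B \<and> D = (\<Sum>s=1..16. A s * B s))"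

lemma hausdorff_derivative_eq:
  assumes "hausdorff_rep i2 i3 \<Phi> p A B"
  shows "hausdorff_derivative i2 i3 \<Phi> p = (\<Sum>s=1..16. A s * B s)"
    and "hausdorff_derivative i2 i3 \<Phi> p = partial_map i2 i3 1 \<Phi> p"
proof -
  have *: "(\<Sum>s=1..16. A s * B s) = partial_map i2 i3 1 \<Phi> p"
    if "hausdorff_rep i2 i3 \<Phi> p A B" for A B :: "nat \<Rightarrow> cquat"
    using that[unfolded hausdorff_rep_def, rule_format, of "axis 1 1"]
    by (simp add: differential_def partial_map_def zeta_def sum_3 axis_def)
  show "hausdorff_derivative i2 i3 \<Phi> p = (\<Sum>s=1..16. A s * B s)"
    unfolding hausdorff_derivative_def
  proof (rule the_equality)
    show "\<exists>A' B'. hausdorff_rep i2 i3 \<Phi> p A' B' \<and>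
        (\<Sum>s=1..16. A s * B s) = (\<Sum>s=1..16. A' s * B' s)"
      using assms by blast
  next
    fix D assume "\<exists>A B. hausdorff_rep i2 i3 \<Phi> p A B \<and> D = (\<Sum>s=1..16. A s * B s)"
    then show "D = (\<Sum>s=1..16. A s * B s)"
      using *[OF assms] * by metis
  qed
  then show "hausdorff_derivative i2 i3 \<Phi> p = partial_map i2 i3 1 \<Phi> p"
    using *[OF assms] by simp
qed

definition right_H_monogenic :: "cquat \<Rightarrow> cquat \<Rightarrow> (real^3) set \<Rightarrow> (cquat \<Rightarrow> cquat) \<Rightarrow> bool" where
  "right_H_monogenic i2 i3 \<Omega> \<Phi> \<longleftrightarrow> H_monogenic i2 i3 \<Omega> \<Phi> \<and>
     (\<forall>p\<in>\<Omega>. \<forall>v. differential i2 i3 \<Phi> p v = zeta i2 i3 v * hausdorff_derivative i2 i3 \<Phi> p)"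

definition left_H_monogenic :: "cquat \<Rightarrow> cquat \<Rightarrow> (real^3) set \<Rightarrow> (cquat \<Rightarrow> cquat) \<Rightarrow> bool" where
  "left_H_monogenic i2 i3 \<Omega> \<Phi> \<longleftrightarrow> H_monogenic i2 i3 \<Omega> \<Phi> \<and>
     (\<forall>p\<in>\<Omega>. \<forall>v. differential i2 i3 \<Phi> p v = hausdorff_derivative i2 i3 \<Phi> p * zeta i2 i3 v)"


section \<open>Curvilinear integrals\<close>

text \<open>The Riemann-Stieltjes integral of \<open>W\<close> with respect to the \<open>j\<close>-th coordinate along a curve
  parametrised by \<open>\<gamma>\<close> on \<open>[0, 1]\<close>; it exists for rectifiable \<open>\<gamma>\<close> and \<open>W\<close> continuous on it.\<close>

definition has_line_integral :: "3 \<Rightarrow> (real \<Rightarrow> real^3) \<Rightarrow> (real^3 \<Rightarrow> complex) \<Rightarrow> complex \<Rightarrow> bool" where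
  "has_line_integral j \<gamma> W c \<longleftrightarrow>
     (\<forall>\<epsilon>>0. \<exists>\<delta>>0. \<forall>P. P tagged_division_of {0..1} \<and> (\<forall>(t, K)\<in>P. diameter K < \<delta>) \<longrightarrow>
        norm ((\<Sum>(t, K)\<in>P. W (\<gamma> t) * of_real (\<gamma> (Sup K) $ j - \<gamma> (Inf K) $ j)) - c) < \<epsilon>)"

definition line_integral :: "3 \<Rightarrow> (real \<Rightarrow> real^3) \<Rightarrow> (real^3 \<Rightarrow> complex) \<Rightarrow> complex" where
  "line_integral j \<gamma> W = (THE c. has_line_integral j \<gamma> W c)"

text \<open>The integrals of \<open>d\<zeta> \<Psi>(\<zeta>)\<close> and of \<open>\<Psi>(\<zeta>) d\<zeta>\<close>.\<close>

definition integral_dz_left ::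
  "cquat \<Rightarrow> cquat \<Rightarrow> (real \<Rightarrow> real^3) \<Rightarrow> (cquat \<Rightarrow> cquat) \<Rightarrow> cquat" where
  "integral_dz_left i2 i3 \<gamma> \<Psi> = (\<Sum>k\<in>UNIV.
     line_integral 1 \<gamma> (Ucomp i2 i3 \<Psi> k) *\<^sub>C ebas k +
     line_integral 2 \<gamma> (Ucomp i2 i3 \<Psi> k) *\<^sub>C (i2 * ebas k) +
     line_integral 3 \<gamma> (Ucomp i2 i3 \<Psi> k) *\<^sub>C (i3 * ebas k))"

definition integral_dz_right ::
  "cquat \<Rightarrow> cquat \<Rightarrow> (real \<Rightarrow> real^3) \<Rightarrow> (cquat \<Rightarrow> cquat) \<Rightarrow> cquat" where
  "integral_dz_right i2 i3 \<gamma> \<Psi> = (\<Sum>k\<in>UNIV.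
     line_integral 1 \<gamma> (Ucomp i2 i3 \<Psi> k) *\<^sub>C ebas k +
     line_integral 2 \<gamma> (Ucomp i2 i3 \<Psi> k) *\<^sub>C (ebas k * i2) +
     line_integral 3 \<gamma> (Ucomp i2 i3 \<Psi> k) *\<^sub>C (ebas k * i3))"

text \<open>The boundary of the triangle \<open>convex hull {p, q, r}\<close>, traversed once. Permuting the vertices
  gives either orientation.\<close>

definition triangle_boundary :: "real^3 \<Rightarrow> real^3 \<Rightarrow> real^3 \<Rightarrow> real \<Rightarrow> real^3" where
  "triangle_boundary p q r = linepath p q +++ linepath q r +++ linepath r p"


section \<open>The complex variables \<open>\<xi>\<^sub>1, \<xi>\<^sub>2\<close> and analytic representations\<close>

definition xi :: "complex \<Rightarrow> complex \<Rightarrow> real^3 \<Rightarrow> complex" where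
  "xi a b p = of_real (p$1) + of_real (p$2) * a + of_real (p$3) * b"

text \<open>\<open>xi a\<^sub>k b\<^sub>k\<close> is \<open>\<xi>\<^sub>k = f\<^sub>k(\<zeta>)\<close> as a function of \<open>(x, y, z)\<close>.\<close>

lemma f1_f2_zeta:
  assumes "i2 = a1 *\<^sub>C ebas 1 + a2 *\<^sub>C ebas 2" "i3 = b1 *\<^sub>C ebas 1 + b2 *\<^sub>C ebas 2"
  shows "f1 (zeta i2 i3 p) = xi a1 b1 p" "f2 (zeta i2 i3 p) = xi a2 b2 p"
  unfolding zeta_def assms ebas_products(17) xi_def
  by (simp_all only: scaleC_of_real[symmetric] f1_f2_linear f1_f2_ebas) simp_all

definition line_L :: "complex \<Rightarrow> complex \<Rightarrow> (real^3) set" where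
  "line_L a b = {v. v$1 + v$2 * Re a + v$3 * Re b = 0 \<and> v$2 * Im a + v$3 * Im b = 0}"

text \<open>Here \<open>L\<close> is a line through the origin.\<close>

definition convex_in_direction :: "(real^3) set \<Rightarrow> (real^3) set \<Rightarrow> bool" where
  "convex_in_direction L \<Omega> \<longleftrightarrow> (\<forall>p\<in>\<Omega>. \<forall>q\<in>\<Omega>. q - p \<in> L \<longrightarrow> closed_segment p q \<subseteq> \<Omega>)"

definition right_analytic_rep ::
  "complex \<Rightarrow> complex \<Rightarrow> complex \<Rightarrow> complex \<Rightarrow> (real^3) set \<Rightarrow> (cquat \<Rightarrow> cquat) \<Rightarrow>
   (complex \<Rightarrow> complex) \<Rightarrow> (complex \<Rightarrow> complex) \<Rightarrow> (complex \<Rightarrow> complex) \<Rightarrow> (complex \<Rightarrow> complex) \<Rightarrow> bool" where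
  "right_analytic_rep a1 a2 b1 b2 \<Omega> \<Phi> F1 F2 F3 F4 \<longleftrightarrow>
     F1 analytic_on xi a1 b1 ` \<Omega> \<and> F2 analytic_on xi a2 b2 ` \<Omega> \<and>
     F3 analytic_on xi a1 b1 ` \<Omega> \<and> F4 analytic_on xi a2 b2 ` \<Omega> \<and>
     (\<forall>p\<in>\<Omega>. \<Phi> (zeta (a1 *\<^sub>C ebas 1 + a2 *\<^sub>C ebas 2) (b1 *\<^sub>C ebas 1 + b2 *\<^sub>C ebas 2) p) =
        F1 (xi a1 b1 p) *\<^sub>C ebas 1 + F2 (xi a2 b2 p) *\<^sub>C ebas 2 +
        F3 (xi a1 b1 p) *\<^sub>C ebas 3 + F4 (xi a2 b2 p) *\<^sub>C ebas 4)"

definition left_analytic_rep ::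
  "complex \<Rightarrow> complex \<Rightarrow> complex \<Rightarrow> complex \<Rightarrow> (real^3) set \<Rightarrow> (cquat \<Rightarrow> cquat) \<Rightarrow>
   (complex \<Rightarrow> complex) \<Rightarrow> (complex \<Rightarrow> complex) \<Rightarrow> (complex \<Rightarrow> complex) \<Rightarrow> (complex \<Rightarrow> complex) \<Rightarrow> bool" where
  "left_analytic_rep a1 a2 b1 b2 \<Omega> \<Phi> F1 F2 F3 F4 \<longleftrightarrow>
     F1 analytic_on xi a1 b1 ` \<Omega> \<and> F2 analytic_on xi a2 b2 ` \<Omega> \<and>
     F3 analytic_on xi a2 b2 ` \<Omega> \<and> F4 analytic_on xi a1 b1 ` \<Omega> \<and>
     (\<forall>p\<in>\<Omega>. \<Phi> (zeta (a1 *\<^sub>C ebas 1 + a2 *\<^sub>C ebas 2) (b1 *\<^sub>C ebas 1 + b2 *\<^sub>C ebas 2) p) =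
        F1 (xi a1 b1 p) *\<^sub>C ebas 1 + F2 (xi a2 b2 p) *\<^sub>C ebas 2 +
        F3 (xi a2 b2 p) *\<^sub>C ebas 3 + F4 (xi a1 b1 p) *\<^sub>C ebas 4)"

end

theory Submission
  imports Defs "HOL-Complex_Analysis.Complex_Analysis" "HOL-Real_Asymp.Real_Asymp"
begin

text \<open>
An element \<open>\<zeta> = \<xi>\<^sub>1 e\<^sub>1 + \<xi>\<^sub>2 e\<^sub>2\<close> of \<open>E\<^sub>3\<close> multiplies, from the right or from the left, each of the four basis
vectors \<open>e\<^sub>k\<close> by one of the numbers \<open>\<xi>\<^sub>1, \<xi>\<^sub>2\<close>. Each of the conditions therefore splits into four
scalar conditions of the same shape: a coordinate \<open>u\<close> of the mapping is differentiable in the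
directions \<open>v\<close> of \<open>\<real>\<^sup>3\<close> with derivatives \<open>xi a b v * d\<close>, where \<open>xi a b\<close> is the real linear form \<open>\<xi>\<^sub>1\<close> or
\<open>\<xi>\<^sub>2\<close>. The locale \<open>e3_product\<close> carries out this reduction once for both sides.

Such a \<open>u\<close> is constant along the kernel of the form, so locally, and globally if the domain is convex in
the direction of the kernel, \<open>u = g \<circ> xi a b\<close> for a function \<open>g\<close> on the image of the form
(\<open>xi_monogenic_imp_holomorphic_factor\<close>). If the image is \<open>\<complex>\<close>, then \<open>g\<close> is continuous and has complex linear
directional derivatives. The main analytic point is that this already makes \<open>g\<close> holomorphic
(\<open>gateaux_holomorphic\<close>), although no uniformity in the direction is assumed. After that the power
series expansion, the vanishing of the integrals over triangles and the analytic representation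
are the classical facts about \<open>g\<close> (Taylor, Goursat), carried back through the form. Conversely, in Morera's
direction the integral from a base point is itself a function of this kind, so that the theorem can be
applied to the primitive.

If the form is real valued, \<open>g\<close> is a differentiable function of one real variable, and \<open>u\<close> is again
totally differentiable; so total differentiability with the Cauchy-Riemann equations holds in both cases.
The equivalence with H-monogenicity is linear algebra at each point: the Hausdorff derivative is
the partial derivative in \<open>x\<close>, and the Cauchy-Riemann equations say that the differential is \<open>d\<zeta>\<close> times it.
\<close>

section \<open>Gateaux derivatives and a maximum principle\<close>

definition gateaux_at :: "('a::real_normed_vector \<Rightarrow> complex) \<Rightarrow> ('a \<Rightarrow> complex) \<Rightarrow> 'a \<Rightarrow> bool"
  where "gateaux_at u D p \<longleftrightarrow>
    (\<forall>v. ((\<lambda>\<epsilon>. (u (p + \<epsilon> *\<^sub>R v) - u p) /\<^sub>R \<epsilon>) \<longlongrightarrow> D v) (at_right 0))"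

lemma gateaux_atD:
  assumes "gateaux_at u D p" "e > 0"
  obtains d where "d > 0"
    "\<And>t. 0 < t \<Longrightarrow> t < d \<Longrightarrow> norm (u (p + t *\<^sub>R v) - u p - t *\<^sub>R D v) \<le> e * t"
proof -
  have "((\<lambda>\<epsilon>. (u (p + \<epsilon> *\<^sub>R v) - u p) /\<^sub>R \<epsilon>) \<longlongrightarrow> D v) (at_right 0)"
    using assms(1) by (simp add: gateaux_at_def)
  then have "eventually (\<lambda>t. dist ((u (p + t *\<^sub>R v) - u p) /\<^sub>R t) (D v) < e) (at_right 0)"
    using assms(2) by (rule tendstoD)
  then obtain d where "d > 0"
    and d: "\<And>t. 0 < t \<Longrightarrow> t < d \<Longrightarrow> dist ((u (p + t *\<^sub>R v) - u p) /\<^sub>R t) (D v) < e"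
    by (auto simp: eventually_at_right_field)
  have "norm (u (p + t *\<^sub>R v) - u p - t *\<^sub>R D v) \<le> e * t" if t: "0 < t" "t < d" for t
  proof -
    have "u (p + t *\<^sub>R v) - u p - t *\<^sub>R D v
        = t *\<^sub>R ((u (p + t *\<^sub>R v) - u p) /\<^sub>R t - D v)"
      using t by (simp add: algebra_simps)
    then have "norm (u (p + t *\<^sub>R v) - u p - t *\<^sub>R D v)
        = t * dist ((u (p + t *\<^sub>R v) - u p) /\<^sub>R t) (D v)"
      using t by (simp add: dist_norm)
    then show ?thesis
      using d[OF t] t by (simp add: mult.commute)
  qed
  with \<open>d > 0\<close> show thesis by (rule that)
qed

text \<open>A Gateaux derivative controls each ray separately. The unit sphere is compact, so finitely many rays
suffice up to a small error, and the Lipschitz bound carries the estimate from a ray to its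
neighbours; hence the control is uniform in the direction.\<close>

lemma lipschitz_gateaux_imp_has_derivative:
  fixes f :: "'a::euclidean_space \<Rightarrow> complex"
  assumes lin: "bounded_linear D" and gat: "gateaux_at f D p"
    and r: "r > 0" and lip: "\<And>x y. x \<in> ball p r \<Longrightarrow> y \<in> ball p r \<Longrightarrow> norm (f x - f y) \<le> C * norm (x - y)"
  shows "(f has_derivative D) (at p)"
  unfolding has_derivative_at_alt
proof (intro conjI allI impI lin)
  fix e :: real assume "e > 0"
  obtain B where B: "B > 0" "\<And>x. norm (D x) \<le> norm x * B"
    using bounded_linear.pos_bounded[OF lin] by blast
  define K where "K = \<bar>C\<bar> + 1 + B"
  have "K > 0" using B by (simp add: K_def)
  define e' where "e' = e / K"
  have "e' > 0" using \<open>e > 0\<close> \<open>K > 0\<close> by (simp add: e'_def)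
  obtain T where T: "T \<subseteq> sphere (0::'a) 1" "finite T" "sphere (0::'a) 1 \<subseteq> (\<Union>t\<in>T. ball t e')"
  proof -
    have "compact (sphere (0::'a) 1)" by simp
    moreover have "sphere (0::'a) 1 \<subseteq> (\<Union>t\<in>sphere 0 1. ball t e')"
      using \<open>e' > 0\<close> by (meson UN_I centre_in_ball subsetI)
    ultimately show ?thesis
      using compactE_image[of "sphere (0::'a) 1" "sphere 0 1" "\<lambda>t. ball t e'"] that by auto
  qed
  have "\<exists>d>0. \<forall>t. 0 < t \<and> t < d \<longrightarrow> norm (f (p + t *\<^sub>R v) - f p - t *\<^sub>R D v) \<le> e' * t" for v
    using gateaux_atD[OF gat \<open>e' > 0\<close>] by metis
  then obtain \<delta> where \<delta>: "\<And>v. \<delta> v > 0"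
    "\<And>v t. 0 < t \<Longrightarrow> t < \<delta> v \<Longrightarrow> norm (f (p + t *\<^sub>R v) - f p - t *\<^sub>R D v) \<le> e' * t"
    by metis
  define d where "d = Min (insert r (\<delta> ` T))"
  have d: "d > 0" "d \<le> r" "\<And>t. t \<in> T \<Longrightarrow> d \<le> \<delta> t"
    using T(2) \<delta>(1) r by (auto simp: d_def)
  have "norm (f y - f p - D (y - p)) \<le> e * norm (y - p)" if y: "norm (y - p) < d" for y
  proof (cases "y = p")
    case True then show ?thesis using lin by (simp add: linear_0 bounded_linear.linear)
  next
    case False
    define t where "t = norm (y - p)"
    define \<theta> where "\<theta> = (y - p) /\<^sub>R t"
    have t: "0 < t" "t < d" using False y by (auto simp: t_def)
    have y_eq: "y = p + t *\<^sub>R \<theta>" using t by (simp add: \<theta>_def)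
    have "norm \<theta> = 1" using t(1) unfolding \<theta>_def t_def by simp
    then obtain v where v: "v \<in> T" "dist v \<theta> < e'" using T(3) by fastforce
    then have nv: "norm v = 1" "norm (\<theta> - v) < e'" using T(1) by (auto simp: dist_norm norm_minus_commute)
    have inb: "p + t *\<^sub>R \<theta> \<in> ball p r" "p + t *\<^sub>R v \<in> ball p r"
      using t d(2) \<open>norm \<theta> = 1\<close> nv by (auto simp: dist_norm)
    have 1: "norm (f (p + t *\<^sub>R \<theta>) - f (p + t *\<^sub>R v)) \<le> \<bar>C\<bar> * (t * e')"
    proof -
      have "norm (f (p + t *\<^sub>R \<theta>) - f (p + t *\<^sub>R v)) \<le> C * norm ((p + t *\<^sub>R \<theta>) - (p + t *\<^sub>R v))"
        by (rule lip[OF inb])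
      also have "norm ((p + t *\<^sub>R \<theta>) - (p + t *\<^sub>R v)) = t * norm (\<theta> - v)"
        using t by (simp add: scaleR_diff_right[symmetric])
      also have "C * (t * norm (\<theta> - v)) \<le> \<bar>C\<bar> * (t * e')"
        using nv t by (intro mult_mono) auto
      finally show ?thesis .
    qed
    have 2: "norm (f (p + t *\<^sub>R v) - f p - t *\<^sub>R D v) \<le> e' * t"
      using \<delta>(2)[of t v] t d(3)[OF v(1)] by simp
    have 3: "norm (t *\<^sub>R D v - D (y - p)) \<le> t * e' * B"
    proof -
      have "t *\<^sub>R D v - D (y - p) = D (t *\<^sub>R (v - \<theta>))"
        using y_eq by (simp add: linear_diff linear_scale bounded_linear.linear[OF lin] scaleR_diff_right)
      also have "norm \<dots> \<le> (t * norm (v - \<theta>)) * B" using B(2)[of "t *\<^sub>R (v - \<theta>)"] t by simp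
      also have "\<dots> \<le> t * e' * B" using nv t B(1) by (simp add: norm_minus_commute)
      finally show ?thesis .
    qed
    have "f y - f p - D (y - p) = (f (p + t *\<^sub>R \<theta>) - f (p + t *\<^sub>R v)) +
       (f (p + t *\<^sub>R v) - f p - t *\<^sub>R D v) + (t *\<^sub>R D v - D (y - p))"
      using y_eq by simp
    also have "norm \<dots> \<le> \<bar>C\<bar> * (t * e') + e' * t + t * e' * B"
      using 1 2 3 by (intro norm_triangle_le add_mono) auto
    also have "\<dots> = (e' * K) * t" by (simp add: K_def algebra_simps)
    also have "\<dots> = e * t" using \<open>K > 0\<close> by (simp add: e'_def)
    finally show ?thesis by (simp add: t_def)
  qed
  with d(1) show "\<exists>d>0. \<forall>y. norm (y - p) < d \<longrightarrow> norm (f y - f p - D (y - p)) \<le> e * norm (y - p)"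
    by blast
qed

text \<open>The boundary bound is missing at the corner \<open>0\<close>, where \<open>g\<close> may grow like \<open>1 / \<bar>w\<bar>\<close>. On the quadrant
\<open>Re ((1 + \<i>) / w) \<ge> 1 / \<bar>w\<bar>\<close>, so the factor \<open>exp (- \<epsilon> (1 + \<i>) / w)\<close> has modulus at most \<open>1\<close> and
kills any polynomial growth at the corner. The maximum modulus principle applies to the product, and
\<open>\<epsilon> \<rightarrow> 0\<close> removes the factor.\<close>

lemma phragmen_lindelof_quadrant:
  fixes g :: "complex \<Rightarrow> complex"
  assumes V: "open V" "bounded V" "V \<subseteq> {w. Re w > 0 \<and> Im w > 0}"
    and hol: "g holomorphic_on V" and cont: "continuous_on (closure V - {0}) g"
    and frontier: "\<And>w. w \<in> frontier V \<Longrightarrow> w \<noteq> 0 \<Longrightarrow> norm (g w) \<le> C" and C: "C \<ge> 0"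
    and growth: "\<And>w. w \<in> closure V \<Longrightarrow> w \<noteq> 0 \<Longrightarrow> norm w * norm (g w) \<le> M"
    and w: "w \<in> V"
  shows "norm (g w) \<le> C"
proof -
  have closV: "Re w \<ge> 0 \<and> Im w \<ge> 0" if "w \<in> closure V" for w
  proof -
    have "closed ({w::complex. Re w \<ge> 0} \<inter> {w. Im w \<ge> 0})"
      by (intro closed_Int closed_halfspace_Re_ge closed_halfspace_Im_ge)
    moreover have "V \<subseteq> {w. Re w \<ge> 0} \<inter> {w. Im w \<ge> 0}" using V(3) by fastforce
    ultimately have "closure V \<subseteq> {w. Re w \<ge> 0} \<inter> {w. Im w \<ge> 0}" by (rule closure_minimal[rotated])
    then show ?thesis using that by auto
  qed
  have re: "Re ((1 + \<i>) / w) \<ge> 1 / norm w" if w: "w \<in> closure V" "w \<noteq> 0" for w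
  proof -
    have "Re ((1 + \<i>) / w) = (Re w + Im w) / (norm w)\<^sup>2"
      using w by (simp add: Re_divide cmod_power2)
    moreover have "norm w \<le> Re w + Im w" using cmod_le[of w] closV[OF w(1)] by simp
    ultimately have "Re ((1 + \<i>) / w) \<ge> norm w / (norm w)\<^sup>2" by (simp add: divide_right_mono)
    then show ?thesis using w(2) by (simp add: power2_eq_square)
  qed
  have "0 \<notin> V" using V(3) by auto
  have key: "norm (g w) * exp (- \<epsilon> * Re ((1 + \<i>) / w)) \<le> C" if "\<epsilon> > 0" for \<epsilon> :: real
  proof -
    define h where "h z = (if z = 0 then 0 else g z * exp (- of_real \<epsilon> * ((1 + \<i>) / z)))" for z
    have normh: "norm (h z) = norm (g z) * exp (- \<epsilon> * Re ((1 + \<i>) / z))" if "z \<noteq> 0" for z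
    proof -
      have "Re (- of_real \<epsilon> * q) = - \<epsilon> * Re q" for q :: complex by simp
      then show ?thesis
        using that by (simp only: h_def norm_mult norm_exp_eq_Re if_False)
    qed
    have "h holomorphic_on V"
    proof (rule holomorphic_transform[where f = "\<lambda>z. g z * exp (- of_real \<epsilon> * ((1 + \<i>) / z))"])
      show "(\<lambda>z. g z * exp (- of_real \<epsilon> * ((1 + \<i>) / z))) holomorphic_on V"
        using \<open>0 \<notin> V\<close> by (intro holomorphic_intros hol) auto
    qed (use \<open>0 \<notin> V\<close> in \<open>auto simp: h_def\<close>)
    moreover have "continuous_on (closure V) h"
      unfolding continuous_on_eq_continuous_within
    proof
      fix z assume z: "z \<in> closure V"
      show "continuous (at z within closure V) h"
      proof (cases "z = 0")
        case False
        have "continuous_on (closure V - {0}) h"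
        proof (subst continuous_on_cong[OF refl])
          show "continuous_on (closure V - {0}) (\<lambda>z. g z * exp (- of_real \<epsilon> * ((1 + \<i>) / z)))"
            by (intro continuous_intros cont) auto
        qed (auto simp: h_def)
        moreover have "at z within closure V = at z within (closure V - {0})"
          by (rule at_within_nhd[where S = "- {0}"]) (use False in auto)
        ultimately show ?thesis using z False
          by (auto simp: continuous_on_eq_continuous_within)
      next
        case True
        have "(h \<longlongrightarrow> 0) (at 0 within closure V)"
        proof (rule Lim_null_comparison)
          show "eventually (\<lambda>z. norm (h z) \<le> M * (exp (- \<epsilon> / norm z) / norm z)) (at 0 within closure V)"
            unfolding eventually_at
          proof (intro exI[of _ 1] conjI ballI impI)
            fix z assume z: "z \<in> closure V" and "z \<noteq> 0 \<and> dist z 0 < 1"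
            then have nz: "z \<noteq> 0" by simp
            have "norm (h z) = norm (g z) * exp (- \<epsilon> * Re ((1 + \<i>) / z))" by (rule normh[OF nz])
            also have "\<dots> \<le> (M / norm z) * exp (- \<epsilon> / norm z)"
            proof (intro mult_mono)
              show "norm (g z) \<le> M / norm z" using growth[OF z nz] nz by (simp add: field_simps)
              have "\<epsilon> * (1 / norm z) \<le> \<epsilon> * Re ((1 + \<i>) / z)"
                using re[OF z nz] \<open>\<epsilon> > 0\<close> by (intro mult_left_mono) auto
              then show "exp (- \<epsilon> * Re ((1 + \<i>) / z)) \<le> exp (- \<epsilon> / norm z)" by simp
              have "0 \<le> norm z * norm (g z)" by simp
              then have "0 \<le> M" using growth[OF z nz] by linarith
              then show "0 \<le> M / norm z" by simp
            qed auto
            finally show "norm (h z) \<le> M * (exp (- \<epsilon> / norm z) / norm z)" by simp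
          qed simp
          have "((\<lambda>t::real. exp (- \<epsilon> / t) / t) \<longlongrightarrow> 0) (at_right 0)"
            using \<open>\<epsilon> > 0\<close> by real_asymp
          moreover have "filterlim (norm :: complex \<Rightarrow> real) (at_right 0) (at 0 within closure V)"
            unfolding filterlim_at
            by (auto simp: eventually_at_filter intro!: tendsto_norm_zero)
          ultimately have "((\<lambda>z. exp (- \<epsilon> / norm z) / norm z) \<longlongrightarrow> 0) (at (0::complex) within closure V)"
            by (rule filterlim_compose)
          then show "((\<lambda>z. M * (exp (- \<epsilon> / norm z) / norm z)) \<longlongrightarrow> 0) (at (0::complex) within closure V)"
            by (rule tendsto_mult_right_zero)
        qed
        then show ?thesis using True by (simp add: continuous_within h_def)
      qed
    qed
    moreover have "norm (h z) \<le> C" if z: "z \<in> frontier V" for z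
    proof (cases "z = 0")
      case True then show ?thesis using C by (simp add: h_def)
    next
      case False
      have z': "z \<in> closure V" using z by (simp add: frontier_def)
      have "0 \<le> 1 / norm z" by simp
      then have "exp (- \<epsilon> * Re ((1 + \<i>) / z)) \<le> 1" 
        using re[OF z' False] \<open>\<epsilon> > 0\<close> by (simp del: norm_ge_zero zero_le_divide_1_iff)
      then have "norm (g z) * exp (- \<epsilon> * Re ((1 + \<i>) / z)) \<le> norm (g z) * 1"
        by (intro mult_left_mono) auto
      then show ?thesis using normh[OF False] frontier[OF z False] by simp
    qed
    ultimately have "norm (h w) \<le> C"
      using maximum_modulus_frontier[of h V C w] V w by (simp add: interior_open)
    moreover have "w \<noteq> 0" using w \<open>0 \<notin> V\<close> by metis
    ultimately show ?thesis using normh[of w] by simp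
  qed
  have "((\<lambda>\<epsilon>. norm (g w) * exp (- \<epsilon> * Re ((1 + \<i>) / w))) \<longlongrightarrow> norm (g w) * exp (- 0 * Re ((1 + \<i>) / w))) (at_right 0)"
    by (intro tendsto_intros)
  then have "((\<lambda>\<epsilon>. norm (g w) * exp (- \<epsilon> * Re ((1 + \<i>) / w))) \<longlongrightarrow> norm (g w)) (at_right 0)" by simp
  then show ?thesis
    by (rule tendsto_upperbound) (use key in \<open>auto simp: eventually_at_right_field intro!: exI[of _ 1]\<close>)
qed

section \<open>Gateaux complex differentiability implies holomorphy\<close>

text \<open>Every Gateaux differentiable function satisfies, at each single point and along the four axis
directions, a Lipschitz estimate with a constant depending on the point. The points where the
constant \<open>n + 1\<close> works form a closed set, so by Baire one constant serves a whole relatively open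
part of \<open>F\<close>. The set \<open>F\<close> will be the set where holomorphy fails.\<close>
lemma gateaux_uniform_portion:
  fixes f :: "complex \<Rightarrow> complex"
  assumes S: "open S" and cont: "continuous_on S f"
    and gat: "\<And>z. z \<in> S \<Longrightarrow> \<exists>D. gateaux_at f D z"
    and F: "F \<subseteq> S" "F \<noteq> {}" "closedin (top_of_set S) F"
  obtains z1 s M where "z1 \<in> F" "s > 0" "M > 0" "cball z1 (2 * s) \<subseteq> S"
    "\<And>z t u. z \<in> F \<Longrightarrow> z \<in> ball z1 s \<Longrightarrow> 0 \<le> t \<Longrightarrow> t \<le> 2 * s \<Longrightarrow> u \<in> {1, \<i>, -1, -\<i>} \<Longrightarrow>
       norm (f (z + of_real t * u) - f z) \<le> M * t"
proof -
  obtain z0 where z0: "z0 \<in> F" using F(2) by blast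
  obtain r0 where r0: "r0 > 0" "ball z0 r0 \<subseteq> S"
    using S F(1) z0 by (meson openE subsetD)
  define r where "r = r0 / 4"
  have r: "r > 0" "cball z0 (2 * r) \<subseteq> S"
    using r0 by (auto simp: r_def subset_iff)
  \<comment> \<open>The closure is taken after intersecting with the open ball, so that every nonempty relatively open
    part of \<open>K\<close> contains points of \<open>F\<close> inside the ball.\<close>
  define K where "K = closure (F \<inter> ball z0 r)"
  obtain F' where F': "closed F'" "F = S \<inter> F'"
    using F(3) by (auto simp: closedin_closed)
  have K_cball: "K \<subseteq> cball z0 r"
    unfolding K_def by (rule closure_minimal) auto
  have KF: "K \<subseteq> F"
  proof -
    have "K \<subseteq> F'" unfolding K_def by (rule closure_minimal) (use F' in auto)
    moreover have "K \<subseteq> S" using K_cball r by (auto simp: subset_iff)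
    ultimately show ?thesis using F' by auto
  qed
  have z0K: "z0 \<in> K" unfolding K_def using z0 r by (auto intro!: closure_subset[THEN subsetD])
  define E where "E n = {z \<in> K. \<forall>t\<in>{0..r / real (Suc n)}. \<forall>u\<in>{1, \<i>, -1, -\<i>}.
      norm (f (z + of_real t * u) - f z) \<le> real (Suc n) * t}" for n
  have "closed (E n)" for n
  proof -
    have "closed {z \<in> K. norm (f (z + of_real t * u) - f z) \<le> real (Suc n) * t}"
      if t: "t \<in> {0..r / real (Suc n)}" and u: "u \<in> {1, \<i>, -1, -\<i>}" for t u
    proof -
      have "r / real (Suc n) \<le> r" using r(1) by (simp add: field_simps)
      then have t': "0 \<le> t" "t \<le> r" using t by auto
      have nu: "norm u = 1" using u by auto
      have sub: "(\<lambda>z. z + of_real t * u) ` K \<subseteq> S"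
      proof safe
        fix z assume "z \<in> K"
        then have "dist z0 z \<le> r" using K_cball by auto
        moreover have "dist z (z + of_real t * u) \<le> r" using t' nu by (simp add: dist_norm norm_mult)
        ultimately have "dist z0 (z + of_real t * u) \<le> 2 * r" by (smt (verit) dist_triangle)
        then show "z + of_real t * u \<in> S" using r(2) by auto
      qed
      have "continuous_on K (\<lambda>z. norm (f (z + of_real t * u) - f z))"
        by (intro continuous_intros continuous_on_compose2[OF cont _ sub]
            continuous_on_subset[OF cont]) (use KF F in auto)
      then have "closed (K \<inter> (\<lambda>z. norm (f (z + of_real t * u) - f z)) -` {..real (Suc n) * t})"
        by (rule continuous_closed_preimage) (auto simp: K_def)
      moreover have "K \<inter> (\<lambda>z. norm (f (z + of_real t * u) - f z)) -` {..real (Suc n) * t} =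
         {z \<in> K. norm (f (z + of_real t * u) - f z) \<le> real (Suc n) * t}" by auto
      ultimately show ?thesis by simp
    qed
    then have "closed (\<Inter>t\<in>{0..r / real (Suc n)}. \<Inter>u\<in>{1, \<i>, -1, -\<i>}. {z \<in> K. norm (f (z + of_real t * u) - f z) \<le> real (Suc n) * t})"
      by blast
    moreover have "(\<Inter>t\<in>{0..r / real (Suc n)}. \<Inter>u\<in>{1, \<i>, -1, -\<i>}. {z \<in> K. norm (f (z + of_real t * u) - f z) \<le> real (Suc n) * t}) = E n"
    proof -
      have "0 \<in> {0..r / real (Suc n)}" using r(1) by simp
      then show ?thesis unfolding E_def by blast
    qed
    ultimately show ?thesis by simp
  qed
  have cover: "K \<subseteq> (\<Union>n. E n)"
  proof
    fix z assume z: "z \<in> K"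
    then obtain D where D: "gateaux_at f D z" using gat KF F(1) by blast
    have "\<exists>d>0. \<forall>t. 0 < t \<and> t < d \<longrightarrow> norm (f (z + t *\<^sub>R u) - f z - t *\<^sub>R D u) \<le> 1 * t" for u
      using gateaux_atD[OF D zero_less_one] by metis
    then obtain \<delta> where \<delta>: "\<And>u. \<delta> u > 0"
      "\<And>u t. 0 < t \<Longrightarrow> t < \<delta> u \<Longrightarrow> norm (f (z + t *\<^sub>R u) - f z - t *\<^sub>R D u) \<le> 1 * t"
      by metis
    define U where "U = {1, \<i>, -1, -\<i>}"
    have U: "finite U" "U \<noteq> {}" by (auto simp: U_def)
    define d where "d = Min (\<delta> ` U)"
    define m where "m = Max ((\<lambda>u. norm (D u)) ` U)"
    have d: "d > 0" "\<And>u. u \<in> U \<Longrightarrow> d \<le> \<delta> u" using U \<delta>(1) by (auto simp: d_def)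
    have m: "norm (D u) \<le> m" if "u \<in> U" for u using U that by (auto simp: m_def)
    obtain n :: nat where n: "real n > max (r / d) (m + 1)" using reals_Archimedean2 by blast
    have "r / d < real (Suc n)" using n by auto
    then have rn: "r / real (Suc n) < d" using d(1) by (simp add: field_simps)
    have "norm (f (z + of_real t * u) - f z) \<le> real (Suc n) * t" if t: "t \<in> {0..r / real (Suc n)}" and u: "u \<in> U" for t u
    proof (cases "t = 0")
      case False
      then have t0: "0 < t" "t < \<delta> u" using t rn d(2)[OF u] by auto
      have "norm (f (z + t *\<^sub>R u) - f z) \<le> norm (f (z + t *\<^sub>R u) - f z - t *\<^sub>R D u) + norm (t *\<^sub>R D u)"
        using norm_triangle_ineq[of "f (z + t *\<^sub>R u) - f z - t *\<^sub>R D u" "t *\<^sub>R D u"] by simp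
      also have "\<dots> \<le> 1 * t + t * m"
        using \<delta>(2)[OF t0] m[OF u] t0 by (intro add_mono) auto
      also have "\<dots> = (m + 1) * t" by (simp add: algebra_simps)
      also have "\<dots> \<le> real (Suc n) * t" using n t0 by (intro mult_right_mono) auto
      finally show ?thesis by (simp add: scaleR_conv_of_real)
    qed simp
    then have "z \<in> E n" using z unfolding E_def U_def by blast
    then show "z \<in> (\<Union>n. E n)" by blast
  qed
  have "\<exists>n. \<exists>T. openin (top_of_set K) T \<and> T \<noteq> {} \<and> T \<subseteq> E n"
  proof (rule ccontr)
    assume no: "\<not> ?thesis"
    have "K \<subseteq> closure (\<Inter>(range (\<lambda>n. K - E n)))"
    proof (rule Baire)
      show "closed K" by (simp add: K_def)
      fix T assume "T \<in> range (\<lambda>n. K - E n)"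
      then obtain n where T: "T = K - E n" by blast
      have "openin (top_of_set K) T"
        unfolding T using \<open>closed (E n)\<close> by (metis Diff_eq openin_open open_Compl)
      moreover have "K \<subseteq> closure T"
      proof
        fix z assume z: "z \<in> K"
        show "z \<in> closure T"
        proof (rule ccontr)
          assume "z \<notin> closure T"
          then have "z \<in> K \<inter> - closure T" using z by blast
          moreover have "openin (top_of_set K) (K \<inter> - closure T)"
            by (intro openin_open_Int open_Compl closed_closure)
          moreover have "K \<inter> - closure T \<subseteq> E n" using closure_subset[of T] T by blast
          ultimately show False using no by blast
        qed
      qed
      ultimately show "openin (top_of_set K) T \<and> K \<subseteq> closure T" ..
    qed simp
    moreover have "\<Inter>(range (\<lambda>n. K - E n)) = {}" using cover by blast
    ultimately have "K \<subseteq> closure {}" by (simp only:)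
    then show False using z0K by simp
  qed
  then obtain n O' where O': "open O'" "K \<inter> O' \<noteq> {}" "K \<inter> O' \<subseteq> E n"
    by (metis openin_open)
  have "O' \<inter> (F \<inter> ball z0 r) \<noteq> {}"
    using O'(1,2) unfolding K_def by (metis Int_commute open_Int_closure_eq_empty)
  then obtain z1 where z1: "z1 \<in> O'" "z1 \<in> F" "z1 \<in> ball z0 r" by blast
  have "open (O' \<inter> ball z0 r)" using O' by blast
  then obtain \<rho> where \<rho>: "\<rho> > 0" "ball z1 \<rho> \<subseteq> O' \<inter> ball z0 r"
    using z1 by (meson IntI openE)
  define s where "s = min (\<rho> / 2) (r / (2 * real (Suc n)))"
  have "s \<le> r / (2 * real (Suc n))" unfolding s_def by (rule min.cobounded2)
  then have "2 * s \<le> r / real (Suc n)" by (simp add: field_simps)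
  moreover have "s > 0" using \<rho>(1) r(1) by (simp add: s_def)
  moreover have "s \<le> \<rho> / 2" unfolding s_def by (rule min.cobounded1)
  ultimately have s: "s > 0" "s \<le> \<rho>" "2 * s \<le> r / real (Suc n)" using \<rho>(1) by auto
  have "r / real (Suc n) \<le> r" using r(1) by (simp add: field_simps)
  then have "2 * s \<le> r" using s(3) by linarith
  then have "cball z1 (2 * s) \<subseteq> cball z0 (2 * r)"
    using z1(3) by (auto simp: subset_iff dist_norm) (smt (verit) dist_norm dist_triangle)
  then have 1: "cball z1 (2 * s) \<subseteq> S" using r by blast
  have 2: "norm (f (z + of_real t * u) - f z) \<le> real (Suc n) * t"
    if z: "z \<in> F" "z \<in> ball z1 s" and t: "0 \<le> t" "t \<le> 2 * s" and u: "u \<in> {1, \<i>, -1, -\<i>}" for z t u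
  proof -
    have zb: "z \<in> ball z1 \<rho>" using z(2) s by auto
    then have "z \<in> F \<inter> ball z0 r" using z \<rho> by blast
    then have "z \<in> K" unfolding K_def by (rule closure_subset[THEN subsetD])
    then have "z \<in> E n" using O'(3) zb \<rho> by blast
    moreover have "t \<in> {0..r / real (Suc n)}" using t s by auto
    ultimately show ?thesis using u unfolding E_def by blast
  qed
  show thesis by (rule that[OF z1(2) s(1) _ 1 2]) auto
qed

text \<open>A variant of the Looman-Menchoff theorem, in which the derivative is assumed along all rays.
Let \<open>F\<close> be the set of points near which \<open>f\<close> is not holomorphic and suppose \<open>F\<close> is nonempty. Near some
point of \<open>F\<close> the axis estimates hold on \<open>F\<close> with one constant. Then \<open>f\<close> is Lipschitz on \<open>F\<close>, as two
points of \<open>F\<close> are joined by two axis-parallel segments, each starting in \<open>F\<close>. For \<open>z\<close> in \<open>F\<close> the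
quotient \<open>(f w - f z) / (w - z)\<close> is bounded on \<open>F\<close>, on the axes through \<open>z\<close> and away from \<open>z\<close>, hence
by the Phragmen-Lindelof principle in each quadrant at \<open>z\<close>. One more application of the maximum
modulus principle makes \<open>f\<close> Lipschitz near the point, so there the Gateaux derivative is a true
complex derivative, a contradiction.\<close>

theorem gateaux_holomorphic:
  fixes f :: "complex \<Rightarrow> complex"
  assumes S: "open S" and cont: "continuous_on S f"
    and gat: "\<And>z. z \<in> S \<Longrightarrow> \<exists>d. gateaux_at f (\<lambda>h. h * d) z"
  shows "f holomorphic_on S"
proof -
  define U where "U = \<Union>{T. open T \<and> T \<subseteq> S \<and> f holomorphic_on T}"
  have U: "open U" "U \<subseteq> S" by (auto simp: U_def)
  have holU: "f holomorphic_on U"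
    unfolding U_def by (rule holomorphic_on_UN_open[where A="\<lambda>T. T", simplified]) auto
  define F where "F = S - U"
  have "F = {}"
  proof (rule ccontr)
    assume "F \<noteq> {}"
    have "closedin (top_of_set S) F" using U unfolding F_def
      by (auto simp: closedin_closed intro!: exI[of _ "- U"])
    moreover have "\<exists>D. gateaux_at f D z" if "z \<in> S" for z using gat[OF that] by blast
    ultimately obtain z1 s M where z1: "z1 \<in> F" and s: "s > 0" and M: "M > 0"
      and sub: "cball z1 (2 * s) \<subseteq> S"
      and axis: "\<And>z t u. z \<in> F \<Longrightarrow> z \<in> ball z1 s \<Longrightarrow> 0 \<le> t \<Longrightarrow> t \<le> 2 * s \<Longrightarrow> u \<in> {1, \<i>, -1, -\<i>} \<Longrightarrow>
         norm (f (z + of_real t * u) - f z) \<le> M * t"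
      using gateaux_uniform_portion[OF S cont _ _ \<open>F \<noteq> {}\<close>] F_def by (metis Diff_subset)
    have axis': "norm (f (z + of_real t * u) - f z) \<le> M * \<bar>t\<bar>"
      if "z \<in> F" "z \<in> ball z1 s" "\<bar>t\<bar> \<le> 2 * s" "u \<in> {1, \<i>}" for z t u
    proof (cases "t \<ge> 0")
      case True
      then show ?thesis using axis[of z t u] that by auto
    next
      case False
      then show ?thesis using axis[of z "-t" "-u"] that by auto
    qed
    have cs: "cball z1 s \<subseteq> cball z1 (2 * s)" using s by (intro subset_cball) auto
    have FU: "z \<in> F" if "z \<in> cball z1 s" "z \<notin> U" for z using that sub cs by (auto simp: F_def)
    have contc: "continuous_on (cball z1 s) f" using cont sub cs by (blast intro: continuous_on_subset)
    obtain B0 where B0: "\<And>z. z \<in> cball z1 s \<Longrightarrow> norm (f z) \<le> B0" "B0 \<ge> 0"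
    proof -
      have "bounded (f ` cball z1 s)"
        by (intro compact_imp_bounded compact_continuous_image contc) auto
      then obtain B where "\<forall>y\<in>f ` cball z1 s. norm y \<le> B" by (auto simp: bounded_iff)
      then show thesis by (intro that[of "max B 0"]) (auto simp: max.coboundedI1)
    qed
    have FF: "norm (f w - f z) \<le> 2 * M * norm (w - z)"
      if z: "z \<in> F" "z \<in> ball z1 s" and w: "w \<in> F" "w \<in> ball z1 s" for z w
    proof -
      have d: "norm (w - z) < 2 * s"
        using z(2) w(2) norm_triangle_ineq[of "w - z1" "z1 - z"] by (simp add: dist_norm norm_minus_commute)
      have re: "\<bar>Re (w - z)\<bar> \<le> norm (w - z)" "\<bar>Im (w - z)\<bar> \<le> norm (w - z)"
        by (rule abs_Re_le_cmod abs_Im_le_cmod)+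
      have 1: "norm (f (z + of_real (Re (w - z)) * 1) - f z) \<le> M * \<bar>Re (w - z)\<bar>"
        by (rule axis') (use z d re in auto)
      have 2: "norm (f (w + of_real (- Im (w - z)) * \<i>) - f w) \<le> M * \<bar>- Im (w - z)\<bar>"
        by (rule axis') (use w d re in auto)
      have eq: "w + of_real (- Im (w - z)) * \<i> = z + of_real (Re (w - z)) * 1"
        by (simp add: complex_eq_iff)
      have "norm (f w - f z) \<le> M * \<bar>Re (w - z)\<bar> + M * \<bar>Im (w - z)\<bar>"
      proof -
        define c where "c = f (z + of_real (Re (w - z)) * 1)"
        have "norm (f w - f z) \<le> norm (c - f z) + norm (c - f w)" by norm
        then show ?thesis using 1 2 unfolding eq c_def[symmetric] abs_minus_cancel by linarith
      qed
      also have "\<dots> \<le> M * norm (w - z) + M * norm (w - z)"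
        using M re by (intro add_mono mult_left_mono) auto
      finally show ?thesis by simp
    qed
    \<comment> \<open>\<open>2 M\<close> is the constant on \<open>F\<close>; on the circle the numerator is at most \<open>2 B0\<close> and \<open>w\<close> is at distance
      at least \<open>s / 2\<close> from \<open>z\<close>.\<close>
    define C where "C = 2 * M + 4 * B0 / s"
    have C: "2 * M \<le> C" "4 * B0 / s \<le> C" "M \<le> C" "0 \<le> C" using M B0(2) s by (auto simp: C_def)
    \<comment> \<open>The quadrants at \<open>z\<close> are the images of the first quadrant under \<open>x \<mapsto> z + u x\<close>. On its boundary
      one meets a half-axis, the circle, or \<open>F\<close>.\<close>
    have quad: "norm (f w - f z) \<le> C * norm (w - z)"
      if z: "z \<in> F" "z \<in> ball z1 (s/2)" and w: "w \<in> ball z1 s" "w \<in> U"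
        and u: "u \<in> {1, \<i>, -1, -\<i>}" and q: "Re ((w - z) / u) > 0" "Im ((w - z) / u) > 0" for z w u
    proof -
      have nu: "norm u = 1" "u \<noteq> 0" using u by auto
      have zs: "z \<in> ball z1 s" using z(2) s by auto
      define A where "A x = z + u * x" for x
      define V where "V = A -` (ball z1 s \<inter> U) \<inter> {x. Re x > 0 \<and> Im x > 0}"
      have contA: "continuous_on X A" for X unfolding A_def by (intro continuous_intros)
      have "open V" unfolding V_def Collect_conj_eq
        by (intro open_Int open_vimage contA U open_ball open_halfspace_Re_gt open_halfspace_Im_gt)
      have clV: "V \<subseteq> A -` cball z1 s \<inter> ({x. Re x \<ge> 0} \<inter> {x. Im x \<ge> 0})"
        unfolding V_def by auto
      have "closure V \<subseteq> A -` cball z1 s \<inter> ({x. Re x \<ge> 0} \<inter> {x. Im x \<ge> 0})"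
        by (rule closure_minimal[OF clV])
          (intro closed_Int closed_vimage contA closed_cball closed_halfspace_Re_ge closed_halfspace_Im_ge)
      then have cl: "A x \<in> cball z1 s" "Re x \<ge> 0" "Im x \<ge> 0" if "x \<in> closure V" for x
        using that by auto
      have nx: "norm x < 2 * s" if "x \<in> closure V" for x
      proof -
        have "norm x = norm (A x - z)" using nu by (simp add: A_def norm_mult)
        also have "\<dots> \<le> norm (A x - z1) + norm (z1 - z)" by norm
        also have "\<dots> < 2 * s" using cl(1)[OF that] z(2) s by (auto simp: dist_norm norm_minus_commute)
        finally show ?thesis .
      qed
      define g where "g x = (f (A x) - f z) / (u * x)" for x
      have normg: "norm (g x) = norm (f (A x) - f z) / norm x" for x
        using nu by (simp add: g_def norm_divide norm_mult)
      have "norm (g ((w - z) / u)) \<le> C"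
      proof (rule phragmen_lindelof_quadrant[where V = V and M = "2 * B0" and g = g])
        show "open V" by fact
        show "bounded V"
          using nx closure_subset[of V] by (auto intro!: boundedI[where B="2 * s"] less_imp_le)
        show "V \<subseteq> {w. 0 < Re w \<and> 0 < Im w}" by (auto simp: V_def)
        have "A holomorphic_on V" unfolding A_def by (intro holomorphic_intros)
        then have "f \<circ> A holomorphic_on V"
          by (rule holomorphic_on_compose_gen[OF _ holU]) (auto simp: V_def)
        then have "(\<lambda>x. f (A x)) holomorphic_on V" by (simp only: o_def)
        then show "g holomorphic_on V"
          unfolding g_def using nu by (intro holomorphic_intros) (auto simp: V_def)
        have "continuous_on (closure V) (\<lambda>x. f (A x))"
          by (rule continuous_on_compose2[OF contc contA]) (use cl in auto)
        then show "continuous_on (closure V - {0}) g"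
          unfolding g_def using nu by (intro continuous_intros) (auto intro: continuous_on_subset)
        show "0 \<le> C" by fact
        show "norm x * norm (g x) \<le> 2 * B0" if "x \<in> closure V" "x \<noteq> 0" for x
        proof -
          have "norm (f (A x)) \<le> B0" "norm (f z) \<le> B0" using B0(1) cl[OF that(1)] zs by auto
          then have "norm (f (A x) - f z) \<le> 2 * B0" by norm
          then show ?thesis using that by (simp add: normg)
        qed
        show "(w - z) / u \<in> V" using w q nu by (simp add: V_def A_def)
        show "norm (g x) \<le> C" if "x \<in> frontier V" "x \<noteq> 0" for x
        proof -
          have x: "x \<in> closure V" "x \<notin> V" using that \<open>open V\<close> by (auto simp: frontier_def interior_open)
          have nxs: "norm x \<le> 2 * s" "norm x > 0" using nx[OF x(1)] that by auto
          have absx: "\<bar>Re x\<bar> \<le> 2 * s" "\<bar>Im x\<bar> \<le> 2 * s"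
            using nxs abs_Re_le_cmod[of x] abs_Im_le_cmod[of x] by linarith+
          consider "Im x = 0" | "Re x = 0" | "A x \<notin> ball z1 s" | "A x \<in> ball z1 s" "A x \<notin> U"
            using x(2) cl[OF x(1)] unfolding V_def by fastforce
          then have "norm (f (A x) - f z) \<le> C * norm x"
          proof cases
            case 1
            then have xe: "x = of_real (Re x)" "norm x = \<bar>Re x\<bar>" by (auto simp: complex_eq_iff cmod_def)
            have "norm (f (z + of_real (Re x) * u) - f z) \<le> M * Re x"
              by (rule axis) (use z zs u cl[OF x(1)] absx in auto)
            also have "\<dots> \<le> C * Re x" using C cl[OF x(1)] by (intro mult_right_mono) auto
            finally show ?thesis using xe cl[OF x(1)] by (simp add: A_def mult.commute)
          next
            case 2
            then have xe: "x = of_real (Im x) * \<i>" "norm x = \<bar>Im x\<bar>" by (auto simp: complex_eq_iff cmod_def)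
            have "norm (f (z + of_real (Im x) * (\<i> * u)) - f z) \<le> M * Im x"
              by (rule axis) (use z zs u cl[OF x(1)] absx in auto)
            also have "\<dots> \<le> C * Im x" using C cl[OF x(1)] by (intro mult_right_mono) auto
            finally have "norm (f (z + of_real (Im x) * (\<i> * u)) - f z) \<le> C * Im x" .
            moreover have "A x = z + of_real (Im x) * (\<i> * u)"
              unfolding A_def by (subst xe(1)) (simp add: algebra_simps)
            ultimately show ?thesis using xe(2) cl[OF x(1)] by simp
          next
            case 3
            then have Ax: "norm (A x - z1) = s" using cl(1)[OF x(1)]
              by (auto simp: dist_norm norm_minus_commute)
            have "norm (A x - z1) \<le> norm (A x - z) + norm (z - z1)" by norm
            moreover have "norm (z - z1) < s / 2" using z(2) by (simp add: dist_norm norm_minus_commute)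
            moreover have "norm (A x - z) = norm x" using nu by (simp add: A_def norm_mult)
            ultimately have nxl: "s / 2 \<le> norm x" using Ax by linarith
            have "norm (f (A x)) \<le> B0" "norm (f z) \<le> B0" using B0(1) cl[OF x(1)] zs by auto
            then have "norm (f (A x) - f z) \<le> 2 * B0" by norm
            also have "\<dots> = (4 * B0 / s) * (s / 2)" using s by simp
            also have "\<dots> \<le> C * norm x" using C nxl s by (intro mult_mono) auto
            finally show ?thesis .
          next
            case 4
            then have "A x \<in> F" using FU[of "A x"] by auto
            then have "norm (f (A x) - f z) \<le> 2 * M * norm (A x - z)"
              using FF[OF z(1) zs] 4 by auto
            also have "norm (A x - z) = norm x" using nu by (simp add: A_def norm_mult)
            also have "2 * M * norm x \<le> C * norm x" using C by (intro mult_right_mono) auto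
            finally show ?thesis .
          qed
          then show ?thesis using nxs by (simp add: normg divide_le_eq)
        qed
      qed
      moreover have "A ((w - z) / u) = w" using nu by (simp add: A_def)
      moreover have "norm ((w - z) / u) = norm (w - z)" using nu by (simp add: norm_divide)
      moreover have "w \<noteq> z" using q by auto
      ultimately show ?thesis by (simp add: normg divide_le_eq)
    qed
    have atF: "norm (f w - f z) \<le> C * norm (w - z)"
      if z: "z \<in> F" "z \<in> ball z1 (s/2)" and w: "w \<in> ball z1 s" for z w
    proof -
      have zs: "z \<in> ball z1 s" using z(2) s by auto
      have d: "norm (w - z) < 2 * s"
        using zs w norm_triangle_ineq[of "w - z1" "z1 - z"] by (simp add: dist_norm norm_minus_commute)
      have re: "\<bar>Re (w - z)\<bar> \<le> norm (w - z)" "\<bar>Im (w - z)\<bar> \<le> norm (w - z)"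
        by (rule abs_Re_le_cmod abs_Im_le_cmod)+
      have CM: "M * norm (w - z) \<le> C * norm (w - z)" "2 * M * norm (w - z) \<le> C * norm (w - z)"
        using C by (intro mult_right_mono; simp)+
      show ?thesis
      proof (cases "w \<in> U")
        case False
        then have "w \<in> F" using FU[of w] w by auto
        then show ?thesis using FF[OF z(1) zs _ w] CM by fastforce
      next
        case True
        consider "Im (w - z) = 0" | "Re (w - z) = 0" | "Im (w - z) > 0" "Re (w - z) > 0"
          | "Im (w - z) > 0" "Re (w - z) < 0" | "Im (w - z) < 0" "Re (w - z) < 0"
          | "Im (w - z) < 0" "Re (w - z) > 0" by linarith
        then show ?thesis
        proof cases
          case 1
          then have "w = z + of_real (Re (w - z)) * 1" "norm (w - z) = \<bar>Re (w - z)\<bar>"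
            by (auto simp: complex_eq_iff cmod_def)
          then show ?thesis using axis'[OF z(1) zs, of "Re (w - z)" 1] d CM by auto
        next
          case 2
          then have "w = z + of_real (Im (w - z)) * \<i>" "norm (w - z) = \<bar>Im (w - z)\<bar>"
            by (auto simp: complex_eq_iff cmod_def)
          then show ?thesis using axis'[OF z(1) zs, of "Im (w - z)" \<i>] d CM by auto
        next
          case 3 then show ?thesis using quad[OF z w True, of 1] by simp
        next
          case 4 then show ?thesis using quad[OF z w True, of \<i>] by (simp add: Re_divide Im_divide)
        next
          case 5 then show ?thesis using quad[OF z w True, of "-1"] by simp
        next
          case 6 then show ?thesis using quad[OF z w True, of "-\<i>"] by (simp add: Re_divide Im_divide)
        qed
      qed
    qed
    define C' where "C' = C + 8 * B0 / s"
    have C': "C \<le> C'" "8 * B0 / s \<le> C'" "0 \<le> C'" using C B0 s by (auto simp: C'_def)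
    have lip: "norm (f x - f w) \<le> C' * norm (x - w)"
      if w: "w \<in> ball z1 (s/4)" and x: "x \<in> ball z1 (s/4)" for w x
    proof (cases "w \<in> U")
      case False
      then have "w \<in> F" using FU[of w] w s by auto
      then have "norm (f x - f w) \<le> C * norm (x - w)" using atF[of w x] w x s by auto
      also have "\<dots> \<le> C' * norm (x - w)" using C' by (intro mult_right_mono) auto
      finally show ?thesis .
    next
      case True
      define V where "V = ball z1 (s/2) \<inter> U"
      have V: "open V" "bounded V" using U by (auto simp: V_def intro: bounded_Int)
      have wV: "w \<in> V" using w s True by (auto simp: V_def)
      \<comment> \<open>Now \<open>w\<close> lies off \<open>F\<close> and is a removable singularity of the quotient; on \<open>F\<close> the bound is \<open>atF\<close>
        with the two points exchanged.\<close>
      define h where "h x = (if x = w then deriv f w else (f x - f w) / (x - w))" for x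
      have "f holomorphic_on V" using holU by (rule holomorphic_on_subset) (auto simp: V_def)
      moreover have "w \<in> interior V" using wV V by (simp add: interior_open)
      ultimately have holh: "h holomorphic_on V" unfolding h_def by (rule pole_lemma)
      have clV: "closure V \<subseteq> cball z1 (s/2)" unfolding V_def by (rule closure_minimal) auto
      have "cball z1 (s/2) \<subseteq> cball z1 s" using s by (intro subset_cball) auto
      then have clV': "closure V \<subseteq> cball z1 s" using clV by blast
      have contV: "continuous_on (closure V) h"
        unfolding continuous_on_eq_continuous_within
      proof
        fix x assume x: "x \<in> closure V"
        show "continuous (at x within closure V) h"
        proof (cases "x = w")
          case True
          have "continuous_on V h" by (rule holomorphic_on_imp_continuous_on[OF holh])
          then have "isCont h x" using V wV True by (simp add: continuous_on_eq_continuous_at)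
          then show ?thesis by (rule continuous_at_imp_continuous_at_within)
        next
          case False
          have "continuous_on (closure V - {w}) h"
          proof (subst continuous_on_cong[OF refl])
            show "continuous_on (closure V - {w}) (\<lambda>x. (f x - f w) / (x - w))"
              by (intro continuous_intros continuous_on_subset[OF contc]) (use clV' in auto)
          qed (auto simp: h_def)
          moreover have "at x within closure V = at x within (closure V - {w})"
            by (rule at_within_nhd[where S = "- {w}"]) (use False in auto)
          ultimately show ?thesis using x False by (auto simp: continuous_on_eq_continuous_within)
        qed
      qed
      have fr: "norm (h y) \<le> C'" if "y \<in> frontier V" for y
      proof -
        have y: "y \<in> closure V" "y \<notin> V" using that V by (auto simp: frontier_def interior_open)
        then have yw: "y \<noteq> w" using wV by auto
        have "norm (f y - f w) \<le> C' * norm (y - w)"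
        proof (cases "y \<in> ball z1 (s/2)")
          case True
          then have "y \<in> F" using y FU[of y] clV' by (auto simp: V_def)
          then have "norm (f w - f y) \<le> C * norm (w - y)" using atF[of y w] True w s by auto
          also have "\<dots> \<le> C' * norm (w - y)" using C' by (intro mult_right_mono) auto
          finally show ?thesis by (simp add: norm_minus_commute)
        next
          case False
          then have "norm (y - z1) = s / 2" using clV y by (auto simp: dist_norm norm_minus_commute)
          moreover have "norm (y - z1) \<le> norm (y - w) + norm (w - z1)" by norm
          moreover have "norm (w - z1) < s / 4" using w by (simp add: dist_norm norm_minus_commute)
          ultimately have nyl: "s / 4 \<le> norm (y - w)" by linarith
          have "norm (f y) \<le> B0" "norm (f w) \<le> B0" using B0(1) clV' y w s by auto
          then have "norm (f y - f w) \<le> 2 * B0" by norm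
          also have "\<dots> = (8 * B0 / s) * (s / 4)" using s by simp
          also have "\<dots> \<le> C' * norm (y - w)" using C' nyl s by (intro mult_mono) auto
          finally show ?thesis .
        qed
        then show ?thesis using yw by (simp add: h_def norm_divide divide_le_eq)
      qed
      show ?thesis
      proof (cases "x \<in> U")
        case xU: True
        have "x \<in> V" using x xU s by (auto simp: V_def)
        then have "norm (h x) \<le> C'"
          using maximum_modulus_frontier[of h V C' x] holh contV V fr by (simp add: interior_open)
        then show ?thesis by (cases "x = w") (auto simp: h_def norm_divide divide_le_eq)
      next
        case False
        then have "x \<in> F" using FU[of x] x s by auto
        then have "norm (f w - f x) \<le> C * norm (w - x)" using atF[of x w] w x s by auto
        also have "\<dots> \<le> C' * norm (w - x)" using C' by (intro mult_right_mono) auto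
        finally show ?thesis by (simp add: norm_minus_commute)
      qed
    qed
    have "f holomorphic_on ball z1 (s/4)"
    proof (rule holomorphic_onI)
      fix z assume z: "z \<in> ball z1 (s/4)"
      then obtain \<rho> where \<rho>: "\<rho> > 0" "ball z \<rho> \<subseteq> ball z1 (s/4)" by (meson open_ball openE)
      have "ball z1 (s/4) \<subseteq> S" using sub s by (auto simp: subset_iff)
      then obtain d where d: "gateaux_at f (\<lambda>h. h * d) z" using gat z by blast
      have "(f has_derivative (\<lambda>h. h * d)) (at z)"
        by (rule lipschitz_gateaux_imp_has_derivative[OF bounded_linear_mult_left d \<rho>(1)])
          (use lip \<rho> in blast)
      moreover have "(\<lambda>h. h * d) = (*) d" by (simp add: fun_eq_iff mult.commute)
      ultimately have "(f has_field_derivative d) (at z)"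
        by (simp only: has_field_derivative_def)
      then show "f field_differentiable at z within ball z1 (s/4)"
        using field_differentiable_at_within field_differentiable_def by blast
    qed
    moreover have "ball z1 (s/4) \<subseteq> S" using sub s by (auto simp: subset_iff)
    ultimately have "ball z1 (s/4) \<subseteq> U" unfolding U_def by blast
    moreover have "z1 \<in> ball z1 (s/4)" using s by simp
    ultimately have "z1 \<in> U" by blast
    then show False using z1 by (simp add: F_def)
  qed
  then show ?thesis using holU U(2) by (auto simp: F_def)
qed

section \<open>Directional and partial derivatives\<close>

text \<open>The defining limit is one-sided; oddness of \<open>D\<close> glues the limits along \<open>v\<close> and \<open>- v\<close>.\<close>

lemma gateaux_line_derivative:
  assumes gat: "gateaux_at u D (p + s *\<^sub>R v)" and odd: "D (- v) = - D v"
  shows "((\<lambda>t. u (p + t *\<^sub>R v)) has_vector_derivative D v) (at s within A)"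
proof (rule has_vector_derivative_at_within)
  show "((\<lambda>t. u (p + t *\<^sub>R v)) has_vector_derivative D v) (at s)"
    unfolding has_vector_derivative_def has_derivative_at_alt
  proof (intro conjI allI impI)
    show "bounded_linear (\<lambda>x. x *\<^sub>R D v)" by (rule bounded_linear_scaleR_left)
    fix e :: real assume "e > 0"
    define q where "q = p + s *\<^sub>R v"
    obtain d1 where d1: "d1 > 0" "\<And>t. 0 < t \<Longrightarrow> t < d1 \<Longrightarrow> norm (u (q + t *\<^sub>R v) - u q - t *\<^sub>R D v) \<le> e * t"
      using gateaux_atD[OF gat \<open>e > 0\<close>, of v] unfolding q_def by blast
    obtain d2 where d2: "d2 > 0" "\<And>t. 0 < t \<Longrightarrow> t < d2 \<Longrightarrow> norm (u (q + t *\<^sub>R (- v)) - u q - t *\<^sub>R D (- v)) \<le> e * t"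
      using gateaux_atD[OF gat \<open>e > 0\<close>, of "- v"] unfolding q_def by blast
    have "norm (u (p + y *\<^sub>R v) - u (p + s *\<^sub>R v) - (y - s) *\<^sub>R D v) \<le> e * norm (y - s)"
      if y: "norm (y - s) < min d1 d2" for y
    proof -
      have yq: "p + y *\<^sub>R v = q + (y - s) *\<^sub>R v" by (simp add: q_def algebra_simps)
      consider "y = s" | "y > s" | "y < s" by linarith
      then show ?thesis
      proof cases
        case 2
        then show ?thesis using d1(2)[of "y - s"] y unfolding yq by (simp add: q_def)
      next
        case 3
        then show ?thesis using d2(2)[of "s - y"] y unfolding yq odd
          by (simp add: q_def scaleR_minus_left[symmetric] del: scaleR_minus_left)
      qed (simp add: q_def)
    qed
    then show "\<exists>d>0. \<forall>y. norm (y - s) < d \<longrightarrow>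
        norm (u (p + y *\<^sub>R v) - u (p + s *\<^sub>R v) - (y - s) *\<^sub>R D v) \<le> e * norm (y - s)"
      using d1(1) d2(1) by (intro exI[of _ "min d1 d2"]) auto
  qed
qed

lemma has_derivative_line:
  assumes "(u has_derivative D) (at p)"
  shows "((\<lambda>t. u (p + t *\<^sub>R v)) has_vector_derivative D v) (at 0)"
proof -
  interpret bounded_linear D using assms by (rule has_derivative_bounded_linear)
  have "((\<lambda>t. p + t *\<^sub>R v) has_derivative (\<lambda>t. t *\<^sub>R v)) (at 0)"
    by (auto intro!: derivative_eq_intros)
  moreover have "(u has_derivative D) (at (p + 0 *\<^sub>R v))" using assms by simp
  ultimately have "((\<lambda>t. u (p + t *\<^sub>R v)) has_derivative (\<lambda>t. D (t *\<^sub>R v))) (at 0)"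
    by (rule has_derivative_compose)
  then show ?thesis by (simp add: has_vector_derivative_def scaleR)
qed

lemma has_derivative_imp_gateaux:
  assumes "(u has_derivative D) (at p)"
  shows "gateaux_at u D p"
  unfolding gateaux_at_def
proof
  fix v
  have "((\<lambda>t. norm (u (p + (0 + t) *\<^sub>R v) - u (p + 0 *\<^sub>R v) - t *\<^sub>R D v) / norm t) \<longlongrightarrow> 0) (at 0)"
    using has_derivative_line[OF assms, of v] unfolding has_vector_derivative_def has_derivative_at
    by (rule conjunct2)
  then have "((\<lambda>t. norm (u (p + t *\<^sub>R v) - u p - t *\<^sub>R D v) / norm t) \<longlongrightarrow> 0) (at_right 0)"
    by (simp add: tendsto_mono[OF at_le[OF subset_UNIV]])
  moreover have "eventually (\<lambda>t. norm (u (p + t *\<^sub>R v) - u p - t *\<^sub>R D v) / norm t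
      = norm ((u (p + t *\<^sub>R v) - u p) /\<^sub>R t - D v)) (at_right 0)"
    unfolding eventually_at_right_field
  proof (intro exI[of _ 1] conjI allI impI)
    fix t :: real assume t: "0 < t" "t < 1"
    have "(u (p + t *\<^sub>R v) - u p) /\<^sub>R t - D v = (u (p + t *\<^sub>R v) - u p - t *\<^sub>R D v) /\<^sub>R t"
      using t by (simp add: algebra_simps)
    then show "norm (u (p + t *\<^sub>R v) - u p - t *\<^sub>R D v) / norm t
      = norm ((u (p + t *\<^sub>R v) - u p) /\<^sub>R t - D v)"
      using t by (simp only: norm_scaleR) (simp add: field_simps)
  qed simp
  ultimately have "((\<lambda>t. norm ((u (p + t *\<^sub>R v) - u p) /\<^sub>R t - D v)) \<longlongrightarrow> 0) (at_right 0)"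
    by (rule Lim_transform_eventually)
  then show "((\<lambda>\<epsilon>. (u (p + \<epsilon> *\<^sub>R v) - u p) /\<^sub>R \<epsilon>) \<longlongrightarrow> D v) (at_right 0)"
    by (rule LIM_zero_cancel[OF tendsto_norm_zero_cancel])
qed

lemma partial_derivs_of_derivative:
  assumes "(u has_derivative D) (at p)"
  shows "has_partial_deriv j u p" "partial_deriv j u p = D (axis j 1)"
proof -
  have *: "((\<lambda>t. u (p + t *\<^sub>R axis j 1)) has_vector_derivative D (axis j 1)) (at 0)"
    by (rule has_derivative_line[OF assms])
  then show "has_partial_deriv j u p"
    unfolding has_partial_deriv_def by (rule differentiableI_vector)
  show "partial_deriv j u p = D (axis j 1)"
    unfolding partial_deriv_def using * by (rule vector_derivative_at)
qed

section \<open>Functions monogenic with respect to a linear form\<close>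

lemma bounded_linear_xi: "bounded_linear (xi a b)"
proof -
  have "linear (xi a b)"
    by (rule linearI) (simp_all add: xi_def algebra_simps scaleR_conv_of_real[where 'a = complex])
  then show ?thesis by (rule linear_conv_bounded_linear[THEN iffD1])
qed

lemmas linear_xi = bounded_linear.linear[OF bounded_linear_xi]
lemmas xi_add = linear_add[OF linear_xi]
  and xi_diff = linear_diff[OF linear_xi]
  and xi_minus = linear_neg[OF linear_xi]
  and xi_scaleR = linear_scale[OF linear_xi]

lemma xi_0 [simp]: "xi a b 0 = 0"
  by (rule linear_0[OF linear_xi])

lemma xi_axis [simp]: "xi a b (axis 1 1) = 1" "xi a b (axis 2 1) = a" "xi a b (axis 3 1) = b"
  by (simp_all add: xi_def axis_def)

lemma vec3_eq_axis: "v = v $ 1 *\<^sub>R axis 1 1 + v $ 2 *\<^sub>R axis 2 1 + v $ 3 *\<^sub>R axis 3 (1::real)" for v :: "real^3"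
  by (simp add: vec_eq_iff forall_3 axis_def)

lemma line_L_eq_kernel: "v \<in> line_L a b \<longleftrightarrow> xi a b v = 0"
  by (simp add: line_L_def xi_def complex_eq_iff)

lemma surj_xi_iff: "surj (xi a b) \<longleftrightarrow> Im a \<noteq> 0 \<or> Im b \<noteq> 0"
proof
  assume "surj (xi a b)"
  then obtain v where "xi a b v = \<i>" by (metis surjD)
  then have "v $ 2 * Im a + v $ 3 * Im b = 1" by (simp add: xi_def complex_eq_iff)
  then show "Im a \<noteq> 0 \<or> Im b \<noteq> 0" by auto
next
  have "\<zeta> \<in> range (xi a b)" if "Im a \<noteq> 0" for \<zeta>
    by (rule range_eqI[where x = "vector [Re \<zeta> - Im \<zeta> / Im a * Re a, Im \<zeta> / Im a, 0]"])
      (use that in \<open>simp add: xi_def complex_eq_iff\<close>)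
  moreover have "\<zeta> \<in> range (xi a b)" if "Im b \<noteq> 0" for \<zeta>
    by (rule range_eqI[where x = "vector [Re \<zeta> - Im \<zeta> / Im b * Re b, 0, Im \<zeta> / Im b]"])
      (use that in \<open>simp add: xi_def complex_eq_iff\<close>)
  moreover assume "Im a \<noteq> 0 \<or> Im b \<noteq> 0"
  ultimately show "surj (xi a b)" by blast
qed

text \<open>This is the scalar form of G-monogenicity: multiplication by an element of \<open>E\<^sub>3\<close> acts on each of the
four coordinates as multiplication by \<open>\<xi>\<^sub>1\<close> or \<open>\<xi>\<^sub>2\<close>.\<close>

definition xi_monogenic ::
  "complex \<Rightarrow> complex \<Rightarrow> (real^3) set \<Rightarrow> (real^3 \<Rightarrow> complex) \<Rightarrow> bool" where
  "xi_monogenic a b \<Omega> u \<longleftrightarrow>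
     continuous_on \<Omega> u \<and> (\<forall>p\<in>\<Omega>. \<exists>d. gateaux_at u (\<lambda>v. xi a b v * d) p)"

lemma xi_monogenic_subset:
  "xi_monogenic a b \<Omega> u \<Longrightarrow> \<Omega>' \<subseteq> \<Omega> \<Longrightarrow> xi_monogenic a b \<Omega>' u"
  unfolding xi_monogenic_def by (blast intro: continuous_on_subset)

text \<open>The derivative in a direction killed by \<open>xi a b\<close> vanishes.\<close>

lemma xi_monogenic_constant_on_fibre:
  assumes mono: "xi_monogenic a b \<Omega> u" and seg: "closed_segment p q \<subseteq> \<Omega>" and eq: "xi a b p = xi a b q"
  shows "u p = u q"
proof -
  define \<phi> where "\<phi> t = u (p + t *\<^sub>R (q - p))" for t
  have ker: "xi a b (q - p) = 0" by (simp add: xi_diff eq)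
  have "\<exists>c. \<forall>t\<in>{0..1}. \<phi> t = c"
  proof (rule has_derivative_zero_constant)
    fix t :: real assume t: "t \<in> {0..1}"
    have "p + t *\<^sub>R (q - p) = (1 - t) *\<^sub>R p + t *\<^sub>R q" by (simp add: algebra_simps)
    then have "p + t *\<^sub>R (q - p) \<in> \<Omega>" using seg t by (auto simp: closed_segment_def)
    then obtain d where "gateaux_at u (\<lambda>v. xi a b v * d) (p + t *\<^sub>R (q - p))"
      using mono unfolding xi_monogenic_def by blast
    then have "(\<phi> has_vector_derivative xi a b (q - p) * d) (at t within {0..1})"
      unfolding \<phi>_def by (rule gateaux_line_derivative) (simp only: xi_minus mult_minus_left)
    then show "(\<phi> has_derivative (\<lambda>h. 0)) (at t within {0..1})"
      by (simp add: has_vector_derivative_def ker)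
  qed simp
  then have "\<phi> 0 = \<phi> 1" by force
  then show ?thesis by (simp add: \<phi>_def)
qed

text \<open>Convexity in the direction of the kernel makes every fibre of \<open>xi a b\<close> in \<open>\<Omega>\<close> an interval, on which \<open>u\<close>
is constant; so \<open>u\<close> descends to a function \<open>g\<close> on the image. Composing with a linear right inverse
of \<open>xi a b\<close> shows that \<open>g\<close> inherits continuity and a complex linear Gateaux derivative.\<close>
lemma xi_monogenic_imp_holomorphic_factor:
  assumes mono: "xi_monogenic a b \<Omega> u" and \<Omega>: "open \<Omega>" and surj: "surj (xi a b)"
    and conv: "convex_in_direction (line_L a b) \<Omega>"
  obtains g where "g holomorphic_on xi a b ` \<Omega>" "\<And>p. p \<in> \<Omega> \<Longrightarrow> u p = g (xi a b p)"
proof -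
  have fibre: "u p = u q" if "p \<in> \<Omega>" "q \<in> \<Omega>" "xi a b p = xi a b q" for p q
  proof (rule xi_monogenic_constant_on_fibre[OF mono _ that(3)])
    have "q - p \<in> line_L a b" using that by (simp add: line_L_eq_kernel xi_diff)
    then show "closed_segment p q \<subseteq> \<Omega>" using conv that unfolding convex_in_direction_def by blast
  qed
  define g where "g \<zeta> = u (SOME p. p \<in> \<Omega> \<and> xi a b p = \<zeta>)" for \<zeta>
  have g: "u p = g (xi a b p)" if "p \<in> \<Omega>" for p
  proof -
    define q where "q = (SOME q. q \<in> \<Omega> \<and> xi a b q = xi a b p)"
    have "q \<in> \<Omega> \<and> xi a b q = xi a b p"
      unfolding q_def by (rule someI[of _ p]) (use that in simp)
    then have "u p = u q" using fibre[OF that, of q] by simp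
    then show ?thesis unfolding g_def q_def .
  qed
  obtain \<sigma> where "linear \<sigma>" and xi_\<sigma>: "\<And>\<zeta>. xi a b (\<sigma> \<zeta>) = \<zeta>"
    using real_vector.linear_surjective_right_inverse[OF linear_xi surj]
    by (auto simp: o_def fun_eq_iff)
  then have \<sigma>: "bounded_linear \<sigma>" by (simp add: linear_conv_bounded_linear)
  have opn: "open (xi a b ` \<Omega>)" by (rule open_surjective_linear_image[OF \<Omega> linear_xi surj])
  have "g holomorphic_on xi a b ` \<Omega>"
  proof (rule gateaux_holomorphic[OF opn])
    have local: "\<exists>\<delta>>0. \<forall>\<zeta>. dist \<zeta> (xi a b p) < \<delta> \<longrightarrow> p + \<sigma> (\<zeta> - xi a b p) \<in> \<Omega>"
      if p: "p \<in> \<Omega>" for p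
    proof -
      have "continuous_on UNIV (\<lambda>\<zeta>. p + \<sigma> (\<zeta> - xi a b p))"
        by (intro continuous_intros bounded_linear.continuous_on[OF \<sigma>])
      with \<Omega> have "open ((\<lambda>\<zeta>. p + \<sigma> (\<zeta> - xi a b p)) -` \<Omega>)" by (rule open_vimage)
      moreover have "xi a b p \<in> (\<lambda>\<zeta>. p + \<sigma> (\<zeta> - xi a b p)) -` \<Omega>"
        using p by (simp add: linear_0[OF \<open>linear \<sigma>\<close>])
      ultimately show ?thesis unfolding open_dist by auto
    qed
    have loc_eq: "g \<zeta> = u (p + \<sigma> (\<zeta> - xi a b p))" if "p + \<sigma> (\<zeta> - xi a b p) \<in> \<Omega>" for p \<zeta>
      using g[OF that] by (simp add: xi_add xi_\<sigma>)
    show "continuous_on (xi a b ` \<Omega>) g"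
      unfolding continuous_on_eq_continuous_at[OF opn]
    proof
      fix \<zeta>0 assume "\<zeta>0 \<in> xi a b ` \<Omega>"
      then obtain p where p: "p \<in> \<Omega>" "\<zeta>0 = xi a b p" by blast
      obtain \<delta> where \<delta>: "\<delta> > 0" "\<And>\<zeta>. dist \<zeta> \<zeta>0 < \<delta> \<Longrightarrow> p + \<sigma> (\<zeta> - \<zeta>0) \<in> \<Omega>"
        using local[OF p(1)] p(2) by blast
      have "continuous_on (ball \<zeta>0 \<delta>) (\<lambda>\<zeta>. p + \<sigma> (\<zeta> - \<zeta>0))"
        by (intro continuous_intros bounded_linear.continuous_on[OF \<sigma>])
      moreover have "(\<lambda>\<zeta>. p + \<sigma> (\<zeta> - \<zeta>0)) ` ball \<zeta>0 \<delta> \<subseteq> \<Omega>"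
        using \<delta>(2) by (auto simp: dist_commute)
      moreover have "continuous_on \<Omega> u" using mono by (simp add: xi_monogenic_def)
      ultimately have "continuous_on (ball \<zeta>0 \<delta>) (\<lambda>\<zeta>. u (p + \<sigma> (\<zeta> - \<zeta>0)))"
        by (metis continuous_on_compose2)
      moreover have "u (p + \<sigma> (\<zeta> - \<zeta>0)) = g \<zeta>" if "\<zeta> \<in> ball \<zeta>0 \<delta>" for \<zeta>
        using loc_eq[of p \<zeta>] \<delta>(2)[of \<zeta>] that p(2) by (simp add: dist_commute)
      ultimately have "continuous_on (ball \<zeta>0 \<delta>) g" by (simp cong: continuous_on_cong_simp)
      then show "isCont g \<zeta>0" using \<delta>(1) by (simp add: continuous_on_eq_continuous_at)
    qed
    fix \<zeta>0 assume "\<zeta>0 \<in> xi a b ` \<Omega>"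
    then obtain p where p: "p \<in> \<Omega>" "\<zeta>0 = xi a b p" by blast
    obtain \<delta> where \<delta>: "\<delta> > 0" "\<And>\<zeta>. dist \<zeta> \<zeta>0 < \<delta> \<Longrightarrow> p + \<sigma> (\<zeta> - \<zeta>0) \<in> \<Omega>"
      using local[OF p(1)] p(2) by blast
    obtain d where d: "gateaux_at u (\<lambda>v. xi a b v * d) p" using mono p by (auto simp: xi_monogenic_def)
    have "gateaux_at g (\<lambda>h. h * d) \<zeta>0"
      unfolding gateaux_at_def
    proof
      fix h
      have "((\<lambda>\<epsilon>. (u (p + \<epsilon> *\<^sub>R \<sigma> h) - u p) /\<^sub>R \<epsilon>) \<longlongrightarrow> h * d) (at_right 0)"
        using d[unfolded gateaux_at_def, rule_format, of "\<sigma> h"] by (simp add: xi_\<sigma>)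
      moreover have "eventually (\<lambda>\<epsilon>. (u (p + \<epsilon> *\<^sub>R \<sigma> h) - u p) /\<^sub>R \<epsilon> = (g (\<zeta>0 + \<epsilon> *\<^sub>R h) - g \<zeta>0) /\<^sub>R \<epsilon>) (at_right 0)"
        unfolding eventually_at_right_field
      proof (intro exI[of _ "\<delta> / (norm h + 1)"] conjI allI impI)
        have nh: "norm h + 1 > 0" using norm_ge_zero[of h] by linarith
        show "\<delta> / (norm h + 1) > 0" using \<delta>(1) nh by simp
        fix \<epsilon> :: real assume e: "\<epsilon> > 0" "\<epsilon> < \<delta> / (norm h + 1)"
        have "\<epsilon> * norm h \<le> \<epsilon> * (norm h + 1)" using e by (intro mult_left_mono) auto
        also have "\<dots> < \<delta>" using e nh by (simp add: field_simps)
        finally have "dist (\<zeta>0 + \<epsilon> *\<^sub>R h) \<zeta>0 < \<delta>" using e by (simp add: dist_norm)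
        from \<delta>(2)[OF this] have "p + \<epsilon> *\<^sub>R \<sigma> h \<in> \<Omega>" by (simp add: linear_scale[OF \<open>linear \<sigma>\<close>])
        from g[OF this] show "(u (p + \<epsilon> *\<^sub>R \<sigma> h) - u p) /\<^sub>R \<epsilon> = (g (\<zeta>0 + \<epsilon> *\<^sub>R h) - g \<zeta>0) /\<^sub>R \<epsilon>"
          using g[OF p(1)] p(2) by (simp add: xi_add xi_scaleR xi_\<sigma>)
      qed
      ultimately show "((\<lambda>\<epsilon>. (g (\<zeta>0 + \<epsilon> *\<^sub>R h) - g \<zeta>0) /\<^sub>R \<epsilon>) \<longlongrightarrow> h * d) (at_right 0)"
        by (rule Lim_transform_eventually)
    qed
    then show "\<exists>d. gateaux_at g (\<lambda>h. h * d) \<zeta>0" by blast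
  qed
  then show thesis using g by (rule that)
qed

lemma has_derivative_holomorphic_comp_xi:
  assumes "(g has_field_derivative d) (at (xi a b p))"
  shows "((\<lambda>p. g (xi a b p)) has_derivative (\<lambda>v. xi a b v * d)) (at p)"
proof -
  have "(xi a b has_derivative xi a b) (at p)"
    by (rule bounded_linear_imp_has_derivative[OF bounded_linear_xi])
  moreover have "(g has_derivative (*) d) (at (xi a b p))"
    using assms by (simp add: has_field_derivative_def)
  ultimately have "((\<lambda>p. g (xi a b p)) has_derivative (\<lambda>v. d * xi a b v)) (at p)"
    by (rule has_derivative_compose)
  then show ?thesis by (simp add: mult.commute)
qed

lemma has_derivative_imp_xi_monogenic:
  assumes "\<And>p. p \<in> \<Omega> \<Longrightarrow> \<exists>d. (u has_derivative (\<lambda>v. xi a b v * d)) (at p)"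
  shows "xi_monogenic a b \<Omega> u"
  unfolding xi_monogenic_def
proof
  show "continuous_on \<Omega> u"
    using assms by (intro continuous_at_imp_continuous_on ballI) (blast dest: has_derivative_continuous)
  show "\<forall>p\<in>\<Omega>. \<exists>d. gateaux_at u (\<lambda>v. xi a b v * d) p"
    using assms has_derivative_imp_gateaux by blast
qed

lemma holomorphic_factor_imp_has_derivative:
  assumes \<Omega>: "open \<Omega>" and G: "open G" "xi a b ` \<Omega> \<subseteq> G" "g holomorphic_on G"
    and u: "\<And>p. p \<in> \<Omega> \<Longrightarrow> u p = g (xi a b p)" and p: "p \<in> \<Omega>"
  shows "(u has_derivative (\<lambda>v. xi a b v * deriv g (xi a b p))) (at p)"
proof -
  have "(g has_field_derivative deriv g (xi a b p)) (at (xi a b p))"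
    by (rule holomorphic_derivI[OF G(3,1) subsetD[OF G(2) imageI[OF p]]])
  from has_derivative_holomorphic_comp_xi[OF this] show ?thesis
    by (rule has_derivative_transform_within_open[OF _ \<Omega> p]) (simp add: u)
qed

lemma convex_imp_convex_in_direction: "convex \<Omega> \<Longrightarrow> convex_in_direction L \<Omega>"
  unfolding convex_in_direction_def by (simp add: closed_segment_subset)

text \<open>On a ball \<open>u\<close> is a function of \<open>xi a b\<close> alone. If the form is onto \<open>\<complex>\<close>, this function is
holomorphic. Otherwise the form is real valued, and a function of one real variable needs only its
ordinary derivative.\<close>

lemma xi_monogenic_imp_has_derivative:
  assumes mono: "xi_monogenic a b \<Omega> u" and \<Omega>: "open \<Omega>" and p: "p \<in> \<Omega>"
  shows "\<exists>d. (u has_derivative (\<lambda>v. xi a b v * d)) (at p)"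
proof -
  obtain r where r: "r > 0" "ball p r \<subseteq> \<Omega>" using \<Omega> p by (meson openE)
  have mono_r: "xi_monogenic a b (ball p r) u" using mono r(2) by (rule xi_monogenic_subset)
  show ?thesis
  proof (cases "surj (xi a b)")
    case True
    obtain g where g: "g holomorphic_on xi a b ` ball p r" "\<And>q. q \<in> ball p r \<Longrightarrow> u q = g (xi a b q)"
      using xi_monogenic_imp_holomorphic_factor[OF mono_r open_ball True
          convex_imp_convex_in_direction[OF convex_ball]] by blast
    have "open (xi a b ` ball p r)" by (rule open_surjective_linear_image[OF open_ball linear_xi True])
    from holomorphic_factor_imp_has_derivative[OF open_ball this order_refl g, of p] r(1)
    show ?thesis by auto
  next
    case False
    then have re: "xi a b v = of_real (Re (xi a b v))" for v
      using False unfolding surj_xi_iff by (simp add: complex_eq_iff xi_def)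
    define x where "x q = Re (xi a b (q - p))" for q
    define \<phi> where "\<phi> t = u (p + t *\<^sub>R axis 1 1)" for t
    obtain d where d: "gateaux_at u (\<lambda>v. xi a b v * d) p"
      using mono p by (auto simp: xi_monogenic_def)
    then have "(\<phi> has_vector_derivative d) (at 0)"
      unfolding \<phi>_def using gateaux_line_derivative[of u "\<lambda>v. xi a b v * d" p 0 "axis 1 1" UNIV]
      by (simp add: xi_minus)
    then have \<phi>': "(\<phi> has_derivative (\<lambda>t. t *\<^sub>R d)) (at (x p))"
      by (simp add: has_vector_derivative_def x_def)
    have x': "(x has_derivative (\<lambda>v. Re (xi a b v))) (at q)" for q
      unfolding x_def by (auto intro!: derivative_eq_intros bounded_linear_imp_has_derivative[OF bounded_linear_xi, THEN has_derivative_compose[rotated]]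
         simp: xi_diff bounded_linear.has_derivative[OF bounded_linear_xi])
    have comp: "((\<lambda>q. \<phi> (x q)) has_derivative (\<lambda>v. Re (xi a b v) *\<^sub>R d)) (at p)"
      by (rule has_derivative_compose[OF x' \<phi>'])
    have "isCont x p" using x' by (rule has_derivative_continuous)
    then have "eventually (\<lambda>q. dist (x q) (x p) < r) (at p)"
      unfolding isCont_def using r(1) by (rule tendstoD)
    then obtain s where s: "s > 0" "\<And>q. q \<noteq> p \<Longrightarrow> dist q p < s \<Longrightarrow> \<bar>x q\<bar> < r"
      by (auto simp: eventually_at x_def dist_real_def)
    have eq: "\<phi> (x q) = u q" if q: "dist q p < min s r" for q
    proof -
      have "\<bar>x q\<bar> < r" using s(2)[of q] q r(1) by (cases "q = p") (auto simp: x_def)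
      then have "p + x q *\<^sub>R axis 1 1 \<in> ball p r" by (simp add: dist_norm)
      moreover have "q \<in> ball p r" using q by (simp add: dist_commute)
      ultimately have "closed_segment (p + x q *\<^sub>R axis 1 1) q \<subseteq> ball p r"
        by (simp add: closed_segment_subset)
      moreover have "xi a b (p + x q *\<^sub>R axis 1 1) = xi a b q"
      proof -
        have "xi a b q - xi a b p = of_real (x q)" using re[of "q - p"] by (simp only: x_def xi_diff)
        then have "xi a b q = xi a b p + of_real (x q)" by (simp add: algebra_simps)
        then show ?thesis by (simp add: xi_add xi_scaleR scaleR_conv_of_real[where 'a = complex])
      qed
      ultimately show ?thesis unfolding \<phi>_def by (rule xi_monogenic_constant_on_fibre[OF mono_r])
    qed
    have "(u has_derivative (\<lambda>v. Re (xi a b v) *\<^sub>R d)) (at p)"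
      by (rule has_derivative_transform_within[OF comp, of "min s r"]) (use s r eq in auto)
    moreover have "Re (xi a b v) *\<^sub>R d = xi a b v * d" for v
      by (subst (2) re) (simp add: scaleR_conv_of_real)
    ultimately show ?thesis by auto
  qed
qed

lemma xi_monogenic_iff_cauchy_riemann:
  assumes "open \<Omega>"
  shows "xi_monogenic a b \<Omega> u \<longleftrightarrow> (\<forall>p\<in>\<Omega>. u differentiable (at p) \<and>
     partial_deriv 2 u p = a * partial_deriv 1 u p \<and> partial_deriv 3 u p = b * partial_deriv 1 u p)"
  (is "_ \<longleftrightarrow> (\<forall>p\<in>\<Omega>. ?R p)")
proof
  assume L: "xi_monogenic a b \<Omega> u"
  show "\<forall>p\<in>\<Omega>. ?R p"
  proof
    fix p assume "p \<in> \<Omega>"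
    then obtain d where "(u has_derivative (\<lambda>v. xi a b v * d)) (at p)"
      using xi_monogenic_imp_has_derivative[OF L assms] by blast
    then show "?R p" by (auto simp: differentiable_def partial_derivs_of_derivative)
  qed
next
  assume R: "\<forall>p\<in>\<Omega>. ?R p"
  show "xi_monogenic a b \<Omega> u"
  proof (rule has_derivative_imp_xi_monogenic)
    fix p assume p: "p \<in> \<Omega>"
    then obtain D where D: "(u has_derivative D) (at p)" using R by (auto simp: differentiable_def)
    interpret bounded_linear D using D by (rule has_derivative_bounded_linear)
    have pd: "D (axis j 1) = partial_deriv j u p" for j
      using partial_derivs_of_derivative(2)[OF D] by simp
    have "D v = xi a b v * D (axis 1 1)" for v
    proof -
      have "D v = v $ 1 *\<^sub>R D (axis 1 1) + v $ 2 *\<^sub>R D (axis 2 1) + v $ 3 *\<^sub>R D (axis 3 1)"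
        by (subst vec3_eq_axis) (simp only: add scaleR)
      then show ?thesis using R p
        by (simp add: pd xi_def scaleR_conv_of_real algebra_simps)
    qed
    then have "D = (\<lambda>v. xi a b v * D (axis 1 1))" by blast
    then show "\<exists>d. (u has_derivative (\<lambda>v. xi a b v * d)) (at p)" using D by metis
  qed
qed

section \<open>Power series in a linear form\<close>

text \<open>For the converse only the derivative at the centre of each expansion is used, since the centre is
arbitrary.\<close>

lemma xi_monogenic_iff_power_series:
  assumes \<Omega>: "open \<Omega>" and surj: "surj (xi a b)"
  shows "xi_monogenic a b \<Omega> u \<longleftrightarrow> (\<forall>p0\<in>\<Omega>. \<exists>N c. open N \<and> p0 \<in> N \<and> N \<subseteq> \<Omega> \<and>
     (\<forall>p\<in>N. (\<lambda>n. c n * xi a b (p - p0) ^ n) sums u p))" (is "_ \<longleftrightarrow> (\<forall>p0\<in>\<Omega>. ?R p0)")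
proof
  have opn: "open (xi a b ` N)" if "open N" for N
    by (rule open_surjective_linear_image[OF that linear_xi surj])
  have cont: "continuous_on UNIV (xi a b)"
    by (rule linear_continuous_on[OF bounded_linear_xi])
  {
    assume L: "xi_monogenic a b \<Omega> u"
    show "\<forall>p0\<in>\<Omega>. ?R p0"
    proof
      fix p0 assume "p0 \<in> \<Omega>"
      then obtain r where r: "r > 0" "ball p0 r \<subseteq> \<Omega>" using \<Omega> by (meson openE)
      obtain g where g: "g holomorphic_on xi a b ` ball p0 r" "\<And>p. p \<in> ball p0 r \<Longrightarrow> u p = g (xi a b p)"
        using xi_monogenic_imp_holomorphic_factor[OF xi_monogenic_subset[OF L r(2)] open_ball surj
          convex_imp_convex_in_direction[OF convex_ball]] by blast
      have "xi a b p0 \<in> xi a b ` ball p0 r" using r by simp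
      then obtain \<rho> where \<rho>: "\<rho> > 0" "ball (xi a b p0) \<rho> \<subseteq> xi a b ` ball p0 r"
        using opn[OF open_ball] by (meson openE)
      define N where "N = ball p0 r \<inter> xi a b -` ball (xi a b p0) \<rho>"
      define c where "c n = (deriv ^^ n) g (xi a b p0) / fact n" for n
      have "open N" unfolding N_def by (intro open_Int open_vimage cont open_ball)
      moreover have "p0 \<in> N" "N \<subseteq> \<Omega>" using r \<rho> by (auto simp: N_def)
      moreover have "(\<lambda>n. c n * xi a b (p - p0) ^ n) sums u p" if "p \<in> N" for p
        using holomorphic_power_series[of g "xi a b p0" \<rho> "xi a b p"] g \<rho> that
        by (auto simp: c_def xi_diff N_def intro: holomorphic_on_subset)
      ultimately show "?R p0" by blast
    qed
  next
    assume R: "\<forall>p0\<in>\<Omega>. ?R p0"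
    show "xi_monogenic a b \<Omega> u"
    proof (rule has_derivative_imp_xi_monogenic)
      fix p0 assume "p0 \<in> \<Omega>"
      then obtain N c where N: "open N" "p0 \<in> N" "N \<subseteq> \<Omega>"
        and sums: "\<And>p. p \<in> N \<Longrightarrow> (\<lambda>n. c n * xi a b (p - p0) ^ n) sums u p"
        using R by meson
      have "xi a b p0 \<in> xi a b ` N" using N by simp
      then obtain \<rho> where \<rho>: "\<rho> > 0" "ball (xi a b p0) \<rho> \<subseteq> xi a b ` N"
        using opn[OF N(1)] by (meson openE)
      define f where "f \<zeta> = (\<Sum>n. c n * (\<zeta> - xi a b p0) ^ n)" for \<zeta>
      have fu: "u p = f (xi a b p)" if "p \<in> N" for p
        using sums[OF that] by (simp add: f_def xi_diff sums_iff)
      have "f holomorphic_on ball (xi a b p0) \<rho>"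
      proof (rule power_series_holomorphic)
        fix w assume "w \<in> ball (xi a b p0) \<rho>"
        then obtain p where p: "p \<in> N" "w = xi a b p" using \<rho> by blast
        show "(\<lambda>n. c n * (w - xi a b p0) ^ n) sums f w"
          using sums[OF p(1)] fu[OF p(1)] p(2) by (simp add: xi_diff)
      qed
      moreover define N' where "N' = N \<inter> xi a b -` ball (xi a b p0) \<rho>"
      have "open N'" unfolding N'_def by (intro open_Int open_vimage cont open_ball N)
      moreover have "xi a b ` N' \<subseteq> ball (xi a b p0) \<rho>" "p0 \<in> N'" using N \<rho> by (auto simp: N'_def)
      moreover have "\<And>p. p \<in> N' \<Longrightarrow> u p = f (xi a b p)" using fu by (auto simp: N'_def)
      ultimately show "\<exists>d. (u has_derivative (\<lambda>v. xi a b v * d)) (at p0)"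
        using holomorphic_factor_imp_has_derivative[of N' "ball (xi a b p0) \<rho>" a b f u p0] by blast
    qed
  }
qed

section \<open>Line integrals over triangles\<close>

lemma has_line_integral_unique:
  assumes "has_line_integral j \<gamma> W c" "has_line_integral j \<gamma> W c'"
  shows "c = c'"
proof (rule ccontr)
  assume "c \<noteq> c'"
  define e where "e = norm (c - c') / 2"
  have "e > 0" using \<open>c \<noteq> c'\<close> by (simp add: e_def)
  define R where "R P = (\<Sum>(t, K)\<in>P. W (\<gamma> t) * of_real (\<gamma> (Sup K) $ j - \<gamma> (Inf K) $ j))"
    for P :: "(real \<times> real set) set"
  obtain d where d: "d > 0" "\<And>P. P tagged_division_of {0..1} \<Longrightarrow> (\<forall>(t, K)\<in>P. diameter K < d) \<Longrightarrow> norm (R P - c) < e"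
    using assms(1) \<open>e > 0\<close> unfolding has_line_integral_def R_def by meson
  obtain d' where d': "d' > 0" "\<And>P. P tagged_division_of {0..1} \<Longrightarrow> (\<forall>(t, K)\<in>P. diameter K < d') \<Longrightarrow> norm (R P - c') < e"
    using assms(2) \<open>e > 0\<close> unfolding has_line_integral_def R_def by meson
  define m where "m = min d d' / 3"
  have m: "m > 0" using d d' by (simp add: m_def)
  have "gauge (\<lambda>x::real. ball x m)" using m by (simp add: gauge_def)
  then obtain P where P: "P tagged_division_of {0..1::real}" "(\<lambda>x. ball x m) fine P"
    by (rule fine_division_exists_real)
  have "diameter K < min d d'" if "(t, K) \<in> P" for t K
  proof -
    have "K \<subseteq> ball t m" using P(2) that by (auto simp: fine_def)
    then have "diameter K \<le> diameter (ball t m)" by (intro diameter_subset) auto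
    also have "\<dots> = 2 * m" using m by (simp add: diameter_ball)
    also have "\<dots> < min d d'" using m unfolding m_def by linarith
    finally show ?thesis .
  qed
  then have "norm (R P - c) < e" "norm (R P - c') < e"
    by (intro d(2) d'(2) P(1); force)+
  then have "norm (c - c') < 2 * e"
    using norm_triangle_ineq4[of "R P - c'" "R P - c"] by (simp add: algebra_simps)
  then show False by (simp add: e_def)
qed

lemma line_integral_eqI: "has_line_integral j \<gamma> W c \<Longrightarrow> line_integral j \<gamma> W = c"
  unfolding line_integral_def using has_line_integral_unique by blast

text \<open>On a fine subinterval the Riemann-Stieltjes term differs from the integral of \<open>W (\<gamma> t) \<gamma>' t\<close> only by the
oscillation of \<open>W \<circ> \<gamma>\<close>, times the bound \<open>M\<close> for the speed and the length. The speed is allowed to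
jump on the finite set \<open>S\<close>, as at the vertices of a triangle.\<close>

lemma has_line_integral_derivative:
  fixes \<gamma> \<gamma>' :: "real \<Rightarrow> real^3"
  assumes cont: "continuous_on {0..1} \<gamma>" and contW: "continuous_on {0..1} (\<lambda>t. W (\<gamma> t))"
    and S: "finite S"
    and deriv: "\<And>t. t \<in> {0..1} - S \<Longrightarrow> (\<gamma> has_vector_derivative \<gamma>' t) (at t)"
    and bound: "\<And>t. norm (\<gamma>' t) \<le> M"
    and int: "((\<lambda>t. W (\<gamma> t) * of_real (\<gamma>' t $ j)) has_integral c) {0..1}"
  shows "has_line_integral j \<gamma> W c"
  unfolding has_line_integral_def
proof (intro allI impI)
  fix \<epsilon> :: real assume "\<epsilon> > 0"
  have "M \<ge> 0" using bound[of 0] norm_ge_zero order_trans by blast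
  define \<eta> where "\<eta> = \<epsilon> / (2 * (M + 1))"
  have "\<eta> > 0" using \<open>\<epsilon> > 0\<close> \<open>M \<ge> 0\<close> by (simp add: \<eta>_def)
  have "\<eta> * M < \<epsilon>" using \<open>\<epsilon> > 0\<close> \<open>M \<ge> 0\<close>
    by (simp add: \<eta>_def field_simps add_nonneg_pos)
  have "uniformly_continuous_on {0..1} (\<lambda>t. W (\<gamma> t))"
    using contW by (intro compact_uniformly_continuous) auto
  then obtain \<delta> where \<delta>: "\<delta> > 0"
    "\<And>s t. s \<in> {0..1} \<Longrightarrow> t \<in> {0..1} \<Longrightarrow> dist t s < \<delta> \<Longrightarrow> dist (W (\<gamma> t)) (W (\<gamma> s)) < \<eta>"
    using \<open>\<eta> > 0\<close> unfolding uniformly_continuous_on_def by metis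
  have "norm ((\<Sum>(t, K)\<in>P. W (\<gamma> t) * of_real (\<gamma> (Sup K) $ j - \<gamma> (Inf K) $ j)) - c) < \<epsilon>"
    if P: "P tagged_division_of {0..1}" and fine: "\<forall>(t, K)\<in>P. diameter K < \<delta>" for P
  proof -
    let ?h = "\<lambda>t. W (\<gamma> t) * of_real (\<gamma>' t $ j)"
    have "c = integral {0..1} ?h" using int by (simp add: integral_unique)
    also have "\<dots> = (\<Sum>(t, K)\<in>P. integral K ?h)"
      using integral_combine_tagged_division_topdown[of ?h 0 1 P] P has_integral_integrable[OF int]
      by simp
    finally have c: "c = (\<Sum>(t, K)\<in>P. integral K ?h)" .
    have piece: "norm (W (\<gamma> t) * of_real (\<gamma> (Sup K) $ j - \<gamma> (Inf K) $ j) - integral K ?h) \<le> \<eta> * M * measure lborel K"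
      if tK: "(t, K) \<in> P" for t K
    proof -
      obtain l r where K: "K = {l..r}" using tagged_division_ofD(4)[OF P tK] by (auto simp: box_real)
      have t: "t \<in> K" using tagged_division_ofD(2)[OF P tK] .
      then have lr: "l \<le> r" using K by auto
      have sub: "{l..r} \<subseteq> {0..1}" using tagged_division_ofD(3)[OF P tK] K by simp
      have "((\<lambda>s. \<gamma>' s $ j) has_integral (\<gamma> r $ j - \<gamma> l $ j)) {l..r}"
      proof (rule fundamental_theorem_of_calculus_interior_strong[OF S lr])
        fix s assume s: "s \<in> {l<..<r} - S"
        then have "(\<gamma> has_vector_derivative \<gamma>' s) (at s)" using sub lr by (intro deriv) auto
        then show "((\<lambda>s. \<gamma> s $ j) has_vector_derivative \<gamma>' s $ j) (at s)"
          by (rule bounded_linear.has_vector_derivative[OF bounded_linear_vec_nth])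
      next
        show "continuous_on {l..r} (\<lambda>s. \<gamma> s $ j)"
          using continuous_on_subset[OF cont sub] by (intro continuous_intros)
      qed
      then have "((\<lambda>s. complex_of_real (\<gamma>' s $ j)) has_integral of_real (\<gamma> r $ j - \<gamma> l $ j)) {l..r}"
        by (rule has_integral_of_real)
      then have 1: "((\<lambda>s. W (\<gamma> t) * of_real (\<gamma>' s $ j)) has_integral W (\<gamma> t) * of_real (\<gamma> r $ j - \<gamma> l $ j)) {l..r}"
        by (rule has_integral_mult_right)
      have "?h integrable_on {l..r}"
        using has_integral_integrable[OF int] sub by (rule integrable_on_subinterval)
      then have 2: "(?h has_integral integral {l..r} ?h) {l..r}" by (rule integrable_integral)
      have "norm (W (\<gamma> t) * of_real (\<gamma> r $ j - \<gamma> l $ j) - integral {l..r} ?h) \<le> (\<eta> * M) * measure lborel (cbox l r)"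
      proof (rule has_integral_bound)
        show "0 \<le> \<eta> * M" using \<open>\<eta> > 0\<close> \<open>M \<ge> 0\<close> by simp
        show "((\<lambda>s. W (\<gamma> t) * of_real (\<gamma>' s $ j) - ?h s) has_integral
          (W (\<gamma> t) * of_real (\<gamma> r $ j - \<gamma> l $ j) - integral {l..r} ?h)) (cbox l r)"
          using has_integral_diff[OF 1 2] by simp
        fix s assume s: "s \<in> cbox l r"
        have "dist t s \<le> diameter K" using t s K by (intro diameter_bounded_bound) auto
        also have "\<dots> < \<delta>" using fine tK by auto
        finally have "dist (W (\<gamma> t)) (W (\<gamma> s)) < \<eta>" using sub t s K by (intro \<delta>(2)) auto
        then have "norm (W (\<gamma> t) - W (\<gamma> s)) \<le> \<eta>" by (simp add: dist_norm)
        moreover have "\<bar>\<gamma>' s $ j\<bar> \<le> M" using component_le_norm_cart[of "\<gamma>' s" j] bound[of s] by linarith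
        ultimately have "norm (W (\<gamma> t) - W (\<gamma> s)) * \<bar>\<gamma>' s $ j\<bar> \<le> \<eta> * M"
          using \<open>\<eta> > 0\<close> by (intro mult_mono) auto
        moreover have "W (\<gamma> t) * of_real (\<gamma>' s $ j) - ?h s = (W (\<gamma> t) - W (\<gamma> s)) * of_real (\<gamma>' s $ j)"
          by (simp add: algebra_simps)
        ultimately show "norm (W (\<gamma> t) * of_real (\<gamma>' s $ j) - ?h s) \<le> \<eta> * M"
          by (simp add: norm_mult)
      qed
      then show ?thesis using lr by (simp add: K)
    qed
    have "(\<Sum>(t, K)\<in>P. W (\<gamma> t) * of_real (\<gamma> (Sup K) $ j - \<gamma> (Inf K) $ j)) - c
        = (\<Sum>(t, K)\<in>P. W (\<gamma> t) * of_real (\<gamma> (Sup K) $ j - \<gamma> (Inf K) $ j) - integral K ?h)"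
      by (simp add: c sum_subtractf split_def)
    also have "norm \<dots> \<le> (\<Sum>(t, K)\<in>P. \<eta> * M * measure lborel K)"
      unfolding split_def by (rule sum_norm_le) (use piece in auto)
    also have "\<dots> = \<eta> * M * (\<Sum>(t, K)\<in>P. measure lborel K)" by (simp add: sum_distrib_left split_def)
    also have "\<dots> = \<eta> * M"
      using additive_content_tagged_division[of P 0 1] P by simp
    also have "\<dots> < \<epsilon>" by fact
    finally show ?thesis .
  qed
  then show "\<exists>\<delta>>0. \<forall>P. P tagged_division_of {0..1} \<and> (\<forall>(t, K)\<in>P. diameter K < \<delta>) \<longrightarrow>
      norm ((\<Sum>(t, K)\<in>P. W (\<gamma> t) * of_real (\<gamma> (Sup K) $ j - \<gamma> (Inf K) $ j)) - c) < \<epsilon>"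
    using \<delta>(1) by blast
qed

definition segment_mean :: "(real^3 \<Rightarrow> complex) \<Rightarrow> real^3 \<Rightarrow> real^3 \<Rightarrow> complex" where
  "segment_mean u p q = integral {0..1} (\<lambda>t. u (linepath p q t))"

definition segment_integral ::
  "complex \<Rightarrow> complex \<Rightarrow> (real^3 \<Rightarrow> complex) \<Rightarrow> real^3 \<Rightarrow> real^3 \<Rightarrow> complex" where
  "segment_integral a b u p q = xi a b (q - p) * segment_mean u p q"

lemma continuous_on_linepath_comp:
  assumes "continuous_on (closed_segment p q) u"
  shows "continuous_on {0..1} (\<lambda>t. u (linepath p q t))"
  by (rule continuous_on_compose2[OF assms])
    (auto intro: continuous_on_linepath linepath_in_path)

lemma has_integral_segment_mean:
  fixes p q :: "real^3" and u :: "real^3 \<Rightarrow> complex"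
  assumes "continuous_on (closed_segment p q) u"
  shows "((\<lambda>t. u (linepath p q t)) has_integral segment_mean u p q) {0..1}"
  unfolding segment_mean_def
  by (intro integrable_integral integrable_continuous_interval continuous_on_linepath_comp assms)

text \<open>The velocity of a joined path, with the factor \<open>2\<close> coming from the reparametrisation of each half.\<close>

definition join_speed :: "(real \<Rightarrow> real^3) \<Rightarrow> (real \<Rightarrow> real^3) \<Rightarrow> real \<Rightarrow> real^3" where
  "join_speed v w t = (if t \<le> 1/2 then 2 *\<^sub>R v (2 * t) else 2 *\<^sub>R w (2 * t - 1))"

lemma has_integral_join:
  fixes u :: "real^3 \<Rightarrow> complex" and l :: "real^3 \<Rightarrow> complex"
  assumes l: "linear l"
    and 1: "((\<lambda>t. u (g t) * l (v t)) has_integral A) {0..1}"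
    and 2: "((\<lambda>t. u (h t) * l (w t)) has_integral B) {0..1}"
    and gh: "g 1 = h 0"
  shows "((\<lambda>t. u ((g +++ h) t) * l (join_speed v w t)) has_integral (A + B)) {0..1}"
proof (rule has_integral_combine[where c = "1/2"])
  have i1: "((\<lambda>t. 2 * (u (g (2 * t)) * l (v (2 * t)))) has_integral A) {0..1/2}"
    and i2: "((\<lambda>t. 2 * (u (h (2 * t - 1)) * l (w (2 * t - 1)))) has_integral B) {1/2..1}"
    using has_integral_affinity01 [OF 1, where m= 2 and c=0, THEN has_integral_cmul [where c=2]]
          has_integral_affinity01 [OF 2, where m= 2 and c="-1", THEN has_integral_cmul [where c=2]]
    by (simp_all only: image_affinity_atLeastAtMost_div_diff, simp_all add: scaleR_conv_of_real mult_ac)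
  have l2: "l (2 *\<^sub>R x) = 2 * l x" for x
    using linear_scale[OF l, of 2 x] by (simp add: scaleR_conv_of_real)
  show "((\<lambda>t. u ((g +++ h) t) * l (join_speed v w t)) has_integral A) {0..1/2}"
    by (rule has_integral_eq[OF _ i1]) (simp add: joinpaths_def join_speed_def l2)
  show "((\<lambda>t. u ((g +++ h) t) * l (join_speed v w t)) has_integral B) {1/2..1}"
    by (rule has_integral_spike_finite[OF _ _ i2, of "{1/2}"]) (auto simp: joinpaths_def join_speed_def l2)
qed auto

definition triangle_speed :: "real^3 \<Rightarrow> real^3 \<Rightarrow> real^3 \<Rightarrow> real \<Rightarrow> real^3" where
  "triangle_speed p q r = join_speed (\<lambda>_. q - p) (join_speed (\<lambda>_. r - q) (\<lambda>_. p - r))"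

lemma join_has_vector_derivative:
  assumes "t \<noteq> 1/2"
    and "t < 1/2 \<Longrightarrow> (g has_vector_derivative v (2 * t)) (at (2 * t))"
    and "t > 1/2 \<Longrightarrow> (h has_vector_derivative w (2 * t - 1)) (at (2 * t - 1))"
  shows "((g +++ h) has_vector_derivative join_speed v w t) (at t)"
proof (cases "t < 1/2")
  case True
  have "((\<lambda>s. 2 * s) has_vector_derivative 2) (at t)"
    by (auto intro!: derivative_eq_intros simp: has_vector_derivative_def)
  from vector_diff_chain_at[OF this assms(2)[OF True]]
  have "(g \<circ> (\<lambda>s. 2 * s) has_vector_derivative 2 *\<^sub>R v (2 * t)) (at t)" .
  then have "((g +++ h) has_vector_derivative 2 *\<^sub>R v (2 * t)) (at t)"
    by (rule has_vector_derivative_transform_within_open[of _ _ _ "{..<1/2}"])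
      (use True in \<open>auto simp: joinpaths_def\<close>)
  then show ?thesis using True by (simp add: join_speed_def)
next
  case False
  then have t: "t > 1/2" using assms(1) by simp
  have "((\<lambda>s. 2 * s - 1) has_vector_derivative 2) (at t)"
    by (auto intro!: derivative_eq_intros simp: has_vector_derivative_def)
  from vector_diff_chain_at[OF this assms(3)[OF t]]
  have "(h \<circ> (\<lambda>s. 2 * s - 1) has_vector_derivative 2 *\<^sub>R w (2 * t - 1)) (at t)" .
  then have "((g +++ h) has_vector_derivative 2 *\<^sub>R w (2 * t - 1)) (at t)"
    by (rule has_vector_derivative_transform_within_open[of _ _ _ "{1/2<..}"])
      (use t in \<open>auto simp: joinpaths_def\<close>)
  then show ?thesis using t by (simp add: join_speed_def)
qed

lemma triangle_has_vector_derivative: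
  assumes "t \<noteq> 1/2" "t \<noteq> 3/4"
  shows "(triangle_boundary p q r has_vector_derivative triangle_speed p q r t) (at t)"
  unfolding triangle_boundary_def triangle_speed_def
proof (rule join_has_vector_derivative[OF assms(1)])
  show "(linepath p q has_vector_derivative q - p) (at (2 * t))"
    by (rule has_vector_derivative_linepath_within)
  show "((linepath q r +++ linepath r p) has_vector_derivative
      join_speed (\<lambda>_. r - q) (\<lambda>_. p - r) (2 * t - 1)) (at (2 * t - 1))"
    by (rule join_has_vector_derivative) (use assms in \<open>auto intro: has_vector_derivative_linepath_within\<close>)
qed

lemma has_line_integral_triangle:
  fixes u :: "real^3 \<Rightarrow> complex"
  assumes u: "continuous_on (convex hull {p, q, r}) u"
  shows "has_line_integral j (triangle_boundary p q r) u
     (of_real ((q - p) $ j) * segment_mean u p q + (of_real ((r - q) $ j) * segment_mean u q r +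
      of_real ((p - r) $ j) * segment_mean u r p))"
proof (rule has_line_integral_derivative)
  have seg: "closed_segment p q \<subseteq> convex hull {p, q, r}" "closed_segment q r \<subseteq> convex hull {p, q, r}"
    "closed_segment r p \<subseteq> convex hull {p, q, r}"
    by (auto simp: segment_convex_hull intro!: hull_mono)
  show cont: "continuous_on {0..1} (triangle_boundary p q r)"
    unfolding triangle_boundary_def path_def[symmetric]
    by (intro path_join_imp path_linepath) simp_all
  have img: "triangle_boundary p q r ` {0..1} \<subseteq> convex hull {p, q, r}"
  proof -
    have "path_image (triangle_boundary p q r) \<subseteq> convex hull {p, q, r}"
      unfolding triangle_boundary_def using seg by (simp add: path_image_join)
    then show ?thesis by (simp add: path_image_def)
  qed
  show "continuous_on {0..1} (\<lambda>t. u (triangle_boundary p q r t))"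
    by (rule continuous_on_compose2[OF u cont img])
  show "finite {1/2, 3/4 :: real}" by simp
  show "(triangle_boundary p q r has_vector_derivative triangle_speed p q r t) (at t)"
    if "t \<in> {0..1} - {1/2, 3/4}" for t
    using that by (intro triangle_has_vector_derivative) auto
  show "norm (triangle_speed p q r t) \<le> 4 * (norm (q - p) + norm (r - q) + norm (p - r))" for t
    using norm_ge_zero[of "q - p"] norm_ge_zero[of "r - q"] norm_ge_zero[of "p - r"]
    by (simp add: triangle_speed_def join_speed_def del: norm_ge_zero)
  have lin: "linear (\<lambda>v :: real^3. complex_of_real (v $ j))"
    by (rule linearI) (simp_all add: scaleR_conv_of_real[where 'a = complex])
  have side: "((\<lambda>t. u (linepath x y t) * complex_of_real ((y - x) $ j)) has_integral
      of_real ((y - x) $ j) * segment_mean u x y) {0..1}"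
    if "closed_segment x y \<subseteq> convex hull {p, q, r}" for x y
    using has_integral_mult_left[OF has_integral_segment_mean[OF continuous_on_subset[OF u that]],
        of "complex_of_real ((y - x) $ j)"] by (simp only: mult.commute)
  show "((\<lambda>t. u (triangle_boundary p q r t) * complex_of_real (triangle_speed p q r t $ j)) has_integral
     of_real ((q - p) $ j) * segment_mean u p q + (of_real ((r - q) $ j) * segment_mean u q r +
      of_real ((p - r) $ j) * segment_mean u r p)) {0..1}"
    unfolding triangle_boundary_def triangle_speed_def
    by (intro has_integral_join[OF lin] side seg) (simp_all add: linepath_def joinpaths_def)
qed

lemma triangle_line_integrals:
  assumes "continuous_on (convex hull {p, q, r}) u"
  shows "line_integral 1 (triangle_boundary p q r) u + a * line_integral 2 (triangle_boundary p q r) u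
       + b * line_integral 3 (triangle_boundary p q r) u
     = segment_integral a b u p q + segment_integral a b u q r + segment_integral a b u r p"
  unfolding has_line_integral_triangle[OF assms, THEN line_integral_eqI] segment_integral_def xi_def
  by (simp add: algebra_simps)

lemma segment_integral_reverse:
  "segment_integral a b u q p = - segment_integral a b u p q"
proof -
  have "integral {- 1 .. - 0} (\<lambda>t. (\<lambda>s. u (linepath q p (s + 1))) t) = integral {0..1} (\<lambda>t. u (linepath q p (- t + 1)))"
    using Henstock_Kurzweil_Integration.integral_reflect_real[of 1 0 "\<lambda>t. u (linepath q p (- t + 1))"]
    by (simp only: minus_minus)
  moreover have "integral {- 1 .. - 0} (\<lambda>t. u (linepath q p (t + 1))) = integral {0..1} (\<lambda>t. u (linepath q p t))"
    using integral_shift_real_ivl[of 0 1 1 "\<lambda>t. u (linepath q p t)"]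
    by (simp only: minus_zero diff_0 diff_self)
  moreover have "linepath q p (- t + 1) = linepath p q t" for t
    by (simp add: linepath_def algebra_simps)
  ultimately have "segment_mean u q p = segment_mean u p q" by (simp add: segment_mean_def)
  then show ?thesis
    by (simp add: segment_integral_def xi_diff algebra_simps)
qed

lemma contour_integral_linepath_eq:
  "contour_integral (linepath z w) k = (w - z) * integral {0..1} (\<lambda>t. k (linepath z w t))"
  by (simp add: contour_integral_integral mult.commute)

text \<open>Along a fixed segment the integral is a contour integral over \<open>[0, 1]\<close> of the complex function
\<open>z \<mapsto> u (linepath p q (Re z))\<close>, where additivity is known.\<close>

lemma segment_integral_split:
  assumes u: "continuous_on (closed_segment p q) u" and c: "c \<in> closed_segment p q"
  shows "segment_integral a b u p q = segment_integral a b u p c + segment_integral a b u c q"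
proof -
  define k where "k z = u (linepath p q (Re z))" for z
  obtain s where s: "0 \<le> s" "s \<le> 1" "c = linepath p q s"
    using c by (auto simp: closed_segment_def linepath_def)
  have "closed_segment (0::complex) 1 = of_real ` {0..1}"
    by (auto simp: closed_segment_def image_iff scaleR_conv_of_real)
  then have seg: "Re z \<in> {0..1}" if "z \<in> closed_segment 0 1" for z using that by auto
  have "continuous_on (closed_segment 0 1) k"
    unfolding k_def
    by (rule continuous_on_compose2[OF continuous_on_linepath_comp[OF u]]) (use seg in \<open>auto intro!: continuous_intros\<close>)
  moreover have "of_real s \<in> closed_segment (0::complex) 1"
    using s by (auto simp: closed_segment_def scaleR_conv_of_real)
  ultimately have split: "contour_integral (linepath 0 1) k
      = contour_integral (linepath 0 (of_real s)) k + contour_integral (linepath (of_real s) 1) k"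
    by (rule contour_integral_split_linepath)
  have part: "segment_integral a b u (linepath p q x) (linepath p q y)
      = xi a b (q - p) * contour_integral (linepath (of_real x) (of_real y)) k" for x y
  proof -
    have "linepath (linepath p q x) (linepath p q y) t = linepath p q (Re (linepath (of_real x) (of_real y) t))" for t
      by (simp add: linepath_def algebra_simps)
    then have "segment_mean u (linepath p q x) (linepath p q y)
        = integral {0..1} (\<lambda>t. k (linepath (of_real x) (of_real y) t))"
      by (simp add: segment_mean_def k_def)
    moreover have "linepath p q y - linepath p q x = (y - x) *\<^sub>R (q - p)"
      by (simp add: linepath_def algebra_simps)
    ultimately show ?thesis
      by (simp add: segment_integral_def contour_integral_linepath_eq xi_scaleR scaleR_conv_of_real[where 'a = complex])
  qed
  show ?thesis
    using part[of 0 1] part[of 0 s] part[of s 1] split s(3)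
    by (simp add: linepath_0' linepath_1' algebra_simps)
qed

text \<open>Only nondegenerate triangles occur in the integral condition; this supplies the degenerate ones when
a primitive is built.\<close>

lemma segment_integral_collinear:
  assumes u: "continuous_on (convex hull {p, q, r}) u" and col: "collinear {p, q, r}"
  shows "segment_integral a b u p q + segment_integral a b u q r + segment_integral a b u r p = 0"
proof -
  have sub: "closed_segment x y \<subseteq> convex hull {p, q, r}" if "x \<in> {p, q, r}" "y \<in> {p, q, r}" for x y
    using that unfolding segment_convex_hull by (intro hull_mono) auto
  have cont: "continuous_on (closed_segment x y) u" if "x \<in> {p, q, r}" "y \<in> {p, q, r}" for x y
    using continuous_on_subset[OF u sub[OF that]] .
  have "between (q, r) p \<or> between (r, p) q \<or> between (p, q) r"
    using col by (simp add: collinear_between_cases)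
  then consider "p \<in> closed_segment q r" | "q \<in> closed_segment r p" | "r \<in> closed_segment p q"
    by (auto simp: between_mem_segment)
  then show ?thesis
  proof cases
    case 1
    from segment_integral_split[OF cont 1] show ?thesis
      by (simp add: segment_integral_reverse[of a b u p q] segment_integral_reverse[of a b u r p])
  next
    case 2
    from segment_integral_split[OF cont 2] show ?thesis
      by (simp add: segment_integral_reverse[of a b u r q] segment_integral_reverse[of a b u p q])
  next
    case 3
    from segment_integral_split[OF cont 3] show ?thesis
      by (simp add: segment_integral_reverse[of a b u r p] segment_integral_reverse[of a b u q r])
  qed
qed

section \<open>The theorems of Goursat and Morera for a linear form\<close>

lemma segment_mean_approx:
  fixes u :: "real^3 \<Rightarrow> complex"
  assumes u: "continuous_on (closed_segment p q) u"
    and e: "\<And>x. x \<in> closed_segment p q \<Longrightarrow> norm (u x - c) \<le> e"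
  shows "norm (segment_mean u p q - c) \<le> e"
proof -
  have "((\<lambda>t::real. c) has_integral c) {0..1}"
    using has_integral_const_real[of c 0 1] by simp
  from has_integral_diff[OF has_integral_segment_mean[OF u] this]
  have "norm (segment_mean u p q - c) \<le> e * measure lborel (cbox 0 (1::real))"
  proof (intro has_integral_bound)
    have "norm (u p - c) \<le> e" by (rule e) simp
    then show "0 \<le> e" using norm_ge_zero order_trans by blast
    show "((\<lambda>t. u (linepath p q t) - c) has_integral segment_mean u p q - c) (cbox 0 1)"
      if "((\<lambda>t. u (linepath p q t) - c) has_integral segment_mean u p q - c) {0..1}"
      using that by simp
    show "norm (u (linepath p q t) - c) \<le> e" if "t \<in> cbox 0 1" for t
      using that by (intro e linepath_in_path) simp
  qed
  then show ?thesis by simp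
qed

lemma segment_integral_has_derivative:
  fixes u :: "real^3 \<Rightarrow> complex"
  assumes B: "open B" "convex B" "p0 \<in> B" and u: "continuous_on B u"
    and tri: "\<And>x y. x \<in> B \<Longrightarrow> y \<in> B \<Longrightarrow>
      segment_integral a b u p0 x + segment_integral a b u x y + segment_integral a b u y p0 = 0"
    and p: "p \<in> B"
  shows "(segment_integral a b u p0 has_derivative (\<lambda>v. xi a b v * u p)) (at p)"
  unfolding has_derivative_at_alt
proof (intro conjI allI impI)
  show "bounded_linear (\<lambda>v. xi a b v * u p)"
    by (rule bounded_linear_compose[OF bounded_linear_mult_left bounded_linear_xi])
  fix e :: real assume "e > 0"
  obtain K where K: "K > 0" "\<And>v. norm (xi a b v) \<le> norm v * K"
    using bounded_linear.pos_bounded[OF bounded_linear_xi] by blast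
  have "e / K > 0" using \<open>e > 0\<close> K by simp
  moreover have "isCont u p" using u B(1) p by (simp add: continuous_on_eq_continuous_at)
  ultimately obtain \<delta>1 where \<delta>1: "\<delta>1 > 0" "\<And>x. dist x p < \<delta>1 \<Longrightarrow> dist (u x) (u p) < e / K"
    unfolding continuous_at_eps_delta by blast
  obtain \<delta>2 where \<delta>2: "\<delta>2 > 0" "ball p \<delta>2 \<subseteq> B" using B(1) p by (meson openE)
  define \<delta> where "\<delta> = min \<delta>1 \<delta>2"
  have "norm (segment_integral a b u p0 y - segment_integral a b u p0 p - xi a b (y - p) * u p) \<le> e * norm (y - p)"
    if y: "norm (y - p) < \<delta>" for y
  proof -
    have yB: "y \<in> B" using y \<delta>2 by (auto simp: \<delta>_def dist_norm norm_minus_commute)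
    have seg: "closed_segment p y \<subseteq> B" using B(2) p yB by (simp add: closed_segment_subset)
    have "norm (segment_mean u p y - u p) \<le> e / K"
    proof (rule segment_mean_approx)
      show "continuous_on (closed_segment p y) u" using u seg by (rule continuous_on_subset)
      fix x assume "x \<in> closed_segment p y"
      then have "norm (x - p) \<le> norm (y - p)" by (rule segment_bound(1))
      then have "dist x p < \<delta>1" using y by (simp add: \<delta>_def dist_norm)
      from \<delta>1(2)[OF this] show "norm (u x - u p) \<le> e / K" by (simp add: dist_norm)
    qed
    then have "norm (xi a b (y - p)) * norm (segment_mean u p y - u p) \<le> (norm (y - p) * K) * (e / K)"
      using K by (intro mult_mono) auto
    also have "\<dots> = e * norm (y - p)" using K(1) by simp
    finally have "norm (xi a b (y - p) * (segment_mean u p y - u p)) \<le> e * norm (y - p)"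
      by (simp only: norm_mult)
    moreover have "segment_integral a b u p0 y - segment_integral a b u p0 p = segment_integral a b u p y"
      using tri[OF p yB] segment_integral_reverse[of a b u y p0] by (simp add: algebra_simps)
    then have "segment_integral a b u p0 y - segment_integral a b u p0 p - xi a b (y - p) * u p
        = xi a b (y - p) * (segment_mean u p y - u p)"
      by (simp only: segment_integral_def right_diff_distrib)
    ultimately show ?thesis by simp
  qed
  moreover have "\<delta> > 0" using \<delta>1 \<delta>2 by (simp add: \<delta>_def)
  ultimately show "\<exists>d>0. \<forall>y. norm (y - p) < d \<longrightarrow> norm (segment_integral a b u p0 y -
      segment_integral a b u p0 p - xi a b (y - p) * u p) \<le> e * norm (y - p)" by blast
qed

text \<open>A convex neighbourhood of the triangle inside \<open>\<Omega>\<close> gives one holomorphic \<open>g\<close> with \<open>u = g \<circ> xi a b\<close> there,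
even when \<open>xi a b\<close> collapses the triangle to a segment. The integral becomes that of \<open>g\<close> over the image
triangle.\<close>

lemma xi_monogenic_imp_triangle_integral_0:
  assumes mono: "xi_monogenic a b \<Omega> u" and \<Omega>: "open \<Omega>" and surj: "surj (xi a b)"
    and T: "convex hull {p, q, r} \<subseteq> \<Omega>"
  shows "segment_integral a b u p q + segment_integral a b u q r + segment_integral a b u r p = 0"
proof -
  let ?T = "convex hull {p, q, r}"
  have "compact ?T" by (simp add: finite_imp_compact_convex_hull)
  then obtain e where e: "e > 0" "(\<Union>x\<in>?T. ball x e) \<subseteq> \<Omega>"
    using compact_subset_open_imp_ball_epsilon_subset \<Omega> T by blast
  define N where "N = (\<Union>x\<in>?T. ball x e)"
  have N_sum: "N = (\<Union>x\<in>?T. \<Union>y\<in>ball 0 e. {x + y})"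
  proof -
    have "ball x e = (\<Union>y\<in>ball 0 e. {x + y})" for x :: "real^3"
    proof safe
      fix z assume "z \<in> ball x e"
      then have "z - x \<in> ball 0 e" "z = x + (z - x)" by (simp_all add: dist_norm norm_minus_commute)
      then show "z \<in> (\<Union>y\<in>ball 0 e. {x + y})" by blast
    qed (simp add: dist_norm)
    then show ?thesis unfolding N_def by (rule SUP_cong[OF refl])
  qed
  have "convex N" unfolding N_sum by (intro convex_sums convex_convex_hull convex_ball)
  have "open N" unfolding N_def by blast
  have TN: "?T \<subseteq> N" unfolding N_def using e(1) by force
  obtain g where g: "g holomorphic_on xi a b ` N" "\<And>x. x \<in> N \<Longrightarrow> u x = g (xi a b x)"
    using xi_monogenic_imp_holomorphic_factor[OF xi_monogenic_subset[OF mono e(2)[folded N_def]] \<open>open N\<close> surj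
        convex_imp_convex_in_direction[OF \<open>convex N\<close>]] by blast
  have "convex hull {xi a b p, xi a b q, xi a b r} = xi a b ` ?T"
    using convex_hull_linear_image[OF linear_xi, of a b "{p, q, r}"] by simp
  then have "g holomorphic_on convex hull {xi a b p, xi a b q, xi a b r}"
    using g(1) TN by (auto intro: holomorphic_on_subset)
  from has_chain_integral_chain_integral3[OF Cauchy_theorem_triangle[OF this]]
  have "contour_integral (linepath (xi a b p) (xi a b q)) g + contour_integral (linepath (xi a b q) (xi a b r)) g +
    contour_integral (linepath (xi a b r) (xi a b p)) g = 0" .
  moreover have "contour_integral (linepath (xi a b x) (xi a b y)) g = segment_integral a b u x y"
    if "x \<in> {p, q, r}" "y \<in> {p, q, r}" for x y
  proof -
    have "closed_segment x y \<subseteq> N"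
    proof -
      have "closed_segment x y \<subseteq> ?T"
        using that unfolding segment_convex_hull by (intro hull_mono) auto
      then show ?thesis using TN by (rule order_trans)
    qed
    then have "u (linepath x y t) = g (linepath (xi a b x) (xi a b y) t)" if "t \<in> {0..1}" for t
      using g(2)[of "linepath x y t"] linepath_in_path[of t x y] that
      by (auto simp: linepath_def xi_add xi_scaleR)
    then have "segment_mean u x y = integral {0..1} (\<lambda>t. g (linepath (xi a b x) (xi a b y) t))"
      unfolding segment_mean_def by (intro integral_cong) auto
    then show ?thesis by (simp add: contour_integral_linepath_eq segment_integral_def xi_diff)
  qed
  ultimately show ?thesis by simp
qed

text \<open>For the converse, \<open>F p\<close>, the integral of \<open>u\<close> against \<open>xi a b\<close> from \<open>p0\<close> to \<open>p\<close>, has derivative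
\<open>v \<mapsto> xi a b v * u p\<close>, so \<open>F\<close> is locally a holomorphic function \<open>g\<close> of \<open>xi a b\<close>. Comparing derivatives
gives \<open>u = g' \<circ> xi a b\<close>.\<close>

lemma xi_monogenic_iff_triangles:
  assumes \<Omega>: "open \<Omega>" and surj: "surj (xi a b)"
  shows "xi_monogenic a b \<Omega> u \<longleftrightarrow> continuous_on \<Omega> u \<and>
    (\<forall>p q r. \<not> collinear {p, q, r} \<and> convex hull {p, q, r} \<subseteq> \<Omega> \<longrightarrow>
       line_integral 1 (triangle_boundary p q r) u + a * line_integral 2 (triangle_boundary p q r) u
       + b * line_integral 3 (triangle_boundary p q r) u = 0)" (is "_ \<longleftrightarrow> _ \<and> ?T")
proof
  assume L: "xi_monogenic a b \<Omega> u"
  then have cont: "continuous_on \<Omega> u" by (simp add: xi_monogenic_def)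
  moreover have ?T
  proof (intro allI impI, elim conjE)
    fix p q r assume T: "convex hull {p, q, r} \<subseteq> \<Omega>"
    show "line_integral 1 (triangle_boundary p q r) u + a * line_integral 2 (triangle_boundary p q r) u
       + b * line_integral 3 (triangle_boundary p q r) u = 0"
      unfolding triangle_line_integrals[OF continuous_on_subset[OF cont T]]
      by (rule xi_monogenic_imp_triangle_integral_0[OF L \<Omega> surj T])
  qed
  ultimately show "continuous_on \<Omega> u \<and> ?T" ..
next
  assume "continuous_on \<Omega> u \<and> ?T"
  then have cont: "continuous_on \<Omega> u" and T: ?T by blast+
  show "xi_monogenic a b \<Omega> u"
  proof (rule has_derivative_imp_xi_monogenic)
    fix p0 assume "p0 \<in> \<Omega>"
    then obtain s where s: "s > 0" "ball p0 s \<subseteq> \<Omega>" using \<Omega> by (meson openE)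
    define B where "B = ball p0 s"
    have B: "open B" "convex B" "p0 \<in> B" "B \<subseteq> \<Omega>" using s by (auto simp: B_def)
    have contB: "continuous_on B u" using cont B(4) by (rule continuous_on_subset)
    have tri: "segment_integral a b u p0 x + segment_integral a b u x y + segment_integral a b u y p0 = 0"
      if "x \<in> B" "y \<in> B" for x y
    proof -
      have hull: "convex hull {p0, x, y} \<subseteq> B" using B that by (intro hull_minimal) auto
      then have c: "continuous_on (convex hull {p0, x, y}) u" using contB continuous_on_subset by blast
      show ?thesis
      proof (cases "collinear {p0, x, y}")
        case True
        then show ?thesis by (rule segment_integral_collinear[OF c])
      next
        case False
        then show ?thesis using T hull B(4) triangle_line_integrals[OF c, of a b] by auto
      qed
    qed
    define F where "F = segment_integral a b u p0"
    have F': "(F has_derivative (\<lambda>v. xi a b v * u p)) (at p)" if "p \<in> B" for p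
      unfolding F_def by (rule segment_integral_has_derivative[OF B(1-3) contB tri that])
    then have "xi_monogenic a b B F" by (intro has_derivative_imp_xi_monogenic) blast
    then obtain g where g: "g holomorphic_on xi a b ` B" "\<And>p. p \<in> B \<Longrightarrow> F p = g (xi a b p)"
      using xi_monogenic_imp_holomorphic_factor B(1) surj convex_imp_convex_in_direction[OF B(2)] by blast
    have opn: "open (xi a b ` B)" by (rule open_surjective_linear_image[OF B(1) linear_xi surj])
    have "u p = deriv g (xi a b p)" if p: "p \<in> B" for p
    proof -
      have "(F has_derivative (\<lambda>v. xi a b v * deriv g (xi a b p))) (at p)"
        by (rule holomorphic_factor_imp_has_derivative[OF B(1) opn order_refl g p])
      with F'[OF p] have "(\<lambda>v. xi a b v * u p) = (\<lambda>v. xi a b v * deriv g (xi a b p))"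
        by (rule has_derivative_unique)
      from fun_cong[OF this, of "axis 1 1"] show ?thesis by simp
    qed
    moreover have "deriv g holomorphic_on xi a b ` B" using g(1) opn by (rule holomorphic_deriv)
    ultimately show "\<exists>d. (u has_derivative (\<lambda>v. xi a b v * d)) (at p0)"
      using holomorphic_factor_imp_has_derivative[OF B(1) opn order_refl, of "deriv g" u p0] B(3) by blast
  qed
qed

section \<open>Coordinates in the basis of idempotents and nilpotents\<close>

lemma bounded_linear_cq: "bounded_linear cq1" "bounded_linear cqI" "bounded_linear cqJ" "bounded_linear cqK"
proof -
  have tup: "norm w \<le> norm (w, x, y, z)" "norm x \<le> norm (w, x, y, z)"
    "norm y \<le> norm (w, x, y, z)" "norm z \<le> norm (w, x, y, z)" for w x y z :: complex
    using norm_fst_le[of w "(x, y, z)"] norm_snd_le[of "(x, y, z)" w] norm_fst_le[of x "(y, z)"]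
      norm_snd_le[of "(y, z)" x] norm_fst_le[of y z] norm_snd_le[of z y] by linarith+
  show "bounded_linear cq1" "bounded_linear cqI" "bounded_linear cqJ" "bounded_linear cqK"
    by (rule bounded_linear_intro[where K = 1];
        simp add: plus_cquat_def scaleR_cquat_def norm_cquat_def tup)+
qed

lemma bounded_linear_ecoord: "bounded_linear (\<lambda>q. ecoord q k)"
proof -
  note bl = bounded_linear_cq bounded_linear_compose[OF bounded_linear_mult_right bounded_linear_cq(2)]
    bounded_linear_compose[OF bounded_linear_mult_right bounded_linear_cq(3)]
  have "bounded_linear (\<lambda>q. ecoord q 1)" "bounded_linear (\<lambda>q. ecoord q 2)"
    "bounded_linear (\<lambda>q. ecoord q 3)" "bounded_linear (\<lambda>q. ecoord q 4)"
    unfolding ecoord_explicit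
    by (intro bounded_linear_sub bounded_linear_add bounded_linear_minus bl)+
  then show ?thesis using exhaust_4[of k] by auto
qed

lemmas linear_ecoord = bounded_linear.linear[OF bounded_linear_ecoord]
lemmas ecoord_linear [simp] =
  linear_0[OF linear_ecoord] linear_add[OF linear_ecoord] linear_diff[OF linear_ecoord]
  linear_scale[OF linear_ecoord] linear_sum[OF linear_ecoord]

lemma ecoord_basis_sum [simp]: "ecoord (\<Sum>k\<in>UNIV. u k *\<^sub>C ebas k) = u"
  using ecoord_iff by blast

lemma sum_ecoord: "(\<Sum>k\<in>UNIV. ecoord q k *\<^sub>C ebas k) = q"
  using ecoord_iff[of q "ecoord q"] by simp

lemma cquat_eq_ecoord: "p = q \<longleftrightarrow> (\<forall>k. ecoord p k = ecoord q k)"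
  by (metis sum_ecoord ext)

lemma bounded_linear_scaleC: "bounded_linear (\<lambda>c. c *\<^sub>C q)"
proof -
  have "(\<lambda>c. c *\<^sub>C q) = (\<lambda>c. Re c *\<^sub>R q + Im c *\<^sub>R (\<i> *\<^sub>C q))"
    by (simp add: fun_eq_iff cquat_eq_iff scaleC_def scaleR_cquat_def plus_cquat_def complex_eq_iff)
  then show ?thesis
    by (simp add: bounded_linear_add bounded_linear_compose[OF bounded_linear_scaleR_left]
        bounded_linear_Re bounded_linear_Im)
qed

lemma tendsto_ecoord_iff:
  "(f \<longlongrightarrow> l) F \<longleftrightarrow> (\<forall>k. ((\<lambda>x. ecoord (f x) k) \<longlongrightarrow> ecoord l k) F)"
proof
  assume "(f \<longlongrightarrow> l) F"
  then show "\<forall>k. ((\<lambda>x. ecoord (f x) k) \<longlongrightarrow> ecoord l k) F"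
    using bounded_linear.tendsto[OF bounded_linear_ecoord] by blast
next
  assume "\<forall>k. ((\<lambda>x. ecoord (f x) k) \<longlongrightarrow> ecoord l k) F"
  then have "((\<lambda>x. \<Sum>k\<in>UNIV. ecoord (f x) k *\<^sub>C ebas k) \<longlongrightarrow> (\<Sum>k\<in>UNIV. ecoord l k *\<^sub>C ebas k)) F"
    by (intro tendsto_sum bounded_linear.tendsto[OF bounded_linear_scaleC]) blast
  then show "(f \<longlongrightarrow> l) F" by (simp add: sum_ecoord)
qed

lemma continuous_on_ecoord_iff:
  "continuous_on S f \<longleftrightarrow> (\<forall>k. continuous_on S (\<lambda>x. ecoord (f x) k))"
  unfolding continuous_on_def by (subst tendsto_ecoord_iff) blast

lemma sums_ecoord_iff: "f sums s \<longleftrightarrow> (\<forall>k. (\<lambda>n. ecoord (f n) k) sums ecoord s k)"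
  unfolding sums_def by (subst tendsto_ecoord_iff) simp

lemma linear_zeta: "linear (zeta i2 i3)"
  by (rule linearI) (simp_all add: zeta_def algebra_simps)

lemmas zeta_simps = linear_add[OF linear_zeta] linear_diff[OF linear_zeta] linear_scale[OF linear_zeta]

lemma zeta_axis: "zeta i2 i3 (axis 2 1) = i2" "zeta i2 i3 (axis 3 1) = i3"
  by (simp_all add: zeta_def axis_def)

lemma independent_imp_inj_zeta:
  assumes "distinct [1, i2, i3]" "independent {1, i2, i3}"
  shows "inj (zeta i2 i3)"
proof -
  have "v = 0" if z: "zeta i2 i3 v = 0" for v
  proof -
    define w where "w x = (if x = 1 then v $ 1 else if x = i2 then v $ 2 else v $ 3)" for x
    have "(\<Sum>x\<in>{1, i2, i3}. w x *\<^sub>R x) = 0"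
      using z assms(1) by (auto simp: w_def zeta_def add_ac)
    then have "\<forall>x\<in>{1, i2, i3}. w x = 0"
      using assms(2) by (subst (asm) independent_explicit_finite_subsets) blast
    then show ?thesis using assms(1) by (auto simp: w_def vec_eq_iff forall_3 split: if_splits)
  qed
  then show ?thesis using linear_injective_0[OF linear_zeta] by blast
qed

text \<open>The coordinates map \<open>zeta\<close> to an injective linear map between Euclidean spaces, which has a linear and
hence continuous left inverse. So \<open>zeta\<close> is a homeomorphism onto \<open>E\<^sub>3\<close>, and topological statements
about \<open>\<Omega>\<^sub>\<zeta>\<close> may be read in \<open>\<Omega>\<close>.\<close>

lemma zeta_left_inverse:
  assumes "inj (zeta i2 i3)"
  obtains w where "continuous_on UNIV w" "\<And>v. w (zeta i2 i3 v) = v"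
proof -
  define c where "c q = (\<chi> k. ecoord q k)" for q
  have c: "bounded_linear c"
  proof -
    have "\<exists>K. \<forall>q. norm (ecoord q k) \<le> norm q * K" for k
      using bounded_linear.bounded[OF bounded_linear_ecoord] .
    then obtain K where K: "\<And>k q. norm (ecoord q k) \<le> norm q * K k" by metis
    have "norm (c q) \<le> norm q * (\<Sum>k\<in>UNIV. K k)" for q
    proof -
      have "norm (c q) \<le> (\<Sum>k\<in>UNIV. norm (ecoord q k))"
        unfolding norm_vec_def c_def by (simp add: L2_set_le_sum)
      also have "\<dots> \<le> (\<Sum>k\<in>UNIV. norm q * K k)" by (rule sum_mono) (rule K)
      finally show ?thesis by (simp add: sum_distrib_left)
    qed
    then show ?thesis by (rule bounded_linear_intro[rotated 2]) (simp_all add: c_def vec_eq_iff)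
  qed
  have "inj c" unfolding inj_def c_def by (metis cquat_eq_ecoord vec_lambda_beta)
  have "linear (c \<circ> zeta i2 i3)" using linear_zeta bounded_linear.linear[OF c] by (rule linear_compose)
  moreover have "inj (c \<circ> zeta i2 i3)" using \<open>inj c\<close> assms by (rule inj_compose)
  ultimately obtain g where g: "linear g" "g \<circ> (c \<circ> zeta i2 i3) = id"
    using linear_injective_left_inverse by blast
  show thesis
  proof (rule that)
    show "continuous_on UNIV (\<lambda>q. g (c q))"
      by (rule linear_continuous_on[OF bounded_linear_compose[OF _ c]]) (use g(1) in \<open>simp add: linear_conv_bounded_linear\<close>)
    show "g (c (zeta i2 i3 v)) = v" for v using fun_cong[OF g(2), of v] by simp
  qed
qed

section \<open>One-sided multiplication and the equivalences\<close>

text \<open>Left and right multiplication by elements of \<open>E\<^sub>3\<close> are both diagonal in the basis \<open>e\<^sub>1, \<dots>, e\<^sub>4\<close>; they differ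
only in which of \<open>\<xi>\<^sub>1, \<xi>\<^sub>2\<close> acts on the third and on the fourth coordinate. The locale keeps
these eigenvalues \<open>xi (a k) (b k)\<close> abstract, so that each equivalence is proved once. Here \<open>mul h q\<close>
stands for \<open>h * q\<close> or \<open>q * h\<close>, and \<open>curve_int\<close> for the matching curvilinear integral; that
\<open>mul h q\<close> is a sum of terms \<open>A h B\<close> makes G-monogenic mappings H-monogenic.\<close>

locale e3_product =
  fixes i2 i3 :: cquat and a b :: "4 \<Rightarrow> complex"
    and mul :: "cquat \<Rightarrow> cquat \<Rightarrow> cquat"
    and curve_int :: "(real \<Rightarrow> real^3) \<Rightarrow> (cquat \<Rightarrow> cquat) \<Rightarrow> cquat"
  assumes inj: "inj (zeta i2 i3)"
    and ecoord_power: "\<And>v n q k. ecoord (mul (zeta i2 i3 v ^ n) q) k = xi (a k) (b k) v ^ n * ecoord q k"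
    and mul_sum: "\<And>q. \<exists>A B. \<forall>h. mul h q = (\<Sum>s=1..16::nat. A s * h * B s)"
    and ecoord_curve_int: "\<And>\<gamma> \<Psi> k. ecoord (curve_int \<gamma> \<Psi>) k = line_integral 1 \<gamma> (Ucomp i2 i3 \<Psi> k) +
      a k * line_integral 2 \<gamma> (Ucomp i2 i3 \<Psi> k) + b k * line_integral 3 \<gamma> (Ucomp i2 i3 \<Psi> k)"
begin

lemma ecoord_mul: "ecoord (mul (zeta i2 i3 v) q) k = xi (a k) (b k) v * ecoord q k"
  using ecoord_power[of v 1] by simp

lemma continuous_on_zeta_iff:
  "continuous_on (zeta i2 i3 ` \<Omega>) \<Phi> \<longleftrightarrow> (\<forall>k. continuous_on \<Omega> (Ucomp i2 i3 \<Phi> k))"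
proof -
  obtain w where w: "continuous_on UNIV w" "\<And>v. w (zeta i2 i3 v) = v"
    using zeta_left_inverse[OF inj] by blast
  have "continuous_on UNIV (zeta i2 i3)"
    using linear_continuous_on[OF linear_conv_bounded_linear[THEN iffD1, OF linear_zeta]] .
  then have cz: "continuous_on \<Omega> (zeta i2 i3)" by (rule continuous_on_subset) simp
  have "continuous_on (zeta i2 i3 ` \<Omega>) \<Phi> \<longleftrightarrow> continuous_on \<Omega> (\<lambda>p. \<Phi> (zeta i2 i3 p))"
  proof
    assume "continuous_on (zeta i2 i3 ` \<Omega>) \<Phi>"
    then show "continuous_on \<Omega> (\<lambda>p. \<Phi> (zeta i2 i3 p))"
      by (rule continuous_on_compose2[OF _ cz]) simp
  next
    assume "continuous_on \<Omega> (\<lambda>p. \<Phi> (zeta i2 i3 p))"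
    then have "continuous_on (zeta i2 i3 ` \<Omega>) (\<lambda>q. \<Phi> (zeta i2 i3 (w q)))"
      by (rule continuous_on_compose2[OF _ continuous_on_subset[OF w(1)]]) (auto simp: w(2))
    then show "continuous_on (zeta i2 i3 ` \<Omega>) \<Phi>"
      by (rule continuous_on_eq) (auto simp: w(2))
  qed
  then show ?thesis unfolding continuous_on_ecoord_iff[where f = "\<lambda>p. \<Phi> (zeta i2 i3 p)"] Ucomp_def .
qed

definition G_monogenic :: "(real^3) set \<Rightarrow> (cquat \<Rightarrow> cquat) \<Rightarrow> bool" where
  "G_monogenic \<Omega> \<Phi> \<longleftrightarrow> continuous_on (zeta i2 i3 ` \<Omega>) \<Phi> \<and>
     (\<forall>\<zeta>\<in>zeta i2 i3 ` \<Omega>. \<exists>D. \<forall>h\<in>E3 i2 i3.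
        ((\<lambda>\<epsilon>. (\<Phi> (\<zeta> + \<epsilon> *\<^sub>R h) - \<Phi> \<zeta>) /\<^sub>R \<epsilon>) \<longlongrightarrow> mul h D) (at_right 0))"

lemma G_monogenic_iff_components:
  "G_monogenic \<Omega> \<Phi> \<longleftrightarrow> (\<forall>k. xi_monogenic (a k) (b k) \<Omega> (Ucomp i2 i3 \<Phi> k))"
proof -
  have "(\<exists>D. \<forall>h\<in>E3 i2 i3. ((\<lambda>\<epsilon>. (\<Phi> (zeta i2 i3 p + \<epsilon> *\<^sub>R h) - \<Phi> (zeta i2 i3 p)) /\<^sub>R \<epsilon>) \<longlongrightarrow> mul h D) (at_right 0))
    \<longleftrightarrow> (\<forall>k. \<exists>d. gateaux_at (Ucomp i2 i3 \<Phi> k) (\<lambda>v. xi (a k) (b k) v * d) p)" (is "?L \<longleftrightarrow> ?R") for p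
  proof -
    have D: "(\<forall>h\<in>E3 i2 i3. ((\<lambda>\<epsilon>. (\<Phi> (zeta i2 i3 p + \<epsilon> *\<^sub>R h) - \<Phi> (zeta i2 i3 p)) /\<^sub>R \<epsilon>) \<longlongrightarrow> mul h D) (at_right 0))
       \<longleftrightarrow> (\<forall>k. gateaux_at (Ucomp i2 i3 \<Phi> k) (\<lambda>v. xi (a k) (b k) v * ecoord D k) p)" for D
      unfolding E3_def ball_simps gateaux_at_def Ucomp_def zeta_simps
      by (subst tendsto_ecoord_iff) (auto simp: ecoord_mul)
    show ?thesis
    proof
      show "?L \<Longrightarrow> ?R" unfolding D by blast
      assume ?R
      then obtain d where "\<forall>k. gateaux_at (Ucomp i2 i3 \<Phi> k) (\<lambda>v. xi (a k) (b k) v * d k) p" by metis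
      then show ?L unfolding D by (intro exI[of _ "\<Sum>k\<in>UNIV. d k *\<^sub>C ebas k"]) (simp only: ecoord_basis_sum simp_thms)
    qed
  qed
  then show ?thesis
    unfolding G_monogenic_def xi_monogenic_def continuous_on_zeta_iff by blast
qed

lemma ecoord_partial_map: "ecoord (partial_map i2 i3 j \<Phi> p) k = partial_deriv j (Ucomp i2 i3 \<Phi> k) p"
  unfolding partial_map_def by (simp only: ecoord_basis_sum)

lemma ecoord_differential:
  "ecoord (differential i2 i3 \<Phi> p v) k = (\<Sum>j\<in>UNIV. partial_deriv j (Ucomp i2 i3 \<Phi> k) p * of_real (v $ j))"
  unfolding differential_def by (simp only: ecoord_basis_sum)

lemma G_monogenic_iff_cauchy_riemann:
  assumes "open \<Omega>"
  shows "G_monogenic \<Omega> \<Phi> \<longleftrightarrow> R_differentiable i2 i3 \<Omega> \<Phi> \<and>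
    (\<forall>p\<in>\<Omega>. partial_map i2 i3 2 \<Phi> p = mul i2 (partial_map i2 i3 1 \<Phi> p) \<and>
         partial_map i2 i3 3 \<Phi> p = mul i3 (partial_map i2 i3 1 \<Phi> p))"
proof -
  have i: "ecoord (mul i2 q) k = a k * ecoord q k" "ecoord (mul i3 q) k = b k * ecoord q k" for q k
    using ecoord_mul[of "axis 2 1" q k] ecoord_mul[of "axis 3 1" q k] by (simp_all add: zeta_axis)
  show ?thesis
    unfolding G_monogenic_iff_components xi_monogenic_iff_cauchy_riemann[OF assms]
      cquat_eq_ecoord[of "partial_map i2 i3 _ \<Phi> _"] i ecoord_partial_map R_differentiable_def by blast
qed

lemma G_monogenic_iff_H_monogenic:
  assumes "open \<Omega>"
  shows "G_monogenic \<Omega> \<Phi> \<longleftrightarrow> R_differentiable i2 i3 \<Omega> \<Phi> \<and> H_monogenic i2 i3 \<Omega> \<Phi> \<and>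
    (\<forall>p\<in>\<Omega>. \<forall>v. differential i2 i3 \<Phi> p v = mul (zeta i2 i3 v) (hausdorff_derivative i2 i3 \<Phi> p))"
    (is "_ \<longleftrightarrow> ?D \<and> ?H \<and> ?E")
proof
  assume G: "G_monogenic \<Omega> \<Phi>"
  then have cont: "continuous_on (zeta i2 i3 ` \<Omega>) \<Phi>" by (simp add: G_monogenic_def)
  from G have cr: "\<And>k p. p \<in> \<Omega> \<Longrightarrow> Ucomp i2 i3 \<Phi> k differentiable (at p) \<and>
     partial_deriv 2 (Ucomp i2 i3 \<Phi> k) p = a k * partial_deriv 1 (Ucomp i2 i3 \<Phi> k) p \<and>
     partial_deriv 3 (Ucomp i2 i3 \<Phi> k) p = b k * partial_deriv 1 (Ucomp i2 i3 \<Phi> k) p"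
    unfolding G_monogenic_iff_components xi_monogenic_iff_cauchy_riemann[OF assms] by blast
  have ?D using cr by (simp add: R_differentiable_def)
  have diff: "differential i2 i3 \<Phi> p v = mul (zeta i2 i3 v) (partial_map i2 i3 1 \<Phi> p)" if "p \<in> \<Omega>" for p v
    unfolding cquat_eq_ecoord ecoord_differential ecoord_mul ecoord_partial_map
    using cr[OF that] by (simp add: sum_3 xi_def algebra_simps)
  obtain A B where AB: "\<And>q h. mul h q = (\<Sum>s=1..16::nat. A q s * h * B q s)"
    using mul_sum by metis
  obtain w where w: "\<And>v. w (zeta i2 i3 v) = v" using zeta_left_inverse[OF inj] by metis
  have rep: "hausdorff_rep i2 i3 \<Phi> p (A (partial_map i2 i3 1 \<Phi> p)) (B (partial_map i2 i3 1 \<Phi> p))"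
    if "p \<in> \<Omega>" for p
    unfolding hausdorff_rep_def diff[OF that] AB by blast
  have partials: "has_partial_deriv j (Ucomp i2 i3 \<Phi> k) p" if "p \<in> \<Omega>" for p k j
    using cr[OF that, of k] partial_derivs_of_derivative(1) unfolding differentiable_def by blast
  have ?H
    unfolding H_monogenic_def
  proof (intro conjI cont ballI allI partials)
    show "\<exists>A B :: nat \<Rightarrow> cquat \<Rightarrow> cquat. \<forall>p\<in>\<Omega>.
        hausdorff_rep i2 i3 \<Phi> p (\<lambda>s. A s (zeta i2 i3 p)) (\<lambda>s. B s (zeta i2 i3 p))"
      by (rule exI[of _ "\<lambda>s q. A (partial_map i2 i3 1 \<Phi> (w q)) s"],
          rule exI[of _ "\<lambda>s q. B (partial_map i2 i3 1 \<Phi> (w q)) s"]) (simp add: w rep)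
  qed
  moreover have ?E using diff hausdorff_derivative_eq(2)[OF rep] by simp
  ultimately show "?D \<and> ?H \<and> ?E" using \<open>?D\<close> by blast
next
  assume R: "?D \<and> ?H \<and> ?E"
  have "partial_map i2 i3 2 \<Phi> p = mul i2 (partial_map i2 i3 1 \<Phi> p) \<and>
         partial_map i2 i3 3 \<Phi> p = mul i3 (partial_map i2 i3 1 \<Phi> p)" if p: "p \<in> \<Omega>" for p
  proof -
    obtain A B where "hausdorff_rep i2 i3 \<Phi> p A B" using R p unfolding H_monogenic_def by blast
    then have hd: "hausdorff_derivative i2 i3 \<Phi> p = partial_map i2 i3 1 \<Phi> p"
      by (rule hausdorff_derivative_eq(2))
    have "differential i2 i3 \<Phi> p (axis j 1) = partial_map i2 i3 j \<Phi> p" for j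
      unfolding cquat_eq_ecoord ecoord_differential ecoord_partial_map
      by (simp add: axis_def if_distrib[where f = complex_of_real] if_distrib[where f = "\<lambda>x. _ * x"] sum.delta' cong: if_cong)
    then show ?thesis using R p hd by (metis zeta_axis)
  qed
  then show "G_monogenic \<Omega> \<Phi>" unfolding G_monogenic_iff_cauchy_riemann[OF assms] using R by blast
qed

lemma G_monogenic_iff_power_series:
  assumes \<Omega>: "open \<Omega>" and surj: "\<And>k. surj (xi (a k) (b k))"
  shows "G_monogenic \<Omega> \<Phi> \<longleftrightarrow>
    (\<forall>\<zeta>0 \<in> zeta i2 i3 ` \<Omega>. \<exists>N c. openin (top_of_set (zeta i2 i3 ` \<Omega>)) N \<and> \<zeta>0 \<in> N \<and>
       (\<forall>\<zeta>\<in>N. (\<lambda>n. mul ((\<zeta> - \<zeta>0) ^ n) (c n)) sums \<Phi> \<zeta>))" (is "_ \<longleftrightarrow> ?R")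
proof -
  obtain w where w: "continuous_on UNIV w" "\<And>v. w (zeta i2 i3 v) = v"
    using zeta_left_inverse[OF inj] by blast
  have cz: "continuous_on UNIV (zeta i2 i3)"
    using linear_continuous_on[OF linear_conv_bounded_linear[THEN iffD1, OF linear_zeta]] .
  have sums_iff: "(\<lambda>n. mul ((zeta i2 i3 p - zeta i2 i3 p0) ^ n) (c n)) sums \<Phi> (zeta i2 i3 p) \<longleftrightarrow>
     (\<forall>k. (\<lambda>n. ecoord (c n) k * xi (a k) (b k) (p - p0) ^ n) sums Ucomp i2 i3 \<Phi> k p)" for p p0 c
    unfolding zeta_simps(2)[symmetric]
    by (subst sums_ecoord_iff) (simp only: ecoord_power Ucomp_def mult.commute)
  show ?thesis
  proof
    assume "G_monogenic \<Omega> \<Phi>"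
    then have G: "\<And>k p0. p0 \<in> \<Omega> \<Longrightarrow> \<exists>N c. open N \<and> p0 \<in> N \<and> N \<subseteq> \<Omega> \<and>
       (\<forall>p\<in>N. (\<lambda>n. c n * xi (a k) (b k) (p - p0) ^ n) sums Ucomp i2 i3 \<Phi> k p)"
      unfolding G_monogenic_iff_components xi_monogenic_iff_power_series[OF \<Omega> surj] by blast
    show ?R
    proof safe
      fix p0 assume "p0 \<in> \<Omega>"
      from G[OF this] obtain N c where N: "\<And>k. open (N k)" "\<And>k. p0 \<in> N k" "\<And>k. N k \<subseteq> \<Omega>"
        and c: "\<And>k p. p \<in> N k \<Longrightarrow> (\<lambda>n. c k n * xi (a k) (b k) (p - p0) ^ n) sums Ucomp i2 i3 \<Phi> k p"
        by metis
      define M where "M = (\<Inter>k. N k)"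
      have "open M" unfolding M_def by (intro open_INT ballI N(1)) simp
      moreover have "p0 \<in> M" using N(2) by (simp add: M_def)
      moreover have "M \<subseteq> N 1" unfolding M_def by (rule INT_lower) simp
      ultimately have M: "open M" "p0 \<in> M" "M \<subseteq> \<Omega>" using N(3)[of 1] by simp_all
      have "zeta i2 i3 ` M = zeta i2 i3 ` \<Omega> \<inter> w -` M" using M(3) by (auto simp: w(2) image_iff)
      then have opn: "openin (top_of_set (zeta i2 i3 ` \<Omega>)) (zeta i2 i3 ` M)"
        using open_vimage[OF M(1) w(1)] by (metis openin_open)
      have sums: "\<forall>\<zeta>\<in>zeta i2 i3 ` M.
          (\<lambda>n. mul ((\<zeta> - zeta i2 i3 p0) ^ n) (\<Sum>k\<in>UNIV. c k n *\<^sub>C ebas k)) sums \<Phi> \<zeta>"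
        using c unfolding ball_simps sums_iff ecoord_basis_sum M_def by blast
      show "\<exists>N c. openin (top_of_set (zeta i2 i3 ` \<Omega>)) N \<and> zeta i2 i3 p0 \<in> N \<and>
          (\<forall>\<zeta>\<in>N. (\<lambda>n. mul ((\<zeta> - zeta i2 i3 p0) ^ n) (c n)) sums \<Phi> \<zeta>)"
        by (rule exI[of _ "zeta i2 i3 ` M"], rule exI[of _ "\<lambda>n. \<Sum>k\<in>UNIV. c k n *\<^sub>C ebas k"])
          (intro conjI opn imageI M(2) sums)
    qed
  next
    assume R: ?R
    show "G_monogenic \<Omega> \<Phi>"
      unfolding G_monogenic_iff_components xi_monogenic_iff_power_series[OF \<Omega> surj]
    proof (intro allI ballI)
      fix k p0 assume "p0 \<in> \<Omega>"
      obtain N c where N: "openin (top_of_set (zeta i2 i3 ` \<Omega>)) N" "zeta i2 i3 p0 \<in> N"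
        and c: "\<And>\<zeta>. \<zeta> \<in> N \<Longrightarrow> (\<lambda>n. mul ((\<zeta> - zeta i2 i3 p0) ^ n) (c n)) sums \<Phi> \<zeta>"
        using bspec[OF R imageI[OF \<open>p0 \<in> \<Omega>\<close>]] by blast
      obtain T where T: "open T" "N = zeta i2 i3 ` \<Omega> \<inter> T" using N(1) by (auto simp: openin_open)
      define M where "M = \<Omega> \<inter> zeta i2 i3 -` T"
      have M: "open M" unfolding M_def by (intro open_Int \<Omega> open_vimage T(1) cz)
      have M': "p0 \<in> M" "M \<subseteq> \<Omega>" using N(2) T(2) \<open>p0 \<in> \<Omega>\<close> by (auto simp: M_def)
      have sums: "(\<lambda>n. ecoord (c n) k * xi (a k) (b k) (p - p0) ^ n) sums Ucomp i2 i3 \<Phi> k p" if "p \<in> M" for p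
      proof -
        have "zeta i2 i3 p \<in> N" using that by (auto simp: M_def T(2))
        from c[OF this] show ?thesis unfolding sums_iff by blast
      qed
      show "\<exists>N c. open N \<and> p0 \<in> N \<and> N \<subseteq> \<Omega> \<and>
         (\<forall>p\<in>N. (\<lambda>n. c n * xi (a k) (b k) (p - p0) ^ n) sums Ucomp i2 i3 \<Phi> k p)"
        by (rule exI[of _ M], rule exI[of _ "\<lambda>n. ecoord (c n) k"])
          (intro conjI M M' ballI sums)
    qed
  qed
qed

lemma G_monogenic_iff_triangles:
  assumes \<Omega>: "open \<Omega>" and surj: "\<And>k. surj (xi (a k) (b k))"
  shows "G_monogenic \<Omega> \<Phi> \<longleftrightarrow> continuous_on (zeta i2 i3 ` \<Omega>) \<Phi> \<and>
    (\<forall>p q r. \<not> collinear {p, q, r} \<and>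
         zeta i2 i3 ` (convex hull {p, q, r}) \<subseteq> zeta i2 i3 ` \<Omega> \<longrightarrow>
       curve_int (triangle_boundary p q r) \<Phi> = 0)"
  unfolding G_monogenic_iff_components xi_monogenic_iff_triangles[OF \<Omega> surj]
    continuous_on_zeta_iff inj_image_subset_iff[OF inj] cquat_eq_ecoord[of "curve_int _ _"] ecoord_curve_int ecoord_linear
  by blast

lemma G_monogenic_iff_analytic:
  assumes \<Omega>: "open \<Omega>" and surj: "\<And>k. surj (xi (a k) (b k))"
    and conv: "\<And>k. convex_in_direction (line_L (a k) (b k)) \<Omega>"
  shows "G_monogenic \<Omega> \<Phi> \<longleftrightarrow> (\<exists>F. \<forall>k. F k analytic_on xi (a k) (b k) ` \<Omega> \<and>
    (\<forall>p\<in>\<Omega>. Ucomp i2 i3 \<Phi> k p = F k (xi (a k) (b k) p)))" (is "_ \<longleftrightarrow> ?R")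
proof
  have opn: "open (xi (a k) (b k) ` \<Omega>)" for k
    by (rule open_surjective_linear_image[OF \<Omega> linear_xi surj])
  {
    assume "G_monogenic \<Omega> \<Phi>"
    then have "\<exists>g. g analytic_on xi (a k) (b k) ` \<Omega> \<and> (\<forall>p\<in>\<Omega>. Ucomp i2 i3 \<Phi> k p = g (xi (a k) (b k) p))" for k
      unfolding G_monogenic_iff_components analytic_on_open[OF opn]
      using xi_monogenic_imp_holomorphic_factor[OF _ \<Omega> surj conv] by metis
    then show ?R by metis
  next
    assume ?R
    then obtain F where F: "\<And>k. F k holomorphic_on xi (a k) (b k) ` \<Omega>"
      "\<And>k p. p \<in> \<Omega> \<Longrightarrow> Ucomp i2 i3 \<Phi> k p = F k (xi (a k) (b k) p)"
      unfolding analytic_on_open[OF opn] by blast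
    show "G_monogenic \<Omega> \<Phi>"
      unfolding G_monogenic_iff_components
      using holomorphic_factor_imp_has_derivative[OF \<Omega> opn order_refl F(1,2)]
      by (blast intro: has_derivative_imp_xi_monogenic)
  }
qed

end

section \<open>The right and the left case\<close>

lemma zeta_diagonal:
  assumes "i2 = a1 *\<^sub>C ebas 1 + a2 *\<^sub>C ebas 2" "i3 = b1 *\<^sub>C ebas 1 + b2 *\<^sub>C ebas 2"
  shows "zeta i2 i3 v = CQuat ((xi a1 b1 v + xi a2 b2 v) / 2) (\<i> * (xi a1 b1 v - xi a2 b2 v) / 2) 0 0"
  unfolding zeta_def assms xi_def ebas_explicit
  by (simp add: cquat_eq_iff scaleC_def scaleR_cquat_def plus_cquat_def one_cquat_def
      scaleR_conv_of_real field_simps)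

lemma ecoord_zeta_mult:
  assumes "i2 = a1 *\<^sub>C ebas 1 + a2 *\<^sub>C ebas 2" "i3 = b1 *\<^sub>C ebas 1 + b2 *\<^sub>C ebas 2"
  shows "ecoord (zeta i2 i3 v * q) k =
      xi (if k = 1 \<or> k = 3 then a1 else a2) (if k = 1 \<or> k = 3 then b1 else b2) v * ecoord q k"
    and "ecoord (q * zeta i2 i3 v) k =
      xi (if k = 1 \<or> k = 4 then a1 else a2) (if k = 1 \<or> k = 4 then b1 else b2) v * ecoord q k"
proof -
  define x y where "x = xi a1 b1 v" and "y = xi a2 b2 v"
  have z: "zeta i2 i3 v = CQuat ((x + y) / 2) (\<i> * (x - y) / 2) 0 0"
    unfolding x_def y_def by (rule zeta_diagonal[OF assms])
  have "ecoord (zeta i2 i3 v * q) 1 = x * ecoord q 1" "ecoord (zeta i2 i3 v * q) 2 = y * ecoord q 2"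
    "ecoord (zeta i2 i3 v * q) 3 = x * ecoord q 3" "ecoord (zeta i2 i3 v * q) 4 = y * ecoord q 4"
    unfolding z ecoord_explicit
    by (simp_all add: times_cquat_def field_simps)
  then show "ecoord (zeta i2 i3 v * q) k =
      xi (if k = 1 \<or> k = 3 then a1 else a2) (if k = 1 \<or> k = 3 then b1 else b2) v * ecoord q k"
    using exhaust_4[of k] by (auto simp: x_def y_def)
  have "ecoord (q * zeta i2 i3 v) 1 = x * ecoord q 1" "ecoord (q * zeta i2 i3 v) 2 = y * ecoord q 2"
    "ecoord (q * zeta i2 i3 v) 3 = y * ecoord q 3" "ecoord (q * zeta i2 i3 v) 4 = x * ecoord q 4"
    unfolding z ecoord_explicit
    by (simp_all add: times_cquat_def field_simps)
  then show "ecoord (q * zeta i2 i3 v) k =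
      xi (if k = 1 \<or> k = 4 then a1 else a2) (if k = 1 \<or> k = 4 then b1 else b2) v * ecoord q k"
    using exhaust_4[of k] by (auto simp: x_def y_def)
qed

lemma ecoord_scaleC: "ecoord (c *\<^sub>C q) k = c * ecoord q k"
  using exhaust_4[of k] by (auto simp: ecoord_explicit scaleC_def algebra_simps)

lemma ecoord_ebas: "ecoord (ebas k) j = (if j = k then 1 else 0)"
  using exhaust_4[of k] exhaust_4[of j] by (auto simp: ecoord_explicit ebas_explicit)

lemma e3_product_right:
  assumes i: "i2 = a1 *\<^sub>C ebas 1 + a2 *\<^sub>C ebas 2" "i3 = b1 *\<^sub>C ebas 1 + b2 *\<^sub>C ebas 2"
    and "inj (zeta i2 i3)"
  shows "e3_product i2 i3 (\<lambda>k. if k = 1 \<or> k = 3 then a1 else a2) (\<lambda>k. if k = 1 \<or> k = 3 then b1 else b2)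
     (*) (integral_dz_left i2 i3)"
    (is "e3_product _ _ ?a ?b _ _")
proof
  show "inj (zeta i2 i3)" by fact
  show pow: "ecoord (zeta i2 i3 v ^ n * q) k = xi (?a k) (?b k) v ^ n * ecoord q k" for v n q k
    by (induction n) (simp_all add: mult.assoc ecoord_zeta_mult(1)[OF i])
  show "\<exists>A B. \<forall>h. h * q = (\<Sum>s=1..16::nat. A s * h * B s)" for q :: cquat
    by (rule exI[of _ "\<lambda>s :: nat. if s = 1 then 1 :: cquat else 0"], rule exI[of _ "\<lambda>s :: nat. if s = 1 then q else 0"])
      (simp add: if_distrib[where f = "\<lambda>x. x * _"] if_distrib[where f = "\<lambda>x. _ * x"] cong: if_cong)
  show "ecoord (integral_dz_left i2 i3 \<gamma> \<Psi>) k = line_integral 1 \<gamma> (Ucomp i2 i3 \<Psi> k) +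
      ?a k * line_integral 2 \<gamma> (Ucomp i2 i3 \<Psi> k) + ?b k * line_integral 3 \<gamma> (Ucomp i2 i3 \<Psi> k)" for \<gamma> \<Psi> k
  proof -
    have "ecoord (i2 * q) k = ?a k * ecoord q k" "ecoord (i3 * q) k = ?b k * ecoord q k" for q k
      using ecoord_zeta_mult(1)[OF i, of "axis 2 1" q k] ecoord_zeta_mult(1)[OF i, of "axis 3 1" q k]
      unfolding zeta_axis xi_axis by blast+
    then show ?thesis
      unfolding integral_dz_left_def ecoord_linear ecoord_scaleC ecoord_ebas
      using exhaust_4[of k] by (auto simp: sum_4 algebra_simps ecoord_ebas)
  qed
qed

lemma e3_product_left:
  assumes i: "i2 = a1 *\<^sub>C ebas 1 + a2 *\<^sub>C ebas 2" "i3 = b1 *\<^sub>C ebas 1 + b2 *\<^sub>C ebas 2"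
    and "inj (zeta i2 i3)"
  shows "e3_product i2 i3 (\<lambda>k. if k = 1 \<or> k = 4 then a1 else a2) (\<lambda>k. if k = 1 \<or> k = 4 then b1 else b2)
     (\<lambda>h q. q * h) (integral_dz_right i2 i3)"
    (is "e3_product _ _ ?a ?b _ _")
proof
  show "inj (zeta i2 i3)" by fact
  show pow: "ecoord (q * zeta i2 i3 v ^ n) k = xi (?a k) (?b k) v ^ n * ecoord q k" for v n q k
    by (induction n arbitrary: q) (simp_all add: mult.assoc[symmetric] ecoord_zeta_mult(2)[OF i] del: mult.assoc)
  show "\<exists>A B. \<forall>h. q * h = (\<Sum>s=1..16::nat. A s * h * B s)" for q :: cquat
    by (rule exI[of _ "\<lambda>s :: nat. if s = 1 then q else 0"], rule exI[of _ "\<lambda>s :: nat. if s = 1 then 1 :: cquat else 0"])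
      (simp add: if_distrib[where f = "\<lambda>x. x * _"] if_distrib[where f = "\<lambda>x. _ * x"] cong: if_cong)
  show "ecoord (integral_dz_right i2 i3 \<gamma> \<Psi>) k = line_integral 1 \<gamma> (Ucomp i2 i3 \<Psi> k) +
      ?a k * line_integral 2 \<gamma> (Ucomp i2 i3 \<Psi> k) + ?b k * line_integral 3 \<gamma> (Ucomp i2 i3 \<Psi> k)" for \<gamma> \<Psi> k
  proof -
    have "ecoord (q * i2) k = ?a k * ecoord q k" "ecoord (q * i3) k = ?b k * ecoord q k" for q k
      using ecoord_zeta_mult(2)[OF i, of q "axis 2 1" k] ecoord_zeta_mult(2)[OF i, of q "axis 3 1" k]
      unfolding zeta_axis xi_axis by blast+
    then show ?thesis
      unfolding integral_dz_right_def ecoord_linear ecoord_scaleC ecoord_ebas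
      using exhaust_4[of k] by (auto simp: sum_4 algebra_simps ecoord_ebas)
  qed
qed

lemma eq_basis_combination_iff:
  "q = c1 *\<^sub>C ebas 1 + c2 *\<^sub>C ebas 2 + c3 *\<^sub>C ebas 3 + c4 *\<^sub>C ebas 4 \<longleftrightarrow>
     ecoord q 1 = c1 \<and> ecoord q 2 = c2 \<and> ecoord q 3 = c3 \<and> ecoord q 4 = c4"
  unfolding cquat_eq_ecoord[of q] forall_4 by (simp add: ecoord_scaleC ecoord_ebas)

lemma right_analytic_rep_iff_components:
  assumes "i2 = a1 *\<^sub>C ebas 1 + a2 *\<^sub>C ebas 2" "i3 = b1 *\<^sub>C ebas 1 + b2 *\<^sub>C ebas 2"
  shows "right_analytic_rep a1 a2 b1 b2 \<Omega> \<Phi> F1 F2 F3 F4 \<longleftrightarrow>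
    F1 analytic_on xi a1 b1 ` \<Omega> \<and> F2 analytic_on xi a2 b2 ` \<Omega> \<and>
    F3 analytic_on xi a1 b1 ` \<Omega> \<and> F4 analytic_on xi a2 b2 ` \<Omega> \<and>
    (\<forall>p\<in>\<Omega>. Ucomp i2 i3 \<Phi> 1 p = F1 (xi a1 b1 p) \<and> Ucomp i2 i3 \<Phi> 2 p = F2 (xi a2 b2 p) \<and>
       Ucomp i2 i3 \<Phi> 3 p = F3 (xi a1 b1 p) \<and> Ucomp i2 i3 \<Phi> 4 p = F4 (xi a2 b2 p))"
  unfolding right_analytic_rep_def eq_basis_combination_iff Ucomp_def assms ..

lemma left_analytic_rep_iff_components:
  assumes "i2 = a1 *\<^sub>C ebas 1 + a2 *\<^sub>C ebas 2" "i3 = b1 *\<^sub>C ebas 1 + b2 *\<^sub>C ebas 2"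
  shows "left_analytic_rep a1 a2 b1 b2 \<Omega> \<Phi> F1 F2 F3 F4 \<longleftrightarrow>
    F1 analytic_on xi a1 b1 ` \<Omega> \<and> F2 analytic_on xi a2 b2 ` \<Omega> \<and>
    F3 analytic_on xi a2 b2 ` \<Omega> \<and> F4 analytic_on xi a1 b1 ` \<Omega> \<and>
    (\<forall>p\<in>\<Omega>. Ucomp i2 i3 \<Phi> 1 p = F1 (xi a1 b1 p) \<and> Ucomp i2 i3 \<Phi> 2 p = F2 (xi a2 b2 p) \<and>
       Ucomp i2 i3 \<Phi> 3 p = F3 (xi a2 b2 p) \<and> Ucomp i2 i3 \<Phi> 4 p = F4 (xi a1 b1 p))"
  unfolding left_analytic_rep_def eq_basis_combination_iff Ucomp_def assms ..

lemma ex_index4: "(\<exists>F :: 4 \<Rightarrow> 'a. P (F 1) (F 2) (F 3) (F 4)) \<longleftrightarrow> (\<exists>F1 F2 F3 F4. P F1 F2 F3 F4)"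
proof
  assume "\<exists>F1 F2 F3 F4. P F1 F2 F3 F4"
  then obtain F1 F2 F3 F4 where "P F1 F2 F3 F4" by blast
  then show "\<exists>F :: 4 \<Rightarrow> 'a. P (F 1) (F 2) (F 3) (F 4)"
    by (intro exI[of _ "\<lambda>k. if k = 1 then F1 else if k = 2 then F2 else if k = 3 then F3 else F4"]) simp
qed blast

text \<open>The four functions are determined on the images of \<open>\<Omega>\<close> by the values of the mapping, so uniqueness comes
for free once they exist; the same holds on the left.\<close>

lemma right_analytic_iff:
  assumes "i2 = a1 *\<^sub>C ebas 1 + a2 *\<^sub>C ebas 2" "i3 = b1 *\<^sub>C ebas 1 + b2 *\<^sub>C ebas 2"
  shows "(\<exists>F. \<forall>k. F k analytic_on xi (if k = 1 \<or> k = 3 then a1 else a2) (if k = 1 \<or> k = 3 then b1 else b2) ` \<Omega> \<and>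
       (\<forall>p\<in>\<Omega>. Ucomp i2 i3 \<Phi> k p = F k (xi (if k = 1 \<or> k = 3 then a1 else a2) (if k = 1 \<or> k = 3 then b1 else b2) p)))
     \<longleftrightarrow> (\<exists>F1 F2 F3 F4.
           right_analytic_rep a1 a2 b1 b2 \<Omega> \<Phi> F1 F2 F3 F4 \<and>
           (\<forall>H1 H2 H3 H4.
              right_analytic_rep a1 a2 b1 b2 \<Omega> \<Phi> H1 H2 H3 H4 \<longrightarrow>
              (\<forall>\<xi> \<in> xi a1 b1 ` \<Omega>. H1 \<xi> = F1 \<xi> \<and> H3 \<xi> = F3 \<xi>) \<and>
              (\<forall>\<xi> \<in> xi a2 b2 ` \<Omega>. H2 \<xi> = F2 \<xi> \<and> H4 \<xi> = F4 \<xi>)))" (is "?L \<longleftrightarrow> ?R")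
proof -
  have "?L \<longleftrightarrow> (\<exists>F1 F2 F3 F4. right_analytic_rep a1 a2 b1 b2 \<Omega> \<Phi> F1 F2 F3 F4)"
    unfolding right_analytic_rep_iff_components[OF assms] ex_index4[symmetric] forall_4
    by (intro ex_cong1) auto
  also have "\<dots> \<longleftrightarrow> ?R"
    unfolding right_analytic_rep_iff_components[OF assms] by (intro ex_cong1) auto
  finally show ?thesis .
qed

lemma left_analytic_iff:
  assumes "i2 = a1 *\<^sub>C ebas 1 + a2 *\<^sub>C ebas 2" "i3 = b1 *\<^sub>C ebas 1 + b2 *\<^sub>C ebas 2"
  shows "(\<exists>F. \<forall>k. F k analytic_on xi (if k = 1 \<or> k = 4 then a1 else a2) (if k = 1 \<or> k = 4 then b1 else b2) ` \<Omega> \<and>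
       (\<forall>p\<in>\<Omega>. Ucomp i2 i3 \<Phi> k p = F k (xi (if k = 1 \<or> k = 4 then a1 else a2) (if k = 1 \<or> k = 4 then b1 else b2) p)))
     \<longleftrightarrow> (\<exists>F1 F2 F3 F4.
           left_analytic_rep a1 a2 b1 b2 \<Omega> \<Phi> F1 F2 F3 F4 \<and>
           (\<forall>H1 H2 H3 H4.
              left_analytic_rep a1 a2 b1 b2 \<Omega> \<Phi> H1 H2 H3 H4 \<longrightarrow>
              (\<forall>\<xi> \<in> xi a1 b1 ` \<Omega>. H1 \<xi> = F1 \<xi> \<and> H4 \<xi> = F4 \<xi>) \<and>
              (\<forall>\<xi> \<in> xi a2 b2 ` \<Omega>. H2 \<xi> = F2 \<xi> \<and> H3 \<xi> = F3 \<xi>)))" (is "?L \<longleftrightarrow> ?R")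
proof -
  have "?L \<longleftrightarrow> (\<exists>F1 F2 F3 F4. left_analytic_rep a1 a2 b1 b2 \<Omega> \<Phi> F1 F2 F3 F4)"
    unfolding left_analytic_rep_iff_components[OF assms] ex_index4[symmetric] forall_4
    by (intro ex_cong1) auto
  also have "\<dots> \<longleftrightarrow> ?R"
    unfolding left_analytic_rep_iff_components[OF assms] by (intro ex_cong1) auto
  finally show ?thesis .
qed

theorem mainTheorem3:
  fixes a1 a2 b1 b2 :: complex
    and i2 i3 :: cquat
    and \<Omega> :: "(real^3) set"
    and \<Phi> \<Phi>h :: "cquat \<Rightarrow> cquat"
  assumes "i2 = a1 *\<^sub>C ebas 1 + a2 *\<^sub>C ebas 2"
    and "i3 = b1 *\<^sub>C ebas 1 + b2 *\<^sub>C ebas 2"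
    and "distinct [1, i2, i3]" and "independent {1, i2, i3}"
    and "open \<Omega>" and "connected \<Omega>" and "\<Omega> \<noteq> {}"
  shows
    "((right_G_monogenic i2 i3 \<Omega> \<Phi> \<longleftrightarrow>
        R_differentiable i2 i3 \<Omega> \<Phi> \<and>
        (\<forall>p\<in>\<Omega>. partial_map i2 i3 2 \<Phi> p = i2 * partial_map i2 i3 1 \<Phi> p \<and>
             partial_map i2 i3 3 \<Phi> p = i3 * partial_map i2 i3 1 \<Phi> p)) \<and>
       (left_G_monogenic i2 i3 \<Omega> \<Phi>h \<longleftrightarrow>
        R_differentiable i2 i3 \<Omega> \<Phi>h \<and>
        (\<forall>p\<in>\<Omega>. partial_map i2 i3 2 \<Phi>h p = partial_map i2 i3 1 \<Phi>h p * i2 \<and>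
             partial_map i2 i3 3 \<Phi>h p = partial_map i2 i3 1 \<Phi>h p * i3)) \<and>
       (right_G_monogenic i2 i3 \<Omega> \<Phi> \<longleftrightarrow>
        R_differentiable i2 i3 \<Omega> \<Phi> \<and> right_H_monogenic i2 i3 \<Omega> \<Phi>) \<and>
       (left_G_monogenic i2 i3 \<Omega> \<Phi>h \<longleftrightarrow>
        R_differentiable i2 i3 \<Omega> \<Phi>h \<and> left_H_monogenic i2 i3 \<Omega> \<Phi>h))
     \<and>
     (f1 ` E3 i2 i3 = UNIV \<and> f2 ` E3 i2 i3 = UNIV \<longrightarrow>
       (right_G_monogenic i2 i3 \<Omega> \<Phi> \<longleftrightarrow>
        (\<forall>\<zeta>0 \<in> zeta i2 i3 ` \<Omega>. \<exists>N c. openin (top_of_set (zeta i2 i3 ` \<Omega>)) N \<and> \<zeta>0 \<in> N \<and>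
           (\<forall>\<zeta>\<in>N. (\<lambda>n. (\<zeta> - \<zeta>0) ^ n * c n) sums \<Phi> \<zeta>))) \<and>
       (left_G_monogenic i2 i3 \<Omega> \<Phi>h \<longleftrightarrow>
        (\<forall>\<zeta>0 \<in> zeta i2 i3 ` \<Omega>. \<exists>N c. openin (top_of_set (zeta i2 i3 ` \<Omega>)) N \<and> \<zeta>0 \<in> N \<and>
           (\<forall>\<zeta>\<in>N. (\<lambda>n. c n * (\<zeta> - \<zeta>0) ^ n) sums \<Phi>h \<zeta>))) \<and>
       (right_G_monogenic i2 i3 \<Omega> \<Phi> \<longleftrightarrow>
        continuous_on (zeta i2 i3 ` \<Omega>) \<Phi> \<and>
        (\<forall>p q r. \<not> collinear {p, q, r} \<and>
             zeta i2 i3 ` (convex hull {p, q, r}) \<subseteq> zeta i2 i3 ` \<Omega> \<longrightarrow>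
           integral_dz_left i2 i3 (triangle_boundary p q r) \<Phi> = 0)) \<and>
       (left_G_monogenic i2 i3 \<Omega> \<Phi>h \<longleftrightarrow>
        continuous_on (zeta i2 i3 ` \<Omega>) \<Phi>h \<and>
        (\<forall>p q r. \<not> collinear {p, q, r} \<and>
             zeta i2 i3 ` (convex hull {p, q, r}) \<subseteq> zeta i2 i3 ` \<Omega> \<longrightarrow>
           integral_dz_right i2 i3 (triangle_boundary p q r) \<Phi>h = 0)))
     \<and>
     (f1 ` E3 i2 i3 = UNIV \<and> f2 ` E3 i2 i3 = UNIV \<and>
      convex_in_direction (line_L a1 b1) \<Omega> \<and> convex_in_direction (line_L a2 b2) \<Omega> \<longrightarrow>
       (right_G_monogenic i2 i3 \<Omega> \<Phi> \<longleftrightarrow>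
        (\<exists>F1 F2 F3 F4.
           right_analytic_rep a1 a2 b1 b2 \<Omega> \<Phi> F1 F2 F3 F4 \<and>
           (\<forall>H1 H2 H3 H4.
              right_analytic_rep a1 a2 b1 b2 \<Omega> \<Phi> H1 H2 H3 H4 \<longrightarrow>
              (\<forall>\<xi> \<in> xi a1 b1 ` \<Omega>. H1 \<xi> = F1 \<xi> \<and> H3 \<xi> = F3 \<xi>) \<and>
              (\<forall>\<xi> \<in> xi a2 b2 ` \<Omega>. H2 \<xi> = F2 \<xi> \<and> H4 \<xi> = F4 \<xi>)))) \<and>
       (left_G_monogenic i2 i3 \<Omega> \<Phi>h \<longleftrightarrow>
        (\<exists>F1 F2 F3 F4.
           left_analytic_rep a1 a2 b1 b2 \<Omega> \<Phi>h F1 F2 F3 F4 \<and>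
           (\<forall>H1 H2 H3 H4.
              left_analytic_rep a1 a2 b1 b2 \<Omega> \<Phi>h H1 H2 H3 H4 \<longrightarrow>
              (\<forall>\<xi> \<in> xi a1 b1 ` \<Omega>. H1 \<xi> = F1 \<xi> \<and> H4 \<xi> = F4 \<xi>) \<and>
              (\<forall>\<xi> \<in> xi a2 b2 ` \<Omega>. H2 \<xi> = F2 \<xi> \<and> H3 \<xi> = F3 \<xi>)))))"
proof -
  note i = assms(1,2) and \<Omega> = \<open>open \<Omega>\<close>
  have inj: "inj (zeta i2 i3)" using assms(3,4) by (rule independent_imp_inj_zeta)
  interpret R: e3_product i2 i3 "\<lambda>k. if k = 1 \<or> k = 3 then a1 else a2" "\<lambda>k. if k = 1 \<or> k = 3 then b1 else b2"
    "(*)" "integral_dz_left i2 i3"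
    by (rule e3_product_right[OF i inj])
  interpret L: e3_product i2 i3 "\<lambda>k. if k = 1 \<or> k = 4 then a1 else a2" "\<lambda>k. if k = 1 \<or> k = 4 then b1 else b2"
    "\<lambda>h q. q * h" "integral_dz_right i2 i3"
    by (rule e3_product_left[OF i inj])
  have R: "right_G_monogenic i2 i3 \<Omega> \<Phi> \<longleftrightarrow> R.G_monogenic \<Omega> \<Phi>"
    unfolding right_G_monogenic_def R.G_monogenic_def ..
  have L: "left_G_monogenic i2 i3 \<Omega> \<Phi>h \<longleftrightarrow> L.G_monogenic \<Omega> \<Phi>h"
    unfolding left_G_monogenic_def L.G_monogenic_def ..
  have surj: "surj (xi a1 b1)" "surj (xi a2 b2)" if "f1 ` E3 i2 i3 = UNIV \<and> f2 ` E3 i2 i3 = UNIV"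
    using that unfolding E3_def image_image f1_f2_zeta[OF i] by blast+
  show ?thesis
  proof (intro conjI impI)
    show "right_G_monogenic i2 i3 \<Omega> \<Phi> \<longleftrightarrow> R_differentiable i2 i3 \<Omega> \<Phi> \<and>
        (\<forall>p\<in>\<Omega>. partial_map i2 i3 2 \<Phi> p = i2 * partial_map i2 i3 1 \<Phi> p \<and>
             partial_map i2 i3 3 \<Phi> p = i3 * partial_map i2 i3 1 \<Phi> p)"
      unfolding R by (rule R.G_monogenic_iff_cauchy_riemann[OF \<Omega>])
    show "left_G_monogenic i2 i3 \<Omega> \<Phi>h \<longleftrightarrow> R_differentiable i2 i3 \<Omega> \<Phi>h \<and>
        (\<forall>p\<in>\<Omega>. partial_map i2 i3 2 \<Phi>h p = partial_map i2 i3 1 \<Phi>h p * i2 \<and>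
             partial_map i2 i3 3 \<Phi>h p = partial_map i2 i3 1 \<Phi>h p * i3)"
      unfolding L by (rule L.G_monogenic_iff_cauchy_riemann[OF \<Omega>])
    show "right_G_monogenic i2 i3 \<Omega> \<Phi> \<longleftrightarrow> R_differentiable i2 i3 \<Omega> \<Phi> \<and> right_H_monogenic i2 i3 \<Omega> \<Phi>"
      unfolding R right_H_monogenic_def by (rule R.G_monogenic_iff_H_monogenic[OF \<Omega>])
    show "left_G_monogenic i2 i3 \<Omega> \<Phi>h \<longleftrightarrow> R_differentiable i2 i3 \<Omega> \<Phi>h \<and> left_H_monogenic i2 i3 \<Omega> \<Phi>h"
      unfolding L left_H_monogenic_def by (rule L.G_monogenic_iff_H_monogenic[OF \<Omega>])
  next
    assume "f1 ` E3 i2 i3 = UNIV \<and> f2 ` E3 i2 i3 = UNIV"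
    then have surjR: "\<And>k :: 4. surj (xi (if k = 1 \<or> k = 3 then a1 else a2) (if k = 1 \<or> k = 3 then b1 else b2))"
      and surjL: "\<And>k :: 4. surj (xi (if k = 1 \<or> k = 4 then a1 else a2) (if k = 1 \<or> k = 4 then b1 else b2))"
      using surj by simp_all
    show "right_G_monogenic i2 i3 \<Omega> \<Phi> \<longleftrightarrow>
        (\<forall>\<zeta>0 \<in> zeta i2 i3 ` \<Omega>. \<exists>N c. openin (top_of_set (zeta i2 i3 ` \<Omega>)) N \<and> \<zeta>0 \<in> N \<and>
           (\<forall>\<zeta>\<in>N. (\<lambda>n. (\<zeta> - \<zeta>0) ^ n * c n) sums \<Phi> \<zeta>))"
      unfolding R by (rule R.G_monogenic_iff_power_series[OF \<Omega> surjR])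
    show "left_G_monogenic i2 i3 \<Omega> \<Phi>h \<longleftrightarrow>
        (\<forall>\<zeta>0 \<in> zeta i2 i3 ` \<Omega>. \<exists>N c. openin (top_of_set (zeta i2 i3 ` \<Omega>)) N \<and> \<zeta>0 \<in> N \<and>
           (\<forall>\<zeta>\<in>N. (\<lambda>n. c n * (\<zeta> - \<zeta>0) ^ n) sums \<Phi>h \<zeta>))"
      unfolding L by (rule L.G_monogenic_iff_power_series[OF \<Omega> surjL])
    show "right_G_monogenic i2 i3 \<Omega> \<Phi> \<longleftrightarrow> continuous_on (zeta i2 i3 ` \<Omega>) \<Phi> \<and>
        (\<forall>p q r. \<not> collinear {p, q, r} \<and>
             zeta i2 i3 ` (convex hull {p, q, r}) \<subseteq> zeta i2 i3 ` \<Omega> \<longrightarrow>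
           integral_dz_left i2 i3 (triangle_boundary p q r) \<Phi> = 0)"
      unfolding R by (rule R.G_monogenic_iff_triangles[OF \<Omega> surjR])
    show "left_G_monogenic i2 i3 \<Omega> \<Phi>h \<longleftrightarrow> continuous_on (zeta i2 i3 ` \<Omega>) \<Phi>h \<and>
        (\<forall>p q r. \<not> collinear {p, q, r} \<and>
             zeta i2 i3 ` (convex hull {p, q, r}) \<subseteq> zeta i2 i3 ` \<Omega> \<longrightarrow>
           integral_dz_right i2 i3 (triangle_boundary p q r) \<Phi>h = 0)"
      unfolding L by (rule L.G_monogenic_iff_triangles[OF \<Omega> surjL])
  next
    assume A: "f1 ` E3 i2 i3 = UNIV \<and> f2 ` E3 i2 i3 = UNIV \<and>
      convex_in_direction (line_L a1 b1) \<Omega> \<and> convex_in_direction (line_L a2 b2) \<Omega>"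
    then have convR: "\<And>k :: 4. convex_in_direction (line_L (if k = 1 \<or> k = 3 then a1 else a2) (if k = 1 \<or> k = 3 then b1 else b2)) \<Omega>"
      and convL: "\<And>k :: 4. convex_in_direction (line_L (if k = 1 \<or> k = 4 then a1 else a2) (if k = 1 \<or> k = 4 then b1 else b2)) \<Omega>"
      and surjR: "\<And>k :: 4. surj (xi (if k = 1 \<or> k = 3 then a1 else a2) (if k = 1 \<or> k = 3 then b1 else b2))"
      and surjL: "\<And>k :: 4. surj (xi (if k = 1 \<or> k = 4 then a1 else a2) (if k = 1 \<or> k = 4 then b1 else b2))"
      using surj by simp_all
    show "right_G_monogenic i2 i3 \<Omega> \<Phi> \<longleftrightarrow>
        (\<exists>F1 F2 F3 F4.
           right_analytic_rep a1 a2 b1 b2 \<Omega> \<Phi> F1 F2 F3 F4 \<and>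
           (\<forall>H1 H2 H3 H4.
              right_analytic_rep a1 a2 b1 b2 \<Omega> \<Phi> H1 H2 H3 H4 \<longrightarrow>
              (\<forall>\<xi> \<in> xi a1 b1 ` \<Omega>. H1 \<xi> = F1 \<xi> \<and> H3 \<xi> = F3 \<xi>) \<and>
              (\<forall>\<xi> \<in> xi a2 b2 ` \<Omega>. H2 \<xi> = F2 \<xi> \<and> H4 \<xi> = F4 \<xi>)))"
      unfolding R R.G_monogenic_iff_analytic[OF \<Omega> surjR convR] by (rule right_analytic_iff[OF i])
    show "left_G_monogenic i2 i3 \<Omega> \<Phi>h \<longleftrightarrow>
        (\<exists>F1 F2 F3 F4.
           left_analytic_rep a1 a2 b1 b2 \<Omega> \<Phi>h F1 F2 F3 F4 \<and>
           (\<forall>H1 H2 H3 H4.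
              left_analytic_rep a1 a2 b1 b2 \<Omega> \<Phi>h H1 H2 H3 H4 \<longrightarrow>
              (\<forall>\<xi> \<in> xi a1 b1 ` \<Omega>. H1 \<xi> = F1 \<xi> \<and> H4 \<xi> = F4 \<xi>) \<and>
              (\<forall>\<xi> \<in> xi a2 b2 ` \<Omega>. H2 \<xi> = F2 \<xi> \<and> H3 \<xi> = F3 \<xi>)))"
      unfolding L L.G_monogenic_iff_analytic[OF \<Omega> surjL convL] by (rule left_analytic_iff[OF i])
  qed
qed

end
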